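(* Let $l\geq 3$, $k\geq 5$ be two positive integers. Let $D\subset\mathbb{P}^2$ be a smooth plane curve of degree $k$ such that $\mathbb{P}^2\setminus D$ is Brody hyperbolic. Let $S$ be a generic small deformation of $2lD$. Then the double cover of $\mathbb{P}^2$ branched along $S$ is Brody hyperbolic.
   Context: We work over $\mathbb{C}$. A complex analytic space is called Brody hyperbolic if there are no non-constant holomorphic maps from $\mathbb{C}$ to it. Generic small deformation: let $m=2l$, let $s_1,\dots,s_N$ be a basis of $H^0(\mathbb{P}^2,\mathcal{O}(k))$ and let $s_D$ be a homogeneous polynomial of degree $k$ with $D=(s_D=0)$. A divisor $S\in|\mathcal{O}_{\mathbb{P}^2}(mk)|$ is a generic small deformation of $mD$ if $S$ is the zero locus of $$s_D^m+\sum_{i=1}^m F_i(s_1,\dots,s_N)\,s_D^{m-i}\,t^i$$ for generic choices of homogeneous polynomials $F_i$ of degree $i$ in $N$ variables ($1\le i\le m$) and for some $t\in\mathbb{C}\setminus\{0\}$ with $|t|\leq\epsilon$, where $\epsilon=\epsilon(\{F_i\})>0$ depends on the choice of $\{F_i\}$. Thus a property holds for a generic small deformation if, for all $(F_1,\dots,F_m)$ in some non-empty Zariski open subset of the parameter space, there is $\epsilon(\{F_i\})>0$ such that it holds for all $t$ with $0<|t|\le\epsilon$. The double cover of $\mathbb{P}^2$ branched along $S=(G=0)$, $\deg G=2lk$, is $\{y^2=G\}$ in the total space of $\mathcal{O}_{\mathbb{P}^2}(lk)$. *)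

theory Defs
  imports "HOL-Analysis.Analysis" "HOL-Library.Poly_Mapping"
begin

section \<open>Polynomials\<close>

text \<open>
  A polynomial is a finitely supported map from monomials to coefficients, and a monomial is a
  finitely supported map from variables to exponents; multiplication is the convolution product
  of HOL-Library.
\<close>

type_synonym ('v, 'a) mpoly = "('v \<Rightarrow>\<^sub>0 nat) \<Rightarrow>\<^sub>0 'a"

definition mpoly_const :: "'a::zero \<Rightarrow> ('v, 'a) mpoly" where
  "mpoly_const c = Poly_Mapping.single 0 c"

text \<open>
  Evaluation at a family \<open>x\<close> of elements of an algebra whose structure map is \<open>h\<close>. For \<open>h = id\<close>
  this is evaluation at a point, for \<open>h = mpoly_const\<close> it is substitution of polynomials.
\<close>

definition mpoly_eval_via ::
  "('a::zero \<Rightarrow> 'b::comm_semiring_1) \<Rightarrow> ('v \<Rightarrow> 'b) \<Rightarrow> ('v, 'a) mpoly \<Rightarrow> 'b" where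
  "mpoly_eval_via h x p =
     (\<Sum>\<alpha>\<in>Poly_Mapping.keys p. h (Poly_Mapping.lookup p \<alpha>) *
        (\<Prod>v\<in>Poly_Mapping.keys \<alpha>. x v ^ Poly_Mapping.lookup \<alpha> v))"

abbreviation mpoly_eval :: "('v \<Rightarrow> 'a::comm_semiring_1) \<Rightarrow> ('v, 'a) mpoly \<Rightarrow> 'a" where
  "mpoly_eval \<equiv> mpoly_eval_via id"

abbreviation mpoly_subst ::
  "('v \<Rightarrow> ('w, 'a::comm_semiring_1) mpoly) \<Rightarrow> ('v, 'a) mpoly \<Rightarrow> ('w, 'a) mpoly" where
  "mpoly_subst \<equiv> mpoly_eval_via mpoly_const"

definition monom_degree :: "('v \<Rightarrow>\<^sub>0 nat) \<Rightarrow> nat" where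
  "monom_degree \<alpha> = (\<Sum>v\<in>Poly_Mapping.keys \<alpha>. Poly_Mapping.lookup \<alpha> v)"

text \<open>Homogeneous polynomials of degree \<open>d\<close> in the variables \<open>V\<close>, including the zero polynomial.\<close>

definition forms :: "'v set \<Rightarrow> nat \<Rightarrow> ('v, 'a::zero) mpoly set" where
  "forms V d = {p. \<forall>\<alpha>\<in>Poly_Mapping.keys p. Poly_Mapping.keys \<alpha> \<subseteq> V \<and> monom_degree \<alpha> = d}"

definition mpoly_deriv :: "'v \<Rightarrow> ('v, 'a::comm_semiring_1) mpoly \<Rightarrow> ('v, 'a) mpoly" where
  "mpoly_deriv v p =
     (\<Sum>\<alpha>\<in>Poly_Mapping.keys p. Poly_Mapping.single (\<alpha> - Poly_Mapping.single v 1)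
        (of_nat (Poly_Mapping.lookup \<alpha> v) * Poly_Mapping.lookup p \<alpha>))"

definition mpoly_scale :: "'a::comm_semiring_1 \<Rightarrow> ('v, 'a) mpoly \<Rightarrow> ('v, 'a) mpoly" where
  "mpoly_scale c p = mpoly_const c * p"

interpretation mpoly: vector_space "mpoly_scale :: 'a::field \<Rightarrow> ('v, 'a) mpoly \<Rightarrow> ('v, 'a) mpoly"
proof
  fix a b :: 'a and p q :: "('v, 'a) mpoly"
  show "mpoly_scale a (p + q) = mpoly_scale a p + mpoly_scale a q"
    by (simp add: mpoly_scale_def distrib_left)
  show "mpoly_scale (a + b) p = mpoly_scale a p + mpoly_scale b p"
    by (simp add: mpoly_scale_def mpoly_const_def single_add distrib_right)
  show "mpoly_scale a (mpoly_scale b p) = mpoly_scale (a * b) p"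
    by (simp add: mpoly_scale_def mpoly_const_def mult_single flip: mult.assoc)
  show "mpoly_scale 1 p = p"
    by (simp add: mpoly_scale_def mpoly_const_def)
qed

text \<open>Sections of \<open>\<O>(d)\<close> on the projective plane are ternary forms of degree \<open>d\<close>.\<close>

type_synonym ternary_poly = "(3, complex) mpoly"

abbreviation ternary_forms :: "nat \<Rightarrow> ternary_poly set" where
  "ternary_forms d \<equiv> forms UNIV d"

definition basis_of_ternary_forms :: "nat \<Rightarrow> nat \<Rightarrow> (nat \<Rightarrow> ternary_poly) \<Rightarrow> bool" where
  "basis_of_ternary_forms k N s \<longleftrightarrow>
     inj_on s {..<N} \<and> mpoly.independent (s ` {..<N}) \<and> mpoly.span (s ` {..<N}) = ternary_forms k"

lemma mpoly_eval_forms: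
  assumes "p \<in> forms V d"
  shows "mpoly_eval (\<lambda>v. c * x v) p = c ^ d * mpoly_eval x p"
  unfolding mpoly_eval_via_def sum_distrib_left
proof (rule sum.cong)
  fix \<alpha> assume "\<alpha> \<in> Poly_Mapping.keys p"
  then have "d = monom_degree \<alpha>"
    using assms by (auto simp: forms_def)
  then show "id (Poly_Mapping.lookup p \<alpha>) *
        (\<Prod>v\<in>Poly_Mapping.keys \<alpha>. (c * x v) ^ Poly_Mapping.lookup \<alpha> v) =
      c ^ d * (id (Poly_Mapping.lookup p \<alpha>) *
        (\<Prod>v\<in>Poly_Mapping.keys \<alpha>. x v ^ Poly_Mapping.lookup \<alpha> v))"
    by (simp add: power_mult_distrib prod.distrib monom_degree_def power_sum mult_ac)
qed simp

section \<open>Brody hyperbolicity\<close>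

text \<open>
  A chart is a domain together with the set of its coordinate functions. For an atlas of a complex
  manifold, a map from the complex plane is holomorphic iff near each point it stays in the domain
  of some chart and has holomorphic coordinates there. Since the plane is reduced, the holomorphic
  maps into an open subspace, or into a closed analytic subspace, are the holomorphic maps into the
  manifold with image in the underlying set; hence \<open>brody_hyperbolic A X\<close> for such a subspace \<open>X\<close> of
  the manifold with atlas \<open>A\<close>.
\<close>

type_synonym 'p chart = "'p set \<times> ('p \<Rightarrow> complex) set"

definition entire_curve :: "'p chart set \<Rightarrow> (complex \<Rightarrow> 'p) \<Rightarrow> bool" where
  "entire_curve A f \<longleftrightarrow>
     (\<forall>z. \<exists>(U, \<Phi>)\<in>A. \<exists>r>0. f ` ball z r \<subseteq> U \<and> (\<forall>\<phi>\<in>\<Phi>. (\<phi> \<circ> f) holomorphic_on ball z r))"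

definition brody_hyperbolic :: "'p chart set \<Rightarrow> 'p set \<Rightarrow> bool" where
  "brody_hyperbolic A X \<longleftrightarrow>
     (\<forall>f. entire_curve A f \<and> range f \<subseteq> X \<longrightarrow> f constant_on UNIV)"

section \<open>The projective plane\<close>

definition proj_rel :: "((complex ^ 3) \<times> (complex ^ 3)) set" where
  "proj_rel = {(x, x'). x \<noteq> 0 \<and> (\<exists>c. c \<noteq> 0 \<and> x' = c *s x)}"

definition P2 :: "(complex ^ 3) set set" where
  "P2 = {x. x \<noteq> 0} // proj_rel"

lemma equiv_proj_rel: "equiv {x. x \<noteq> 0} proj_rel"
proof (rule equivI)
  show "proj_rel \<subseteq> {x. x \<noteq> 0} \<times> {x. x \<noteq> 0}"
    by (auto simp: proj_rel_def)
  show "refl_on {x. x \<noteq> 0} proj_rel"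
    by (auto simp: refl_on_def proj_rel_def intro: exI[of _ 1])
  show "sym proj_rel"
  proof (rule symI)
    fix x x' assume "(x, x') \<in> proj_rel"
    then obtain c where c: "x \<noteq> 0" "c \<noteq> 0" "x' = c *s x"
      by (auto simp: proj_rel_def)
    then have "x = inverse c *s x'" "x' \<noteq> 0" "inverse c \<noteq> 0"
      by simp_all
    then show "(x', x) \<in> proj_rel"
      unfolding proj_rel_def by blast
  qed
  show "trans proj_rel"
  proof (rule transI)
    fix x y z assume "(x, y) \<in> proj_rel" "(y, z) \<in> proj_rel"
    then obtain c d where "x \<noteq> 0" "d * c \<noteq> 0" "z = (d * c) *s x"
      by (auto simp: proj_rel_def)
    then show "(x, z) \<in> proj_rel"
      unfolding proj_rel_def by blast
  qed
qed

text \<open>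
  The standard affine charts: on \<open>x\<^sub>i \<noteq> 0\<close> the coordinates are \<open>x\<^sub>j / x\<^sub>i\<close> for \<open>j \<noteq> i\<close>. The value at a
  point is the common value on all its representatives.
\<close>

definition P2_chart :: "3 \<Rightarrow> (complex ^ 3) set chart" where
  "P2_chart i =
     ({p \<in> P2. \<forall>x\<in>p. x $ i \<noteq> 0}, {\<lambda>p. the_elem ((\<lambda>x. x $ j / x $ i) ` p) | j. j \<noteq> i})"

definition P2_atlas :: "(complex ^ 3) set chart set" where
  "P2_atlas = range P2_chart"

lemma P2_coordinate:
  assumes "p \<in> P2" and "x \<in> p"
  shows "the_elem ((\<lambda>x. x $ j / x $ i) ` p) = x $ j / x $ i"
proof -
  have "x' $ j / x' $ i = x $ j / x $ i" if "x' \<in> p" for x'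
  proof -
    have "(x, x') \<in> proj_rel"
      using quotient_eq_iff[OF equiv_proj_rel] assms that unfolding P2_def by blast
    then show ?thesis
      by (auto simp: proj_rel_def)
  qed
  moreover have "p \<noteq> {}" using assms(2) by blast
  ultimately show ?thesis by (intro the_elem_image_unique)
qed

definition plane_curve :: "ternary_poly \<Rightarrow> (complex ^ 3) set set" where
  "plane_curve q = {p \<in> P2. \<forall>x\<in>p. mpoly_eval (($) x) q = 0}"

text \<open>The Jacobian criterion in homogeneous coordinates; it excludes \<open>q = 0\<close> and repeated factors.\<close>

definition smooth_plane_curve :: "nat \<Rightarrow> ternary_poly \<Rightarrow> bool" where
  "smooth_plane_curve k q \<longleftrightarrow>
     q \<in> ternary_forms k \<and>
     (\<forall>x. x \<noteq> 0 \<and> mpoly_eval (($) x) q = 0 \<longrightarrow> (\<exists>i. mpoly_eval (($) x) (mpoly_deriv i q) \<noteq> 0))"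

section \<open>Double covers\<close>

text \<open>
  The total space of \<open>\<O>(d)\<close>, as the quotient of pairs \<open>(x, y)\<close> with \<open>x \<noteq> 0\<close> by
  \<open>(x, y) \<sim> (c x, c\<^sup>d y)\<close>. A form \<open>q\<close> of degree \<open>d\<close> gives the section sending the class of \<open>x\<close> to the
  class of \<open>(x, q(x))\<close>, and on \<open>x\<^sub>i \<noteq> 0\<close> the fibre coordinate for the frame \<open>x\<^sub>i\<^sup>d\<close> is \<open>y / x\<^sub>i\<^sup>d\<close>.
\<close>

definition O_rel :: "nat \<Rightarrow> (((complex ^ 3) \<times> complex) \<times> ((complex ^ 3) \<times> complex)) set" where
  "O_rel d = {((x, y), (x', y')). x \<noteq> 0 \<and> (\<exists>c. c \<noteq> 0 \<and> x' = c *s x \<and> y' = c ^ d * y)}"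

definition O_total :: "nat \<Rightarrow> ((complex ^ 3) \<times> complex) set set" where
  "O_total d = {(x, y). x \<noteq> 0} // O_rel d"

lemma equiv_O_rel: "equiv {(x, y). x \<noteq> 0} (O_rel d)"
proof (rule equivI)
  show "O_rel d \<subseteq> {(x, y). x \<noteq> 0} \<times> {(x, y). x \<noteq> 0}"
    by (auto simp: O_rel_def)
  show "refl_on {(x, y). x \<noteq> 0} (O_rel d)"
    by (auto simp: refl_on_def O_rel_def intro: exI[of _ 1])
  show "sym (O_rel d)"
  proof (rule symI, clarify)
    fix x x' y y' assume "((x, y), (x', y')) \<in> O_rel d"
    then obtain c where c: "x \<noteq> 0" "c \<noteq> 0" "x' = c *s x" "y' = c ^ d * y"
      by (auto simp: O_rel_def)
    then have "x = inverse c *s x'" "x' \<noteq> 0" "inverse c \<noteq> 0" "y = inverse c ^ d * y'"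
      by (simp_all add: power_inverse)
    then show "((x', y'), (x, y)) \<in> O_rel d"
      unfolding O_rel_def by blast
  qed
  show "trans (O_rel d)"
  proof (rule transI, clarify)
    fix x1 y1 x2 y2 x3 y3
    assume "((x1, y1), (x2, y2)) \<in> O_rel d" "((x2, y2), (x3, y3)) \<in> O_rel d"
    then obtain c e where "x1 \<noteq> 0" "e * c \<noteq> 0" "x3 = (e * c) *s x1" "y3 = (e * c) ^ d * y1"
      by (auto simp: O_rel_def power_mult_distrib)
    then show "((x1, y1), (x3, y3)) \<in> O_rel d"
      unfolding O_rel_def by blast
  qed
qed

definition O_chart :: "nat \<Rightarrow> 3 \<Rightarrow> ((complex ^ 3) \<times> complex) set chart" where
  "O_chart d i =
     ({w \<in> O_total d. \<forall>(x, y)\<in>w. x $ i \<noteq> 0},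
      insert (\<lambda>w. the_elem ((\<lambda>(x, y). y / x $ i ^ d) ` w))
        {\<lambda>w. the_elem ((\<lambda>(x, y). x $ j / x $ i) ` w) | j. j \<noteq> i})"

definition O_atlas :: "nat \<Rightarrow> ((complex ^ 3) \<times> complex) set chart set" where
  "O_atlas d = range (O_chart d)"

lemma O_coordinate:
  assumes "w \<in> O_total d" and "(x, y) \<in> w"
  shows "the_elem ((\<lambda>(x, y). x $ j / x $ i) ` w) = x $ j / x $ i"
    and "the_elem ((\<lambda>(x, y). y / x $ i ^ d) ` w) = y / x $ i ^ d"
proof -
  have *: "x' $ j / x' $ i = x $ j / x $ i \<and> y' / x' $ i ^ d = y / x $ i ^ d"
    if "(x', y') \<in> w" for x' y'
  proof -
    have "((x, y), (x', y')) \<in> O_rel d"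
      using quotient_eq_iff[OF equiv_O_rel] assms that unfolding O_total_def by blast
    then show ?thesis
      by (auto simp: O_rel_def power_mult_distrib)
  qed
  have "w \<noteq> {}" using assms(2) by blast
  then have unique: "the_elem (f ` w) = f (x, y)" if "\<And>z. z \<in> w \<Longrightarrow> f z = f (x, y)"
    for f :: "(complex ^ 3) \<times> complex \<Rightarrow> complex"
    using that by (rule the_elem_image_unique)
  show "the_elem ((\<lambda>(x, y). x $ j / x $ i) ` w) = x $ j / x $ i"
    by (subst unique) (auto dest: *)
  show "the_elem ((\<lambda>(x, y). y / x $ i ^ d) ` w) = y / x $ i ^ d"
    by (subst unique) (auto dest: *)
qed

text \<open>For \<open>G\<close> of degree \<open>2 d\<close>, the double cover \<open>y\<^sup>2 = G\<close> branched along \<open>G = 0\<close>.\<close>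

definition double_cover :: "nat \<Rightarrow> ternary_poly \<Rightarrow> ((complex ^ 3) \<times> complex) set set" where
  "double_cover d G = {w \<in> O_total d. \<forall>(x, y)\<in>w. y ^ 2 = mpoly_eval (($) x) G}"

section \<open>Generic small deformations\<close>

text \<open>
  The parameter space of \<open>(F\<^sub>1, \<dots>, F\<^sub>m)\<close>; the components outside \<open>{1..m}\<close> are fixed to be \<open>0\<close> so
  that this is a finite-dimensional vector space. Its linear coordinates are the coefficients
  of the \<open>F\<^sub>i\<close>; the coordinates with \<open>i\<close> or the monomial out of range vanish identically.
\<close>

definition deformation_params :: "nat \<Rightarrow> nat \<Rightarrow> (nat \<Rightarrow> (nat, complex) mpoly) set" where
  "deformation_params N m = {F. \<forall>i. F i \<in> (if i \<in> {1..m} then forms {..<N} i else {0})}"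

definition param_coord :: "(nat \<Rightarrow> (nat, complex) mpoly) \<Rightarrow> nat \<times> (nat \<Rightarrow>\<^sub>0 nat) \<Rightarrow> complex" where
  "param_coord F = (\<lambda>(i, \<alpha>). Poly_Mapping.lookup (F i) \<alpha>)"

definition zariski_closed_params ::
  "nat \<Rightarrow> nat \<Rightarrow> (nat \<Rightarrow> (nat, complex) mpoly) set \<Rightarrow> bool" where
  "zariski_closed_params N m Z \<longleftrightarrow>
     (\<exists>Q. Z = {F \<in> deformation_params N m. \<forall>q\<in>Q. mpoly_eval (param_coord F) q = 0})"

definition zariski_open_params ::
  "nat \<Rightarrow> nat \<Rightarrow> (nat \<Rightarrow> (nat, complex) mpoly) set \<Rightarrow> bool" where
  "zariski_open_params N m U \<longleftrightarrow>
     U \<subseteq> deformation_params N m \<and> zariski_closed_params N m (deformation_params N m - U)"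

text \<open>The sections \<open>s\<^sub>1, \<dots>, s\<^sub>N\<close> are indexed from \<open>0\<close>.\<close>

definition deformation ::
  "nat \<Rightarrow> (nat \<Rightarrow> ternary_poly) \<Rightarrow> ternary_poly \<Rightarrow> (nat \<Rightarrow> (nat, complex) mpoly) \<Rightarrow> complex \<Rightarrow>
    ternary_poly" where
  "deformation m s s\<^sub>D F t =
     s\<^sub>D ^ m + (\<Sum>i=1..m. mpoly_subst s (F i) * s\<^sub>D ^ (m - i) * mpoly_const (t ^ i))"

definition holds_for_generic_small_deformation ::
  "nat \<Rightarrow> (nat \<Rightarrow> ternary_poly) \<Rightarrow> nat \<Rightarrow> ternary_poly \<Rightarrow> (ternary_poly \<Rightarrow> bool) \<Rightarrow> bool" where
  "holds_for_generic_small_deformation N s m s\<^sub>D P \<longleftrightarrow>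
     (\<exists>U. zariski_open_params N m U \<and> U \<noteq> {} \<and>
       (\<forall>F\<in>U. \<exists>\<epsilon>>0. \<forall>t. 0 < cmod t \<and> cmod t \<le> \<epsilon> \<longrightarrow> P (deformation m s s\<^sub>D F t)))"

end

theory Submission
  imports Defs "HOL-Complex_Analysis.Complex_Analysis" "HOL-Computational_Algebra.Field_as_Ring"
    "HOL-Computational_Algebra.Polynomial_Factorial"
    "HOL-Computational_Algebra.Fundamental_Theorem_Algebra" "HOL-Library.Diagonal_Subsequence"
begin

text \<open>
  Suppose that for \<open>t\<close> tending to \<open>0\<close> there are entire curves in the double covers. Degenerating to the
  normal cone of \<open>D\<close>, write \<open>w = s\<^sub>D / t\<close> for the rescaled normal coordinate. A reparametrisation in
  the style of Brody makes the curves uniformly tame on balls of radius \<open>1/4\<close>, but not on the ball of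
  radius \<open>2\<close>, so that by Montel's theorem they converge, and on the limit \<open>w\<close> is everywhere finite or
  everywhere infinite. The limit in the plane lies in \<open>D\<close> or avoids it, by Hurwitz's theorem. It is
  constant: in the complement of \<open>D\<close> by hypothesis, in \<open>D\<close> because the pullbacks of the holomorphic
  differentials \<open>x\<^sub>j\<^sup>k\<^sup>-\<^sup>3 \<omega>\<close> of \<open>D\<close> are bounded entire functions, so that they and the powers
  \<open>(x\<^sub>j / x\<^sub>i)\<^sup>k\<^sup>-\<^sup>3\<close> are constant. If \<open>w\<close> is infinite, constancy contradicts the choice of the
  reparametrisation. If \<open>w\<close> is finite, the limit lies over one point \<open>x\<close> of \<open>D\<close> and gives an entire
  curve in \<open>y\<^sup>2 = p\<^sub>x(w)\<close>, where \<open>p\<^sub>x\<close> is the monic polynomial of degree \<open>2 l\<close> with coefficients \<open>F\<^sub>i(s(x))\<close>.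

  For generic \<open>F\<close> no \<open>p\<^sub>x\<close> has the form \<open>A\<^sup>2 B\<close> with \<open>deg B = 2\<close>: such polynomials form a family
  of codimension \<open>l - 1 \<ge> 2\<close>, while \<open>x\<close> moves in a curve; the elimination is done by comparing
  the dimensions of spaces of polynomials. Write \<open>p\<^sub>x = A\<^sup>2 B\<close> with \<open>B\<close> squarefree of degree at least
  \<open>4\<close>. The pullback of \<open>dw / v\<close> from \<open>v\<^sup>2 = B(w)\<close> is again bounded, so \<open>w'\<^sup>2 = c B(w)\<close> for a constant
  \<open>c\<close>, which has no nonconstant entire solution. Constancy of \<open>w\<close> again contradicts the choice of
  the reparametrisation.
\<close>

text \<open>The double covers vary with t and degenerate, so there is no fixed compact target to
  which Brody's lemma could be applied. Therefore only the plane curve X is reparametrised, and the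
  derivative bound is replaced by \<open>tame\<close>, which states directly what Montel's theorem
  needs: a single chart, and q / t bounded from one side. The two sides |q| \<le> 2 |t| and 2 |q|
  \<ge> |t| overlap, and a unit vector has a component of modulus at least 1/3 > 1/4. So every curve
  is tame near each point, with slack for limits.

  The fibre coordinate y takes no part in the reparametrisation. It is controlled through its
  square, and the root in the limit is only produced on balls, without compatibility between
  different balls. Hence the boundedness argument uses the square w'^2 / B(w) of the pulled back
  form, which does not see the sign of the root, and a version of Liouville's theorem for families
  of functions on balls.\<close>

no_notation fps_nth (infixl \<open>$\<close> 75)

section \<open>Evaluation of polynomials\<close>

definition monom_eval :: "('v \<Rightarrow> 'a::comm_semiring_1) \<Rightarrow> ('v \<Rightarrow>\<^sub>0 nat) \<Rightarrow> 'a" where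
  "monom_eval x \<alpha> = (\<Prod>v\<in>Poly_Mapping.keys \<alpha>. x v ^ Poly_Mapping.lookup \<alpha> v)"

lemma monom_eval_superset:
  assumes "finite V" "Poly_Mapping.keys \<alpha> \<subseteq> V"
  shows "monom_eval x \<alpha> = (\<Prod>v\<in>V. x v ^ Poly_Mapping.lookup \<alpha> v)"
  unfolding monom_eval_def using assms
  by (intro prod.mono_neutral_left) (auto simp: in_keys_iff)

lemma monom_eval_add: "monom_eval x (\<alpha> + \<beta>) = monom_eval x \<alpha> * monom_eval x \<beta>"
proof -
  let ?V = "Poly_Mapping.keys \<alpha> \<union> Poly_Mapping.keys \<beta>"
  have "monom_eval x (\<alpha> + \<beta>) = (\<Prod>v\<in>?V. x v ^ Poly_Mapping.lookup (\<alpha> + \<beta>) v)"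
    using Poly_Mapping.keys_add[of \<alpha> \<beta>] by (intro monom_eval_superset) auto
  also have "\<dots> = (\<Prod>v\<in>?V. x v ^ Poly_Mapping.lookup \<alpha> v) * (\<Prod>v\<in>?V. x v ^ Poly_Mapping.lookup \<beta> v)"
    by (simp add: lookup_add power_add prod.distrib)
  also have "\<dots> = monom_eval x \<alpha> * monom_eval x \<beta>"
    by (subst (1 2) monom_eval_superset[of ?V]) auto
  finally show ?thesis .
qed

lemma monom_eval_zero [simp]: "monom_eval x 0 = 1"
  by (simp add: monom_eval_def)

lemma monom_eval_single [simp]: "monom_eval x (Poly_Mapping.single v n) = x v ^ n"
  by (simp add: monom_eval_def)

lemma monom_eval_sum: "monom_eval x (sum f A) = (\<Prod>a\<in>A. monom_eval x (f a))"
  by (induction A rule: infinite_finite_induct) (auto simp: monom_eval_add)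

text \<open>\<open>mpoly_eval\<close> hides the structure map \<open>id\<close>. This copy without
  it, with the monomials split off, carries the simp rules.\<close>

definition peval :: "('v \<Rightarrow> 'a::comm_semiring_1) \<Rightarrow> ('v, 'a) mpoly \<Rightarrow> 'a" where
  "peval x p = (\<Sum>\<alpha>\<in>Poly_Mapping.keys p. Poly_Mapping.lookup p \<alpha> * monom_eval x \<alpha>)"

lemma mpoly_eval_eq_peval: "mpoly_eval_via id = peval"
  by (intro ext) (simp add: peval_def mpoly_eval_via_def monom_eval_def)

lemma peval_forms: "p \<in> forms V d \<Longrightarrow> peval (\<lambda>v. c * x v) p = c ^ d * peval x p"
  using mpoly_eval_forms[of p V d c x] by (simp only: mpoly_eval_eq_peval)

lemma peval_superset:
  assumes "finite A" "Poly_Mapping.keys p \<subseteq> A"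
  shows "peval x p = (\<Sum>\<alpha>\<in>A. Poly_Mapping.lookup p \<alpha> * monom_eval x \<alpha>)"
  unfolding peval_def using assms
  by (intro sum.mono_neutral_left) (auto simp: in_keys_iff)

lemma peval_zero [simp]: "peval x 0 = 0"
  by (simp add: peval_def)

lemma peval_single: "peval x (Poly_Mapping.single \<alpha> c) = c * monom_eval x \<alpha>"
  by (subst peval_superset[of "{\<alpha>}"]) (auto split: if_splits)

lemma peval_const [simp]: "peval x (mpoly_const c) = c"
  by (simp add: mpoly_const_def peval_single)

lemma peval_add: "peval x (p + q) = peval x p + peval x q"
proof -
  let ?A = "Poly_Mapping.keys p \<union> Poly_Mapping.keys q"
  have "peval x (p + q) = (\<Sum>\<alpha>\<in>?A. Poly_Mapping.lookup (p + q) \<alpha> * monom_eval x \<alpha>)"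
    using Poly_Mapping.keys_add[of p q] by (intro peval_superset) auto
  also have "\<dots> = peval x p + peval x q"
    by (subst (1 2) peval_superset[of ?A]) (auto simp: lookup_add distrib_right sum.distrib)
  finally show ?thesis .
qed

lemma peval_sum: "peval x (sum f A) = (\<Sum>a\<in>A. peval x (f a))"
  by (induction A rule: infinite_finite_induct) (auto simp: peval_add)

lemma poly_mapping_sum_single:
  "p = (\<Sum>\<alpha>\<in>Poly_Mapping.keys p. Poly_Mapping.single \<alpha> (Poly_Mapping.lookup p \<alpha>))"
  by (rule poly_mapping_eqI)
     (auto simp: lookup_sum lookup_single when_def in_keys_iff sum.delta')

lemma peval_mult: "peval x (p * q) = peval x p * peval x q"
proof -
  have "p * q = (\<Sum>\<alpha>\<in>Poly_Mapping.keys p. \<Sum>\<beta>\<in>Poly_Mapping.keys q.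
      Poly_Mapping.single (\<alpha> + \<beta>) (Poly_Mapping.lookup p \<alpha> * Poly_Mapping.lookup q \<beta>))"
    using arg_cong2[OF poly_mapping_sum_single[of p] poly_mapping_sum_single[of q], of "(*)"]
    by (simp only: sum_product mult_single)
  then have "peval x (p * q) = (\<Sum>\<alpha>\<in>Poly_Mapping.keys p. \<Sum>\<beta>\<in>Poly_Mapping.keys q.
      (Poly_Mapping.lookup p \<alpha> * monom_eval x \<alpha>) * (Poly_Mapping.lookup q \<beta> * monom_eval x \<beta>))"
    by (simp add: peval_sum peval_single monom_eval_add mult_ac)
  also have "\<dots> = peval x p * peval x q"
    unfolding sum_product[symmetric]
    by (simp add: peval_def)
  finally show ?thesis .
qed

lemma peval_one [simp]: "peval x 1 = 1"
  using peval_const[of x 1] by (simp add: mpoly_const_def)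

lemma peval_power: "peval x (p ^ n) = peval x p ^ n"
  by (induction n) (auto simp: peval_mult)

lemma peval_prod: "peval x (prod f A) = (\<Prod>a\<in>A. peval x (f a))"
  by (induction A rule: infinite_finite_induct) (auto simp: peval_mult)

lemma peval_scale: "peval x (mpoly_scale c p) = c * peval x p"
  by (simp add: mpoly_scale_def peval_mult)

lemma peval_subst:
  "peval x (mpoly_subst s F) = peval (\<lambda>j. peval x (s j)) F"
  by (simp add: mpoly_eval_via_def[of mpoly_const] peval_sum peval_mult peval_prod
      peval_power) (simp add: peval_def monom_eval_def)

lemma peval_deformation:
  "peval x (deformation m s q F t) = peval x q ^ m +
     (\<Sum>i=1..m. peval (\<lambda>j. peval x (s j)) (F i) * peval x q ^ (m - i) * t ^ i)"
  by (simp add: deformation_def peval_add peval_sum peval_mult peval_power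
      peval_subst)

lemma tendsto_monom_eval [tendsto_intros]:
  fixes L :: "'v \<Rightarrow> 'a::{real_normed_field}"
  assumes "\<And>i. ((\<lambda>n. a n i) \<longlongrightarrow> L i) G"
  shows "((\<lambda>n. monom_eval (a n) \<alpha>) \<longlongrightarrow> monom_eval L \<alpha>) G"
  unfolding monom_eval_def by (intro tendsto_intros assms)

lemma tendsto_peval [tendsto_intros]:
  fixes L :: "'v \<Rightarrow> 'a::{real_normed_field}"
  assumes "\<And>i. ((\<lambda>n. a n i) \<longlongrightarrow> L i) G"
  shows "((\<lambda>n. peval (a n) p) \<longlongrightarrow> peval L p) G"
  unfolding peval_def by (intro tendsto_intros assms)

lemma holomorphic_mpoly_eval:
  assumes "\<And>i. (\<lambda>z. a z i) holomorphic_on S"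
  shows "(\<lambda>z. peval (a z) p) holomorphic_on S"
  unfolding peval_def monom_eval_def by (intro holomorphic_intros assms)

section \<open>Formal partial derivatives, differentiation along curves, Euler's identity\<close>

lemma peval_deriv:
  "peval x (mpoly_deriv v p) = (\<Sum>\<alpha>\<in>Poly_Mapping.keys p. of_nat (Poly_Mapping.lookup \<alpha> v) *
     Poly_Mapping.lookup p \<alpha> * monom_eval x (\<alpha> - Poly_Mapping.single v 1))"
  by (simp add: mpoly_deriv_def peval_sum peval_single)

text \<open>Truncated subtraction is harmless: if v does not occur in \<alpha>, neither subtraction
  changes an exponent, and the derivative formula multiplies such a term by 0.\<close>

lemma monom_eval_diff_single:
  assumes "finite V" "Poly_Mapping.keys \<alpha> \<subseteq> V" "v \<in> V"
  shows "monom_eval x (\<alpha> - Poly_Mapping.single v 1) =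
     x v ^ (Poly_Mapping.lookup \<alpha> v - 1) * (\<Prod>w\<in>V - {v}. x w ^ Poly_Mapping.lookup \<alpha> w)"
proof -
  have "Poly_Mapping.keys (\<alpha> - Poly_Mapping.single v 1) \<subseteq> V"
    using assms(2) by (auto simp: in_keys_iff lookup_minus)
  then have "monom_eval x (\<alpha> - Poly_Mapping.single v 1)
      = (\<Prod>w\<in>V. x w ^ Poly_Mapping.lookup (\<alpha> - Poly_Mapping.single v 1) w)"
    by (rule monom_eval_superset[OF assms(1)])
  also have "\<dots> = x v ^ (Poly_Mapping.lookup \<alpha> v - 1) *
      (\<Prod>w\<in>V - {v}. x w ^ Poly_Mapping.lookup (\<alpha> - Poly_Mapping.single v 1) w)"
    using assms by (subst prod.remove[of V v]) (auto simp: lookup_minus)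
  also have "(\<Prod>w\<in>V - {v}. x w ^ Poly_Mapping.lookup (\<alpha> - Poly_Mapping.single v 1) w) =
      (\<Prod>w\<in>V - {v}. x w ^ Poly_Mapping.lookup \<alpha> w)"
    by (intro prod.cong) (auto simp: lookup_minus lookup_single)
  finally show ?thesis .
qed

lemma has_field_derivative_monom_eval:
  fixes a :: "complex \<Rightarrow> 'v::finite \<Rightarrow> complex"
  assumes "\<And>i. ((\<lambda>z. a z i) has_field_derivative a' i) (at z)"
  shows "((\<lambda>z. monom_eval (a z) \<alpha>) has_field_derivative
     (\<Sum>v\<in>UNIV. of_nat (Poly_Mapping.lookup \<alpha> v) * monom_eval (a z) (\<alpha> - Poly_Mapping.single v 1) * a' v))
     (at z)"
proof -
  have 1: "monom_eval y \<alpha> = (\<Prod>v\<in>UNIV. y v ^ Poly_Mapping.lookup \<alpha> v)" for y :: "'v \<Rightarrow> complex"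
    by (rule monom_eval_superset) auto
  have 2: "((\<lambda>z. a z v ^ Poly_Mapping.lookup \<alpha> v) has_field_derivative
      (of_nat (Poly_Mapping.lookup \<alpha> v) * a z v ^ (Poly_Mapping.lookup \<alpha> v - 1) * a' v)) (at z)" for v
    by (rule derivative_eq_intros assms refl)+ simp
  have "((\<lambda>z. \<Prod>v\<in>UNIV. a z v ^ Poly_Mapping.lookup \<alpha> v) has_field_derivative
      (\<Sum>v\<in>UNIV. (of_nat (Poly_Mapping.lookup \<alpha> v) * a z v ^ (Poly_Mapping.lookup \<alpha> v - 1) * a' v) *
        (\<Prod>w\<in>UNIV - {v}. a z w ^ Poly_Mapping.lookup \<alpha> w))) (at z)"
    by (rule has_field_derivative_prod) (rule 2)
  then show ?thesis
    unfolding 1 by (subst monom_eval_diff_single[of UNIV]) (auto simp: mult_ac)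
qed

lemma has_field_derivative_mpoly_eval:
  fixes a :: "complex \<Rightarrow> 'v::finite \<Rightarrow> complex"
  assumes "\<And>i. ((\<lambda>z. a z i) has_field_derivative a' i) (at z)"
  shows "((\<lambda>z. peval (a z) p) has_field_derivative
     (\<Sum>v\<in>UNIV. peval (a z) (mpoly_deriv v p) * a' v)) (at z)"
proof -
  have "((\<lambda>z. \<Sum>\<alpha>\<in>Poly_Mapping.keys p. Poly_Mapping.lookup p \<alpha> * monom_eval (a z) \<alpha>)
     has_field_derivative (\<Sum>\<alpha>\<in>Poly_Mapping.keys p. Poly_Mapping.lookup p \<alpha> *
      (\<Sum>v\<in>UNIV. of_nat (Poly_Mapping.lookup \<alpha> v) * monom_eval (a z) (\<alpha> - Poly_Mapping.single v 1) * a' v)))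
     (at z)"
    by (intro DERIV_sum DERIV_cmult has_field_derivative_monom_eval assms)
  also have "(\<Sum>\<alpha>\<in>Poly_Mapping.keys p. Poly_Mapping.lookup p \<alpha> *
      (\<Sum>v\<in>UNIV. of_nat (Poly_Mapping.lookup \<alpha> v) * monom_eval (a z) (\<alpha> - Poly_Mapping.single v 1) * a' v))
    = (\<Sum>v\<in>UNIV. peval (a z) (mpoly_deriv v p) * a' v)"
    unfolding peval_deriv sum_distrib_left sum_distrib_right
    by (subst sum.swap) (simp add: mult_ac)
  finally show ?thesis
    by (simp add: peval_def)
qed

text \<open>Differentiate c \<mapsto> p(c x) = c^d p(x) at c = 1 in two ways.\<close>

lemma euler_identity:
  fixes p :: "('v::finite, complex) mpoly"
  assumes "p \<in> forms V d"
  shows "(\<Sum>v\<in>UNIV. x v * peval x (mpoly_deriv v p)) = of_nat d * peval x p"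
proof -
  have "((\<lambda>c. peval (\<lambda>v. c * x v) p) has_field_derivative
      (\<Sum>v\<in>UNIV. peval (\<lambda>v. 1 * x v) (mpoly_deriv v p) * x v)) (at 1)"
    by (rule has_field_derivative_mpoly_eval) (auto intro!: derivative_eq_intros)
  moreover have "((\<lambda>c. peval (\<lambda>v. c * x v) p) has_field_derivative
      (of_nat d * peval x p)) (at 1)"
    unfolding peval_forms[OF assms] by (auto intro!: derivative_eq_intros)
  ultimately show ?thesis
    using DERIV_unique by (fastforce simp: mult_ac)
qed

section \<open>Algebraic dependence by counting\<close>

text \<open>Gaussian elimination: T indexes the equations and I the unknowns. An unknown
  \<open>e0\<close> occurring in equation \<tau> is eliminated from the others, and its value
  \<open>w0\<close> is then read off from \<tau>.\<close>

lemma nontrivial_linear_relation: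
  fixes c :: "'i \<Rightarrow> 't \<Rightarrow> 'a::field"
  assumes "finite T" "finite I" "card T < card I"
  shows "\<exists>w. (\<exists>e\<in>I. w e \<noteq> 0) \<and> (\<forall>\<tau>\<in>T. (\<Sum>e\<in>I. w e * c e \<tau>) = 0)"
  using assms
proof (induction T arbitrary: I c rule: finite_induct)
  case empty
  then obtain e where "e \<in> I" by fastforce
  then show ?case by (intro exI[of _ "\<lambda>_. 1"]) auto
next
  case (insert \<tau> T)
  show ?case
  proof (cases "\<forall>e\<in>I. c e \<tau> = 0")
    case True
    obtain w where "\<exists>e\<in>I. w e \<noteq> 0" "\<forall>\<sigma>\<in>T. (\<Sum>e\<in>I. w e * c e \<sigma>) = 0"
      using insert.IH[of I c] insert.prems insert.hyps by auto
    then show ?thesis using True by (intro exI[of _ w]) auto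
  next
    case False
    then obtain e0 where e0: "e0 \<in> I" "c e0 \<tau> \<noteq> 0" by auto
    let ?I = "I - {e0}"
    let ?c = "\<lambda>e \<sigma>. c e \<sigma> - c e \<tau> / c e0 \<tau> * c e0 \<sigma>"
    have "card T < card ?I"
      using insert.prems insert.hyps e0 by simp
    then obtain w where w: "\<exists>e\<in>?I. w e \<noteq> 0" "\<forall>\<sigma>\<in>T. (\<Sum>e\<in>?I. w e * ?c e \<sigma>) = 0"
      using insert.IH[of ?I ?c] insert.prems by auto
    define w0 where "w0 = - (\<Sum>e\<in>?I. w e * c e \<tau>) / c e0 \<tau>"
    define w' where "w' = w(e0 := w0)"
    have w': "(\<Sum>e\<in>I. w' e * c e \<sigma>) = w0 * c e0 \<sigma> + (\<Sum>e\<in>?I. w e * c e \<sigma>)" for \<sigma>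
      using e0 insert.prems by (subst sum.remove[of I e0]) (auto simp: w'_def intro!: sum.cong)
    have "(\<Sum>e\<in>I. w' e * c e \<sigma>) = 0" if "\<sigma> \<in> T" for \<sigma>
    proof -
      have "0 = (\<Sum>e\<in>?I. w e * ?c e \<sigma>)" using w that by simp
      also have "\<dots> = (\<Sum>e\<in>?I. w e * c e \<sigma>) - (\<Sum>e\<in>?I. w e * c e \<tau>) / c e0 \<tau> * c e0 \<sigma>"
        by (simp add: right_diff_distrib sum_subtractf sum_divide_distrib sum_distrib_left mult_ac)
      finally show ?thesis unfolding w' w0_def by simp
    qed
    moreover have "(\<Sum>e\<in>I. w' e * c e \<tau>) = 0"
      unfolding w' w0_def using e0 by simp
    moreover have "\<exists>e\<in>I. w' e \<noteq> 0"
      using w(1) by (auto simp: w'_def)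
    ultimately show ?thesis by auto
  qed
qed

text \<open>Only the values on P count. Relations that hold on P alone, such as the equation of the
  plane curve, can thus be used without passing to a quotient ring.\<close>

definition lspan :: "'p set \<Rightarrow> ('t \<Rightarrow> 'p \<Rightarrow> 'a::field) \<Rightarrow> 't set \<Rightarrow> ('p \<Rightarrow> 'a) \<Rightarrow> bool" where
  "lspan P b T f \<longleftrightarrow> (\<exists>c. \<forall>p\<in>P. f p = (\<Sum>\<tau>\<in>T. c \<tau> * b \<tau> p))"

lemma lspan_cong: "lspan P b T f \<Longrightarrow> (\<And>p. p \<in> P \<Longrightarrow> f p = g p) \<Longrightarrow> lspan P b T g"
  by (simp add: lspan_def)

lemma lspan_base:
  assumes "finite T" "\<tau> \<in> T"
  shows "lspan P b T (b \<tau>)"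
  unfolding lspan_def using assms
  by (intro exI[of _ "\<lambda>\<sigma>. if \<sigma> = \<tau> then 1 else 0"]) (simp add: if_distrib[of "\<lambda>x. x * _"] cong: if_cong)

lemma lspan_zero: "lspan P b T (\<lambda>_. 0)"
  unfolding lspan_def by (intro exI[of _ "\<lambda>_. 0"]) simp

lemma lspan_add:
  assumes "lspan P b T f" "lspan P b T g"
  shows "lspan P b T (\<lambda>p. f p + g p)"
proof -
  obtain c d where "\<forall>p\<in>P. f p = (\<Sum>\<tau>\<in>T. c \<tau> * b \<tau> p)" "\<forall>p\<in>P. g p = (\<Sum>\<tau>\<in>T. d \<tau> * b \<tau> p)"
    using assms by (auto simp: lspan_def)
  then show ?thesis unfolding lspan_def
    by (intro exI[of _ "\<lambda>\<tau>. c \<tau> + d \<tau>"]) (simp add: distrib_right sum.distrib)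
qed

lemma lspan_scale:
  assumes "lspan P b T f"
  shows "lspan P b T (\<lambda>p. r * f p)"
proof -
  obtain c where "\<forall>p\<in>P. f p = (\<Sum>\<tau>\<in>T. c \<tau> * b \<tau> p)"
    using assms by (auto simp: lspan_def)
  then show ?thesis unfolding lspan_def
    by (intro exI[of _ "\<lambda>\<tau>. r * c \<tau>"]) (simp add: sum_distrib_left mult_ac)
qed

lemma lspan_sum:
  assumes "\<And>i. i \<in> A \<Longrightarrow> lspan P b T (f i)"
  shows "lspan P b T (\<lambda>p. \<Sum>i\<in>A. f i p)"
  using assms by (induction A rule: infinite_finite_induct) (auto intro: lspan_zero lspan_add)

lemma lspan_trans:
  assumes "lspan P b T f" "\<And>\<tau>. \<tau> \<in> T \<Longrightarrow> lspan P b T' (b \<tau>)"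
  shows "lspan P b T' f"
proof -
  obtain c where c: "\<forall>p\<in>P. f p = (\<Sum>\<tau>\<in>T. c \<tau> * b \<tau> p)"
    using assms by (auto simp: lspan_def)
  have "lspan P b T' (\<lambda>p. \<Sum>\<tau>\<in>T. c \<tau> * b \<tau> p)"
    by (intro lspan_sum lspan_scale assms)
  then show ?thesis by (rule lspan_cong) (use c in auto)
qed

lemma lspan_mono:
  assumes "lspan P b T f" "T \<subseteq> T'" "finite T'"
  shows "lspan P b T' f"
  using assms(1) by (rule lspan_trans) (use assms in \<open>auto intro: lspan_base\<close>)

text \<open>In the application \<alpha>, \<beta>, \<gamma> are linear coordinates of a point of the
  plane, and the \<open>g x\<close> are the coefficients of the two factors of a branch polynomial
  together with those coefficients of F that are left free.\<close>

locale form_functions =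
  fixes P :: "'p set" and \<alpha> \<beta> \<gamma> :: "'p \<Rightarrow> 'a::field" and G :: "'g set" and g :: "'g \<Rightarrow> 'p \<Rightarrow> 'a"
  assumes finite_G: "finite G"
begin

definition fmon :: "(nat \<times> nat \<times> nat) \<times> ('g \<Rightarrow> nat) \<Rightarrow> 'p \<Rightarrow> 'a" where
  "fmon = (\<lambda>((a, b, c), e) p. \<alpha> p ^ a * \<beta> p ^ b * \<gamma> p ^ c * (\<Prod>x\<in>G. g x p ^ e x))"

definition fidx :: "nat \<Rightarrow> nat \<Rightarrow> ((nat \<times> nat \<times> nat) \<times> ('g \<Rightarrow> nat)) set" where
  "fidx n D = {(a, b, c). a + b + c = n} \<times> (G \<rightarrow>\<^sub>E {..D})"

text \<open>
  The functions on \<open>P\<close> that are homogeneous of degree \<open>n\<close> in \<open>\<alpha>, \<beta>, \<gamma>\<close>, with coefficients of degree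
  at most \<open>D\<close> in each of the parameters \<open>g x\<close>, \<open>x \<in> G\<close>.
\<close>

abbreviation hspan :: "nat \<Rightarrow> nat \<Rightarrow> ('p \<Rightarrow> 'a) \<Rightarrow> bool" where
  "hspan n D \<equiv> lspan P fmon (fidx n D)"

lemma finite_fidx [simp]: "finite (fidx n D)"
proof -
  have "{(a, b, c). a + b + c = n} \<subseteq> {..n} \<times> {..n} \<times> {..n}" by auto
  then have "finite {(a, b, c). a + b + c = n}"
    by (rule finite_subset) auto
  then show ?thesis using finite_G by (auto simp: fidx_def intro!: finite_PiE)
qed

lemma hspan_mono: "hspan n D f \<Longrightarrow> D \<le> D' \<Longrightarrow> hspan n D' f"
  by (erule lspan_mono[OF _ _ finite_fidx]) (fastforce simp: fidx_def PiE_iff)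

lemma fmon_mult:
  "fmon ((a, b, c), e) p * fmon ((a', b', c'), e') p =
   fmon ((a + a', b + b', c + c'), restrict (\<lambda>x. e x + e' x) G) p"
  by (simp add: fmon_def power_add prod.distrib mult_ac)

lemma hspan_mult:
  assumes "hspan n D f" "hspan n' D' f'"
  shows "hspan (n + n') (D + D') (\<lambda>p. f p * f' p)"
proof -
  obtain c where c: "\<forall>p\<in>P. f p = (\<Sum>\<tau>\<in>fidx n D. c \<tau> * fmon \<tau> p)"
    using assms by (auto simp: lspan_def)
  obtain c' where c': "\<forall>p\<in>P. f' p = (\<Sum>\<tau>\<in>fidx n' D'. c' \<tau> * fmon \<tau> p)"
    using assms by (auto simp: lspan_def)
  have base: "hspan (n + n') (D + D') (\<lambda>p. fmon \<tau> p * fmon \<tau>' p)"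
    if mem: "\<tau> \<in> fidx n D" "\<tau>' \<in> fidx n' D'" for \<tau> \<tau>'
  proof -
    obtain a b r e where t: "\<tau> = ((a, b, r), e)" by (metis surj_pair)
    obtain a' b' r' e' where t': "\<tau>' = ((a', b', r'), e')" by (metis surj_pair)
    have "((a + a', b + b', r + r'), restrict (\<lambda>x. e x + e' x) G) \<in> fidx (n + n') (D + D')"
      using mem by (auto simp: fidx_def t t' PiE_iff intro!: add_mono)
    from lspan_base[OF finite_fidx this] show ?thesis
      by (rule lspan_cong) (simp add: t t' fmon_mult)
  qed
  have "hspan (n + n') (D + D')
      (\<lambda>p. \<Sum>\<tau>\<in>fidx n D. \<Sum>\<tau>'\<in>fidx n' D'. c \<tau> * (c' \<tau>' * (fmon \<tau> p * fmon \<tau>' p)))"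
    by (intro lspan_sum lspan_scale base)
  then show ?thesis
    by (rule lspan_cong) (use c c' in \<open>simp add: sum_product mult.assoc mult.left_commute\<close>)
qed

lemma hspan_const: "hspan 0 0 (\<lambda>_. r)"
proof -
  have "((0, 0, 0), restrict (\<lambda>_. 0) G) \<in> fidx 0 0"
    by (auto simp: fidx_def)
  from lspan_scale[OF lspan_base[OF finite_fidx this], of P fmon r] show ?thesis
    by (simp add: fmon_def)
qed

lemma hspan_prod:
  assumes "finite A" "\<And>i. i \<in> A \<Longrightarrow> hspan (n i) (D i) (f i)"
  shows "hspan (\<Sum>i\<in>A. n i) (\<Sum>i\<in>A. D i) (\<lambda>p. \<Prod>i\<in>A. f i p)"
  using assms
proof (induction A rule: finite_induct)
  case empty
  show ?case by (simp add: hspan_const)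
next
  case (insert i A)
  then have "hspan (n i + (\<Sum>i\<in>A. n i)) (D i + (\<Sum>i\<in>A. D i)) (\<lambda>p. f i p * (\<Prod>i\<in>A. f i p))"
    by (intro hspan_mult) auto
  then show ?case using insert by simp
qed

lemma hspan_power: "hspan n D f \<Longrightarrow> hspan (r * n) (r * D) (\<lambda>p. f p ^ r)"
  using hspan_prod[of "{..<r}" "\<lambda>_. n" "\<lambda>_. D" "\<lambda>_. f"] by simp

lemma hspan_coords: "hspan 1 0 \<alpha>" "hspan 1 0 \<beta>" "hspan 1 0 \<gamma>"
proof -
  let ?e = "restrict (\<lambda>_. 0) G"
  have "((1, 0, 0), ?e) \<in> fidx 1 0" "((0, 1, 0), ?e) \<in> fidx 1 0" "((0, 0, 1), ?e) \<in> fidx 1 0"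
    by (auto simp: fidx_def)
  note * = this[THEN lspan_base[OF finite_fidx, of _ _ _ P fmon]]
  show "hspan 1 0 \<alpha>" using *(1) by (rule lspan_cong) (simp add: fmon_def)
  show "hspan 1 0 \<beta>" using *(2) by (rule lspan_cong) (simp add: fmon_def)
  show "hspan 1 0 \<gamma>" using *(3) by (rule lspan_cong) (simp add: fmon_def)
qed

lemma hspan_param:
  assumes "x \<in> G"
  shows "hspan 0 1 (g x)"
proof -
  have "((0, 0, 0), restrict (\<lambda>y. if y = x then 1 else 0) G) \<in> fidx 0 1"
    by (auto simp: fidx_def)
  from lspan_base[OF finite_fidx this, of P fmon] show ?thesis
  proof (rule lspan_cong)
    fix p
    have "(\<Prod>y\<in>G. g y p ^ (if y = x then 1 else 0)) = (\<Prod>y\<in>G. if y = x then g y p else 1)"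
      by (intro prod.cong) auto
    then show "fmon ((0, 0, 0), restrict (\<lambda>y. if y = x then 1 else 0) G) p = g x p"
      using assms finite_G by (simp add: fmon_def)
  qed
qed

text \<open>Normal forms modulo an equation of degree k that is monic in \<gamma>. Bounding the
  exponent of \<gamma> leaves O(n) instead of O(n^2) plane monomials, which is how the curve counts
  as one-dimensional.\<close>

definition fidx_red :: "nat \<Rightarrow> nat \<Rightarrow> nat \<Rightarrow> ((nat \<times> nat \<times> nat) \<times> ('g \<Rightarrow> nat)) set" where
  "fidx_red k n D = {((a, b, c), e) \<in> fidx n D. c < k}"

lemma card_fidx_red: "card (fidx_red k n D) \<le> k * (n + 1) * (D + 1) ^ card G"
proof -
  \<comment> \<open>b is determined by a, c and n.\<close>
  have "inj_on (\<lambda>((a, b, c), e). ((c, a), e)) (fidx_red k n D)"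
    by (auto simp: inj_on_def fidx_red_def fidx_def)
  moreover have "(\<lambda>((a, b, c), e). ((c, a), e)) ` fidx_red k n D \<subseteq>
      ({..<k} \<times> {..n}) \<times> (G \<rightarrow>\<^sub>E {..D})"
    by (auto simp: fidx_red_def fidx_def)
  moreover have "finite (({..<k} \<times> {..n}) \<times> (G \<rightarrow>\<^sub>E {..D}))"
    using finite_G by (auto intro!: finite_PiE)
  ultimately have "card (fidx_red k n D) \<le> card (({..<k} \<times> {..n}) \<times> (G \<rightarrow>\<^sub>E {..D}))"
    by (rule card_inj_on_le)
  then show ?thesis
    using finite_G by (simp add: card_cartesian_product card_PiE)
qed

text \<open>Division with remainder: a factor \<gamma>^k is replaced by monomials of smaller degree
  in \<gamma>, so the exponent of \<gamma> strictly decreases. The equation contains no parameters,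
  so D is unchanged.\<close>

lemma hspan_reduce:
  assumes "lspan P fmon (fidx_red k k 0) (\<lambda>p. \<gamma> p ^ k)" "hspan n D f"
  shows "lspan P fmon (fidx_red k n D) f"
  using assms(2)
proof (rule lspan_trans)
  obtain C where C: "\<forall>p\<in>P. \<gamma> p ^ k = (\<Sum>\<tau>\<in>fidx_red k k 0. C \<tau> * fmon \<tau> p)"
    using assms(1) by (auto simp: lspan_def)
  have fin: "finite (fidx_red k n D)"
    by (rule finite_subset[OF _ finite_fidx[of n D]]) (auto simp: fidx_red_def)
  have "\<forall>a b e. ((a, b, c), e) \<in> fidx n D \<longrightarrow> lspan P fmon (fidx_red k n D) (fmon ((a, b, c), e))" for c
  proof (induction c rule: less_induct)
    case (less c)
    show ?case
    proof (intro allI impI)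
      fix a b e assume mem: "((a, b, c), e) \<in> fidx n D"
      show "lspan P fmon (fidx_red k n D) (fmon ((a, b, c), e))"
      proof (cases "c < k")
        case True
        then show ?thesis using mem fin by (intro lspan_base) (auto simp: fidx_red_def)
      next
        case False
        have "lspan P fmon (fidx_red k n D) (\<lambda>p. \<Sum>\<tau>\<in>fidx_red k k 0. C \<tau> * (fmon \<tau> p * fmon ((a, b, c - k), e) p))"
        proof (intro lspan_sum lspan_scale)
          fix \<tau> assume t: "\<tau> \<in> fidx_red k k 0"
          obtain a' b' c' e' where t': "\<tau> = ((a', b', c'), e')" by (metis surj_pair)
          have *: "a' + b' + c' = k" "c' < k" "\<forall>x\<in>G. e' x = 0" "a + b + c = n" "e \<in> G \<rightarrow>\<^sub>E {..D}"
            using t mem by (auto simp: t' fidx_red_def fidx_def)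
          have "((a' + a, b' + b, c' + (c - k)), restrict (\<lambda>x. e' x + e x) G) \<in> fidx n D"
            using * False by (auto simp: fidx_def PiE_iff)
          moreover have "c' + (c - k) < c" using * False by auto
          ultimately have "lspan P fmon (fidx_red k n D)
              (fmon ((a' + a, b' + b, c' + (c - k)), restrict (\<lambda>x. e' x + e x) G))"
            using less by blast
          then show "lspan P fmon (fidx_red k n D) (\<lambda>p. fmon \<tau> p * fmon ((a, b, c - k), e) p)"
            by (rule lspan_cong) (simp add: t' fmon_mult)
        qed
        then show ?thesis
        proof (rule lspan_cong)
          fix p assume "p \<in> P"
          have "fmon ((a, b, c), e) p = \<gamma> p ^ k * fmon ((a, b, c - k), e) p"
            using False power_add[of "\<gamma> p" k "c - k"] by (simp add: fmon_def mult_ac)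
          then show "(\<Sum>\<tau>\<in>fidx_red k k 0. C \<tau> * (fmon \<tau> p * fmon ((a, b, c - k), e) p)) = fmon ((a, b, c), e) p"
            using C \<open>p \<in> P\<close> by (simp only: sum_distrib_right mult.assoc)
        qed
      qed
    qed
  qed
  then show "lspan P fmon (fidx_red k n D) (fmon \<tau>)" if "\<tau> \<in> fidx n D" for \<tau>
    using that by (metis surj_pair)
qed

end

text \<open>Let M = card V. On each P j the d^M monomials in the Y v with all exponents less than d
  lie in a space of dimension O(d^(M-1)): one dimension comes from the curve and at most M - 2 from
  the parameters. For large d there are more monomials than linear conditions, even for all j
  together, so that one relation serves all pieces.\<close>

theorem algebraic_relation_by_counting:
  fixes P :: "'j \<Rightarrow> 'p set" and \<alpha> \<beta> \<gamma> :: "'p \<Rightarrow> 'a::field"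
    and G :: "'j \<Rightarrow> 'g set" and g :: "'j \<Rightarrow> 'g \<Rightarrow> 'p \<Rightarrow> 'a" and Y :: "'v \<Rightarrow> 'p \<Rightarrow> 'a"
  assumes "finite J" "finite V"
    and G: "\<And>j. j \<in> J \<Longrightarrow> finite (G j)" "\<And>j. j \<in> J \<Longrightarrow> card (G j) + 2 \<le> card V"
    and Y: "\<And>j v. j \<in> J \<Longrightarrow> v \<in> V \<Longrightarrow>
        lspan (P j) (form_functions.fmon \<alpha> \<beta> \<gamma> (G j) (g j)) (form_functions.fidx (G j) n\<^sub>0 D\<^sub>0) (Y v)"
    and one: "\<And>j. j \<in> J \<Longrightarrow>
        lspan (P j) (form_functions.fmon \<alpha> \<beta> \<gamma> (G j) (g j)) (form_functions.fidx (G j) n\<^sub>0 D\<^sub>0) (\<lambda>_. 1)"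
    and red: "\<And>j. j \<in> J \<Longrightarrow> lspan (P j) (form_functions.fmon \<alpha> \<beta> \<gamma> (G j) (g j))
        (form_functions.fidx_red (G j) k k 0) (\<lambda>p. \<gamma> p ^ k)"
  shows "\<exists>d w. (\<exists>e\<in>V \<rightarrow>\<^sub>E {..<d::nat}. w e \<noteq> 0) \<and>
     (\<forall>j\<in>J. \<forall>p\<in>P j. (\<Sum>e\<in>V \<rightarrow>\<^sub>E {..<d}. w e * (\<Prod>v\<in>V. Y v p ^ e v)) = 0)"
proof (cases "J = {}")
  case True
  then show ?thesis
    by (intro exI[of _ 1] exI[of _ "\<lambda>_. 1"]) (auto intro: exI[of _ "restrict (\<lambda>_. 0) V"])
next
  case False
  define M where "M = card V"
  have M: "M \<ge> 2" "\<And>j. j \<in> J \<Longrightarrow> card (G j) \<le> M - 2"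
    using False G(2) by (fastforce simp: M_def)+
  \<comment> \<open>There will be at most K d^(M-1) linear conditions, so any d > K
    suffices.\<close>
  define K where "K = card J * k * (M * n\<^sub>0 + 1) * (M * D\<^sub>0 + 1) ^ (M - 2)"
  define d where "d = K + 1"
  let ?E = "V \<rightarrow>\<^sub>E {..<d}"
  let ?n = "M * d * n\<^sub>0" and ?D = "M * d * D\<^sub>0"
  define T where "T j = form_functions.fidx_red (G j) k ?n ?D" for j
  have finT: "finite (T j)" and cardT: "card (T j) \<le> k * (?n + 1) * (?D + 1) ^ (M - 2)" if "j \<in> J" for j
  proof -
    interpret form_functions "P j" \<alpha> \<beta> \<gamma> "G j" "g j" by unfold_locales (rule G(1)[OF that])
    show "finite (T j)"
      by (rule finite_subset[OF _ finite_fidx[of ?n ?D]]) (auto simp: T_def fidx_red_def)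
    have "(?D + 1) ^ card (G j) \<le> (?D + 1) ^ (M - 2)"
      using M(2)[OF that] by (intro power_increasing) auto
    then show "card (T j) \<le> k * (?n + 1) * (?D + 1) ^ (M - 2)"
      using card_fidx_red[of k ?n ?D] unfolding T_def by (meson le_trans mult_le_mono2)
  qed
  have mono: "lspan (P j) (form_functions.fmon \<alpha> \<beta> \<gamma> (G j) (g j)) (T j) (\<lambda>p. \<Prod>v\<in>V. Y v p ^ e v)"
    if j: "j \<in> J" and e: "e \<in> ?E" for j e
  proof -
    interpret form_functions "P j" \<alpha> \<beta> \<gamma> "G j" "g j" by unfold_locales (rule G(1)[OF j])
    have le: "(\<Sum>v\<in>V. e v) \<le> M * d"
      using sum_bounded_above[of V e d] e by (auto simp: M_def PiE_iff less_imp_le)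
    have "hspan (\<Sum>v\<in>V. e v * n\<^sub>0) (\<Sum>v\<in>V. e v * D\<^sub>0) (\<lambda>p. \<Prod>v\<in>V. Y v p ^ e v)"
      using Y[OF j] by (intro hspan_prod \<open>finite V\<close> hspan_power)
    \<comment> \<open>The constant 1 is itself of degree \<open>n\<^sub>0\<close> in the plane
      coordinates. Its powers bring all monomials to the common degree
      \<open>M * d * n\<^sub>0\<close>.\<close>
    from hspan_mult[OF this hspan_power[OF one[OF j], of "M * d - (\<Sum>v\<in>V. e v)"]]
    have "hspan ?n ?D (\<lambda>p. \<Prod>v\<in>V. Y v p ^ e v)"
      using le by (simp flip: sum_distrib_right distrib_right)
    from hspan_reduce[OF red[OF j] this] show ?thesis by (simp add: T_def)
  qed
  \<comment> \<open>The coefficients must not depend on p, so that the conditions on w are finitely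
    many linear equations.\<close>
  define C where "C j e = (SOME c. \<forall>p\<in>P j. (\<Prod>v\<in>V. Y v p ^ e v) =
      (\<Sum>\<tau>\<in>T j. c \<tau> * form_functions.fmon \<alpha> \<beta> \<gamma> (G j) (g j) \<tau> p))" for j e
  have C: "(\<Prod>v\<in>V. Y v p ^ e v) = (\<Sum>\<tau>\<in>T j. C j e \<tau> * form_functions.fmon \<alpha> \<beta> \<gamma> (G j) (g j) \<tau> p)"
    if "j \<in> J" "e \<in> ?E" "p \<in> P j" for j e p
    using someI_ex[OF mono[OF that(1,2), unfolded lspan_def]] that(3) unfolding C_def by blast
  have "card (Sigma J T) < card ?E"
  proof -
    have d1: "d \<ge> 1" by (simp add: d_def)
    have "card (Sigma J T) = (\<Sum>j\<in>J. card (T j))"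
      using \<open>finite J\<close> finT by (subst card_SigmaI) auto
    also have "\<dots> \<le> card J * (k * (?n + 1) * (?D + 1) ^ (M - 2))"
      using sum_bounded_above[of J "\<lambda>j. card (T j)"] cardT by simp
    also have "\<dots> \<le> card J * (k * (d * (M * n\<^sub>0 + 1)) * (d * (M * D\<^sub>0 + 1)) ^ (M - 2))"
      using d1 by (intro mult_le_mono le_refl power_mono) (auto simp: algebra_simps)
    also have "\<dots> = K * (d * d ^ (M - 2))"
      by (simp only: K_def power_mult_distrib mult_ac)
    also have "d * d ^ (M - 2) = d ^ (M - 1)"
      using M(1) power_Suc[of d "M - 2"] by (simp only: Suc_diff_Suc numeral_2_eq_2 One_nat_def)
    also have "K * d ^ (M - 1) < d * d ^ (M - 1)"
      using d1 by (intro mult_strict_right_mono) (auto simp: d_def)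
    also have "\<dots> = d ^ M"
      using M(1) power_Suc[of d "M - 1"] by (simp del: power_Suc)
    finally show ?thesis
      using \<open>finite V\<close> by (simp add: card_PiE M_def)
  qed
  moreover have "finite (Sigma J T)" using \<open>finite J\<close> finT by auto
  moreover have "finite ?E" using \<open>finite V\<close> by (auto intro!: finite_PiE)
  ultimately obtain w where w: "\<exists>e\<in>?E. w e \<noteq> 0"
      "\<forall>\<tau>\<in>Sigma J T. (\<Sum>e\<in>?E. w e * C (fst \<tau>) e (snd \<tau>)) = 0"
    using nontrivial_linear_relation[of "Sigma J T" ?E "\<lambda>e \<tau>. C (fst \<tau>) e (snd \<tau>)"] by blast
  have "(\<Sum>e\<in>?E. w e * (\<Prod>v\<in>V. Y v p ^ e v)) = 0" if "j \<in> J" "p \<in> P j" for j p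
  proof -
    let ?m = "form_functions.fmon \<alpha> \<beta> \<gamma> (G j) (g j)"
    have "(\<Sum>e\<in>?E. w e * (\<Prod>v\<in>V. Y v p ^ e v)) = (\<Sum>e\<in>?E. w e * (\<Sum>\<tau>\<in>T j. C j e \<tau> * ?m \<tau> p))"
      using C that by (intro sum.cong refl) simp
    also have "\<dots> = (\<Sum>\<tau>\<in>T j. (\<Sum>e\<in>?E. w e * C j e \<tau>) * ?m \<tau> p)"
      unfolding sum_distrib_left sum_distrib_right by (subst sum.swap) (simp add: mult_ac)
    also have "\<dots> = 0"
      using w(2) that by (intro sum.neutral) force
    finally show ?thesis .
  qed
  then show ?thesis using w(1) by blast
qed

section \<open>Generic parameters\<close>

text \<open>Induction on the variables: some coefficient with respect to v, a polynomial in the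
  other variables, is nonzero at a point Y. Then t avoids the finitely many roots of the resulting
  polynomial in one variable.\<close>

lemma exists_nonzero_value:
  fixes w :: "('v \<Rightarrow> nat) \<Rightarrow> 'a::field_char_0"
  assumes "finite V" "\<exists>e\<in>V \<rightarrow>\<^sub>E {..<d}. w e \<noteq> 0"
  shows "\<exists>Y. (\<Sum>e\<in>V \<rightarrow>\<^sub>E {..<d}. w e * (\<Prod>v\<in>V. Y v ^ e v)) \<noteq> 0"
  using assms
proof (induction V arbitrary: w rule: finite_induct)
  case empty
  then show ?case by simp
next
  case (insert v V)
  let ?E = "V \<rightarrow>\<^sub>E {..<d}"
  have fE: "finite ?E" using insert.hyps by (auto intro!: finite_PiE)
  obtain e where e: "e \<in> insert v V \<rightarrow>\<^sub>E {..<d}" "w e \<noteq> 0" using insert.prems by blast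
  have "restrict e V \<in> ?E" "w ((restrict e V)(v := e v)) \<noteq> 0" "e v < d"
  proof -
    have "(restrict e V)(v := e v) = e"
      using e(1) by (auto simp: fun_eq_iff PiE_iff extensional_def)
    then show "w ((restrict e V)(v := e v)) \<noteq> 0" using e by simp
  qed (use e in \<open>auto simp: PiE_iff\<close>)
  then obtain Y where Y: "(\<Sum>g\<in>?E. w (g(v := e v)) * (\<Prod>u\<in>V. Y u ^ g u)) \<noteq> 0"
    using insert.IH[of "\<lambda>g. w (g(v := e v))"] by blast
  define S where "S y = (\<Sum>g\<in>?E. w (g(v := y)) * (\<Prod>u\<in>V. Y u ^ g u))" for y
  define p where "p = (\<Sum>y<d. monom (S y) y)"
  have "coeff p (e v) = S (e v)"
    using \<open>e v < d\<close> by (simp add: p_def coeff_sum)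
  then have "p \<noteq> 0" using Y by (auto simp: S_def)
  then have "finite {t. poly p t = 0}" by (rule poly_roots_finite)
  then obtain t where t: "poly p t \<noteq> 0"
    using ex_new_if_finite[OF infinite_UNIV_char_0[where 'a='a]] by blast
  let ?Y = "Y(v := t)"
  have "(\<Sum>e\<in>insert v V \<rightarrow>\<^sub>E {..<d}. w e * (\<Prod>u\<in>insert v V. ?Y u ^ e u)) =
      (\<Sum>(y, g)\<in>{..<d} \<times> ?E. w (g(v := y)) * (\<Prod>u\<in>insert v V. ?Y u ^ (g(v := y)) u))"
    unfolding PiE_insert_eq
    by (subst sum.reindex) (use insert.hyps in \<open>auto intro!: inj_combinator sum.cong\<close>)
  also have "\<dots> = (\<Sum>(y, g)\<in>{..<d} \<times> ?E. w (g(v := y)) * (\<Prod>u\<in>V. Y u ^ g u) * t ^ y)"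
  proof (intro sum.cong refl, clarify)
    fix y g
    have "(\<Prod>u\<in>insert v V. ?Y u ^ (g(v := y)) u) = t ^ y * (\<Prod>u\<in>V. ?Y u ^ (g(v := y)) u)"
      using insert.hyps by (subst prod.insert) auto
    also have "(\<Prod>u\<in>V. ?Y u ^ (g(v := y)) u) = (\<Prod>u\<in>V. Y u ^ g u)"
      using insert.hyps by (intro prod.cong) auto
    finally show "w (g(v := y)) * (\<Prod>u\<in>insert v V. ?Y u ^ (g(v := y)) u) =
        w (g(v := y)) * (\<Prod>u\<in>V. Y u ^ g u) * t ^ y" by simp
  qed
  also have "\<dots> = poly p t"
    by (simp add: p_def S_def poly_sum poly_monom sum.cartesian_product[symmetric] sum_distrib_right)
  finally show ?case using t by (intro exI[of _ ?Y]) simp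
qed

lemma finite_monomials: "finite {\<alpha>. Poly_Mapping.keys \<alpha> \<subseteq> {..<N::nat} \<and> monom_degree \<alpha> = i}" (is "finite ?A")
proof (rule finite_imageD)
  let ?f = "\<lambda>\<alpha>. restrict (Poly_Mapping.lookup \<alpha>) {..<N}"
  have "?f ` ?A \<subseteq> {..<N} \<rightarrow>\<^sub>E {..i}"
  proof clarify
    fix \<alpha> :: "nat \<Rightarrow>\<^sub>0 nat" assume "Poly_Mapping.keys \<alpha> \<subseteq> {..<N}" "i = monom_degree \<alpha>"
    have "Poly_Mapping.lookup \<alpha> v \<le> monom_degree \<alpha>" for v
      unfolding monom_degree_def
      by (cases "v \<in> Poly_Mapping.keys \<alpha>") (auto simp: in_keys_iff intro!: member_le_sum)
    then show "?f \<alpha> \<in> {..<N} \<rightarrow>\<^sub>E {..monom_degree \<alpha>}" by auto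
  qed
  then show "finite (?f ` ?A)"
    by (rule finite_subset) (auto intro!: finite_PiE)
  show "inj_on ?f ?A"
  proof (rule inj_onI)
    fix \<alpha> \<beta> assume *: "\<alpha> \<in> ?A" "\<beta> \<in> ?A" "?f \<alpha> = ?f \<beta>"
    show "\<alpha> = \<beta>"
    proof (rule poly_mapping_eqI)
      fix v
      show "Poly_Mapping.lookup \<alpha> v = Poly_Mapping.lookup \<beta> v"
      proof (cases "v < N")
        case True
        then show ?thesis using fun_cong[OF *(3), of v] by simp
      next
        case False
        then have "v \<notin> Poly_Mapping.keys \<alpha>" "v \<notin> Poly_Mapping.keys \<beta>" using * by auto
        then show ?thesis by (simp add: in_keys_iff)
      qed
    qed
  qed
qed

lemma monom_degree_superset:
  assumes "finite V" "Poly_Mapping.keys \<alpha> \<subseteq> V"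
  shows "monom_degree \<alpha> = (\<Sum>v\<in>V. Poly_Mapping.lookup \<alpha> v)"
  unfolding monom_degree_def using assms
  by (intro sum.mono_neutral_left) (auto simp: in_keys_iff)

text \<open>
  In the degeneration to the normal cone, \<open>deformation m s q F t = t\<^sup>m branch_poly m s F x (w)\<close> with
  the fibre coordinate \<open>w = q / t\<close>; the double cover degenerates over a point \<open>x\<close> of \<open>q = 0\<close> to the
  curve \<open>y\<^sup>2 = branch_poly m s F x (w)\<close>.
\<close>

definition branch_poly ::
  "nat \<Rightarrow> (nat \<Rightarrow> ternary_poly) \<Rightarrow> (nat \<Rightarrow> (nat, complex) mpoly) \<Rightarrow> complex ^ 3 \<Rightarrow> complex poly" where
  "branch_poly m s F x =
     monom 1 m + (\<Sum>i=1..m. monom (peval (\<lambda>j. peval (($) x) (s j)) (F i)) (m - i))"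

lemma poly_branch_poly:
  "poly (branch_poly m s F x) u =
     u ^ m + (\<Sum>i=1..m. peval (\<lambda>j. peval (($) x) (s j)) (F i) * u ^ (m - i))"
  by (simp add: branch_poly_def poly_sum poly_monom)

lemma coeff_branch_poly:
  assumes "i \<in> {1..m}"
  shows "coeff (branch_poly m s F x) (m - i) = peval (\<lambda>j. peval (($) x) (s j)) (F i)"
proof -
  have "coeff (branch_poly m s F x) (m - i) =
      (\<Sum>r=1..m. if m - r = m - i then peval (\<lambda>j. peval (($) x) (s j)) (F r) else 0)"
  proof -
    have "m \<noteq> m - i" using assms by auto
    then show ?thesis by (simp add: branch_poly_def coeff_sum)
  qed
  also have "\<dots> = (\<Sum>r=1..m. if r = i then peval (\<lambda>j. peval (($) x) (s j)) (F r) else 0)"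
    using assms by (intro sum.cong) auto
  finally show ?thesis using assms by simp
qed

lemma deformation_params_forms:
  "F \<in> deformation_params N m \<Longrightarrow> i \<in> {1..m} \<Longrightarrow> F i \<in> forms {..<N} i"
  unfolding deformation_params_def mem_Collect_eq by (erule allE[of _ i]) simp

lemma peval_scaled: "p \<in> forms V d \<Longrightarrow> peval (($) (c *s x)) p = c ^ d * peval (($) x) p"
  using peval_forms[of p V d c "($) x"] by (simp add: vector_scalar_mult_def vec_lambda_inverse)

text \<open>The i-th coefficient has weight i in b = c^k, so the fibre polynomial p(u) becomes b^m
  p(u / b). This will allow a representative x at which some form \<open>s j\<close> has the value
  1.\<close>

lemma branch_poly_scaled:
  assumes "\<And>j. j < N \<Longrightarrow> s j \<in> ternary_forms k" "F \<in> deformation_params N m" "c \<noteq> 0"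
  shows "branch_poly m s F (c *s x) =
    smult ((c ^ k) ^ m) (pcompose (branch_poly m s F x) [:0, 1 / c ^ k:])"
proof -
  have 1: "peval (\<lambda>j. peval (($) (c *s x)) (s j)) (F i) = (c ^ k) ^ i * peval (\<lambda>j. peval (($) x) (s j)) (F i)"
    if i: "i \<in> {1..m}" for i
  proof -
    have F: "F i \<in> forms {..<N} i" using assms(2) i by (rule deformation_params_forms)
    have "peval (\<lambda>j. peval (($) (c *s x)) (s j)) (F i) = peval (\<lambda>j. c ^ k * peval (($) x) (s j)) (F i)"
      unfolding peval_def[of _ "F i"] monom_eval_def
    proof (intro sum.cong prod.cong refl arg_cong2[of _ _ _ _ "(*)"] arg_cong2[of _ _ _ _ "(^)"])
      fix \<alpha> v assume "\<alpha> \<in> Poly_Mapping.keys (F i)" "v \<in> Poly_Mapping.keys \<alpha>"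
      then have "v < N" using F by (auto simp: forms_def)
      then show "peval (($) (c *s x)) (s v) = c ^ k * peval (($) x) (s v)"
        by (intro peval_scaled[OF assms(1)])
    qed
    then show ?thesis using peval_forms[OF F] by simp
  qed
  have "poly (branch_poly m s F (c *s x)) u =
     poly (smult ((c ^ k) ^ m) (pcompose (branch_poly m s F x) [:0, 1 / c ^ k:])) u" for u
  proof -
    have "(c ^ k) ^ m * (u / c ^ k) ^ m = u ^ m"
      using assms(3) by (simp flip: power_mult_distrib)
    moreover have 2: "(c ^ k) ^ m * (u / c ^ k) ^ (m - i) = (c ^ k) ^ i * u ^ (m - i)" if "i \<in> {1..m}" for i
      using assms(3) that power_add[of "c ^ k" i "m - i"] by (simp add: power_divide)
    moreover have "(\<Sum>i=1..m. peval (\<lambda>j. peval (($) (c *s x)) (s j)) (F i) * u ^ (m - i)) =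
        (\<Sum>i=1..m. (c ^ k) ^ m * (peval (\<lambda>j. peval (($) x) (s j)) (F i) * (u / c ^ k) ^ (m - i)))"
    proof (intro sum.cong refl)
      fix i assume i: "i \<in> {1..m}"
      show "peval (\<lambda>j. peval (($) (c *s x)) (s j)) (F i) * u ^ (m - i) =
          (c ^ k) ^ m * (peval (\<lambda>j. peval (($) x) (s j)) (F i) * (u / c ^ k) ^ (m - i))"
        unfolding 1[OF i] mult.left_commute[of "(c ^ k) ^ m"] 2[OF i] by (simp only: mult_ac)
    qed
    ultimately show ?thesis
      by (simp add: poly_branch_poly poly_pcompose distrib_left sum_distrib_left)
  qed
  then show ?thesis by (simp add: poly_eq_poly_eq_iff[symmetric] fun_eq_iff)
qed

text \<open>The substitution of \<open>branch_poly_scaled\<close> keeps monic polynomials monic, so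
  it can be applied to the factors A and B separately.\<close>

lemma lead_coeff_scaled:
  fixes A :: "complex poly"
  assumes "lead_coeff A = 1" "c \<noteq> 0"
  shows "lead_coeff (smult (c ^ degree A) (pcompose A [:0, 1 / c:])) = 1"
    "degree (smult (c ^ degree A) (pcompose A [:0, 1 / c:])) = degree A"
proof -
  show "degree (smult (c ^ degree A) (pcompose A [:0, 1 / c:])) = degree A"
    using assms(2) by (simp add: degree_pcompose)
  then show "lead_coeff (smult (c ^ degree A) (pcompose A [:0, 1 / c:])) = 1"
    using assms lead_coeff_comp[of "[:0, 1 / c:]" A] by (simp add: degree_pcompose power_divide)
qed

text \<open>
  The negation says that the monic polynomial \<open>p\<close> of even degree has at least four roots of odd
  multiplicity, so that \<open>y\<^sup>2 = p\<close> has positive geometric genus; \<open>B\<close> may have a double root.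
\<close>

definition degenerate_fibre :: "complex poly \<Rightarrow> bool" where
  "degenerate_fibre p \<longleftrightarrow>
     (\<exists>A B. p = A\<^sup>2 * B \<and> lead_coeff A = 1 \<and> lead_coeff B = 1 \<and> degree B = 2)"

section \<open>Parametrisation of the degenerate fibres and the dimension count\<close>

definition monic_poly :: "nat \<Rightarrow> (nat \<Rightarrow> 'a::comm_ring_1) \<Rightarrow> 'a poly" where
  "monic_poly n c = monom 1 n + (\<Sum>r<n. monom (c r) r)"

lemma coeff_monic_poly: "coeff (monic_poly n c) r = (if r < n then c r else if r = n then 1 else 0)"
proof -
  have "coeff (monic_poly n c) r = (if n = r then 1 else 0) + (\<Sum>i<n. if i = r then c i else 0)"
    by (simp add: monic_poly_def coeff_sum)
  then show ?thesis by simp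
qed

lemma monic_poly_coeff:
  assumes "degree A = n" "lead_coeff A = 1"
  shows "monic_poly n (coeff A) = A"
  using assms by (intro poly_eqI) (auto simp: coeff_monic_poly coeff_eq_0)

text \<open>The point p0 gets the coordinates (0 : 0 : 1). A form of degree k that does not vanish
  there contains the monomial \<gamma>^k and can be solved for it.\<close>

lemma linear_coordinates_plane:
  fixes p0 :: "complex ^ 3"
  assumes "p0 \<noteq> 0"
  obtains \<alpha> \<beta> \<gamma> :: "complex ^ 3 \<Rightarrow> complex" where
    "\<alpha> p0 = 0" "\<beta> p0 = 0" "\<gamma> p0 = 1"
    "\<And>v. \<exists>a b c. \<forall>x. x $ v = a * \<alpha> x + b * \<beta> x + c * \<gamma> x"
proof -
  obtain i where i: "p0 $ i \<noteq> 0" using assms by (auto simp: vec_eq_iff)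
  let ?\<gamma> = "\<lambda>x::complex^3. x $ i / p0 $ i"
  let ?h = "\<lambda>j x. x $ j - p0 $ j * ?\<gamma> x"
  have "(UNIV :: 3 set) = {1, 2, 3}" "(UNIV :: 3 set) = {2, 1, 3}" "(UNIV :: 3 set) = {3, 1, 2}"
    by (auto simp: UNIV_3)
  then obtain j1 j2 :: 3 where U: "UNIV = {i, j1, j2}"
    using exhaust_3[of i] by blast
  show thesis
  proof (rule that[of "?h j1" "?h j2" ?\<gamma>])
    fix v
    have "v = i \<or> v = j1 \<or> v = j2" using U by blast
    moreover have "\<forall>x::complex^3. x $ i = 0 * ?h j1 x + 0 * ?h j2 x + p0 $ i * ?\<gamma> x"
      using i by simp
    moreover have "\<forall>x::complex^3. x $ j1 = 1 * ?h j1 x + 0 * ?h j2 x + p0 $ j1 * ?\<gamma> x"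
      by simp
    moreover have "\<forall>x::complex^3. x $ j2 = 0 * ?h j1 x + 1 * ?h j2 x + p0 $ j2 * ?\<gamma> x"
      by simp
    ultimately show "\<exists>a b c. \<forall>x. x $ v = a * ?h j1 x + b * ?h j2 x + c * ?\<gamma> x"
      by metis
  qed (use i in auto)
qed

lemma (in form_functions) hspan_form:
  fixes X :: "'p \<Rightarrow> 'a ^ 3"
  assumes "\<And>v. \<exists>a b c. \<forall>p. X p $ v = a * \<alpha> p + b * \<beta> p + c * \<gamma> p"
    and "f \<in> forms UNIV n"
  shows "hspan n 0 (\<lambda>p. peval (($) (X p)) f)"
  unfolding peval_def
proof (intro lspan_sum lspan_scale)
  fix \<mu> assume "\<mu> \<in> Poly_Mapping.keys f"
  then have deg: "monom_degree \<mu> = n" using assms(2) by (auto simp: forms_def)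
  have "hspan 1 0 (\<lambda>p. X p $ v)" for v
  proof -
    obtain a b c where "\<forall>p. X p $ v = a * \<alpha> p + b * \<beta> p + c * \<gamma> p" using assms(1) by blast
    then show ?thesis by (simp add: lspan_add lspan_scale hspan_coords del: One_nat_def)
  qed
  then have "hspan (\<Sum>v\<in>UNIV. Poly_Mapping.lookup \<mu> v * 1) (\<Sum>v\<in>UNIV. Poly_Mapping.lookup \<mu> v * 0)
      (\<lambda>p. \<Prod>v\<in>UNIV. X p $ v ^ Poly_Mapping.lookup \<mu> v)"
    by (intro hspan_prod hspan_power) auto
  then show "hspan n 0 (\<lambda>p. monom_eval (($) (X p)) \<mu>)"
    using deg by (simp add: monom_degree_superset[of UNIV] monom_eval_superset[of UNIV])
qed

text \<open>At \<open>p\<^sub>0\<close> every monomial except \<gamma>^k vanishes, so the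
  coefficient of \<gamma>^k in q is the nonzero value of q there, and the equation q = 0 can be
  divided by it.\<close>

lemma hspan_reduction:
  fixes X :: "'p \<Rightarrow> 'a::field ^ 3"
  assumes "finite G" "q \<in> forms UNIV k"
    and X: "\<And>v. \<exists>a b c. \<forall>p. X p $ v = a * \<alpha> p + b * \<beta> p + c * \<gamma> p"
    and p0: "\<alpha> p\<^sub>0 = 0" "\<beta> p\<^sub>0 = 0" "\<gamma> p\<^sub>0 = 1" "peval (($) (X p\<^sub>0)) q \<noteq> 0"
    and P: "\<And>p. p \<in> P \<Longrightarrow> peval (($) (X p)) q = 0"
  shows "lspan P (form_functions.fmon \<alpha> \<beta> \<gamma> G g) (form_functions.fidx_red G k k 0) (\<lambda>p. \<gamma> p ^ k)"
proof -
  \<comment> \<open>q is expanded on the whole space rather than on P, because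
    \<open>p\<^sub>0\<close> does not lie on the curve.\<close>
  interpret U: form_functions UNIV \<alpha> \<beta> \<gamma> G g by unfold_locales fact
  obtain C where C: "\<And>p. peval (($) (X p)) q = (\<Sum>\<tau>\<in>U.fidx k 0. C \<tau> * U.fmon \<tau> p)"
    using U.hspan_form[of X q k, OF X assms(2)] by (auto simp: lspan_def)
  let ?t = "((0, 0, k), restrict (\<lambda>_. 0) G)"
  have eq: "U.fidx k 0 = insert ?t (U.fidx_red k k 0)"
    by (auto simp: U.fidx_def U.fidx_red_def PiE_iff extensional_def fun_eq_iff)
  have nin: "?t \<notin> U.fidx_red k k 0" by (auto simp: U.fidx_red_def)
  have fin: "finite (U.fidx_red k k 0)"
    using eq U.finite_fidx[of k 0] by (metis finite_insert)
  have split: "peval (($) (X p)) q = C ?t * \<gamma> p ^ k + (\<Sum>\<tau>\<in>U.fidx_red k k 0. C \<tau> * U.fmon \<tau> p)" for p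
    unfolding C eq using nin fin by (subst sum.insert) (auto simp: U.fmon_def)
  have "(\<Sum>\<tau>\<in>U.fidx_red k k 0. C \<tau> * U.fmon \<tau> p\<^sub>0) = 0"
  proof (intro sum.neutral ballI)
    fix \<tau> assume "\<tau> \<in> U.fidx_red k k 0"
    then show "C \<tau> * U.fmon \<tau> p\<^sub>0 = 0"
      using p0 by (auto simp: U.fidx_red_def U.fidx_def U.fmon_def power_0_left)
  qed
  then have "C ?t \<noteq> 0" using split[of p\<^sub>0] p0 by simp
  have "\<gamma> p ^ k = (\<Sum>\<tau>\<in>U.fidx_red k k 0. (- C \<tau> / C ?t) * U.fmon \<tau> p)" if "p \<in> P" for p
  proof -
    have "C ?t * \<gamma> p ^ k = - (\<Sum>\<tau>\<in>U.fidx_red k k 0. C \<tau> * U.fmon \<tau> p)"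
      using split[of p] P[OF that] by (simp add: eq_neg_iff_add_eq_0)
    then have "\<gamma> p ^ k = - (\<Sum>\<tau>\<in>U.fidx_red k k 0. C \<tau> * U.fmon \<tau> p) / C ?t"
      using \<open>C ?t \<noteq> 0\<close> by (simp add: field_simps)
    then show ?thesis by (simp add: sum_divide_distrib sum_negf)
  qed
  then show ?thesis unfolding lspan_def by (intro exI[of _ "\<lambda>\<tau>. - C \<tau> / C ?t"]) blast
qed

definition bad_param where
  "bad_param m s q F \<longleftrightarrow>
     (\<exists>x. x \<noteq> 0 \<and> peval (($) x) q = 0 \<and> degenerate_fibre (branch_poly m s F x))"

lemma coeff_square_mult:
  "coeff (A\<^sup>2 * B) n = (\<Sum>i\<le>n. (\<Sum>j\<le>i. coeff A j * coeff A (i - j)) * coeff B (n - i))"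
  by (simp add: coeff_mult power2_eq_square)

text \<open>Dimension count for triples (x, c, F) with a factored branch polynomial, split into
  pieces where s_j(x) = 1. There the 2 l coefficients of the pure powers of the j-th variable in F
  are determined by the remaining data: the i-th fibre coefficient F_i(s(x)) is linear in the
  coefficient of the i-th power, with factor s_j(x)^i = 1. The factors have l + 1 coefficients, so
  card V - 2 l + l + 1 parameters remain. Adding 1 for the point x of the curve and 1 to leave
  positive codimension gives at most card V because l \<ge> 3.\<close>

lemma bad_param_algebraic:
  fixes q :: ternary_poly and s :: "nat \<Rightarrow> ternary_poly"
  assumes l: "l \<ge> 3"
    and s': "\<forall>j<N. s j \<in> ternary_forms k"
    and q: "q \<in> ternary_forms k" "peval (($) p\<^sub>0) q \<noteq> 0" "p\<^sub>0 \<noteq> 0"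
  defines "V \<equiv> {(i, \<mu>). i \<in> {1..2 * l} \<and> Poly_Mapping.keys \<mu> \<subseteq> {..<N} \<and> monom_degree \<mu> = i}"
  shows "finite V" and "\<exists>d w. (\<exists>e\<in>V \<rightarrow>\<^sub>E {..<d::nat}. w e \<noteq> 0) \<and>
     (\<forall>F x c. F \<in> deformation_params N (2 * l) \<and> peval (($) x) q = 0 \<and> (\<exists>j<N. peval (($) x) (s j) = 1) \<and>
        branch_poly (2 * l) s F x =
          (monic_poly (l - 1) c)\<^sup>2 * monic_poly 2 (\<lambda>r. c (l - 1 + r)) \<longrightarrow>
        (\<Sum>e\<in>V \<rightarrow>\<^sub>E {..<d}. w e * (\<Prod>v\<in>V. param_coord F v ^ e v)) = 0)"
proof -
  have s: "s j \<in> ternary_forms k" if "j < N" for j using s' that by blast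
  define m where "m = 2 * l"
  have V_eq: "V = (SIGMA i:{1..m}. {\<mu>. Poly_Mapping.keys \<mu> \<subseteq> {..<N} \<and> monom_degree \<mu> = i})"
    by (auto simp: V_def m_def)
  show finV: "finite V"
    unfolding V_eq using finite_monomials by (intro finite_SigmaI) auto
  obtain \<alpha>' \<beta>' \<gamma>' :: "complex ^ 3 \<Rightarrow> complex" where coords: "\<alpha>' p\<^sub>0 = 0" "\<beta>' p\<^sub>0 = 0" "\<gamma>' p\<^sub>0 = 1"
    "\<And>v. \<exists>a b c. \<forall>x. x $ v = a * \<alpha>' x + b * \<beta>' x + c * \<gamma>' x"
    using linear_coordinates_plane[OF q(3)] by metis
  define X :: "(complex ^ 3) \<times> (nat \<Rightarrow> complex) \<times> (nat \<Rightarrow> (nat, complex) mpoly) \<Rightarrow> complex ^ 3"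
    where "X = fst"
  define Cf :: "(complex ^ 3) \<times> (nat \<Rightarrow> complex) \<times> (nat \<Rightarrow> (nat, complex) mpoly) \<Rightarrow> nat \<Rightarrow> complex"
    where "Cf p = fst (snd p)" for p
  define Fp :: "(complex ^ 3) \<times> (nat \<Rightarrow> complex) \<times> (nat \<Rightarrow> (nat, complex) mpoly) \<Rightarrow> nat \<Rightarrow> (nat, complex) mpoly"
    where "Fp p = snd (snd p)" for p
  define \<alpha> where "\<alpha> p = \<alpha>' (X p)" for p
  define \<beta> where "\<beta> p = \<beta>' (X p)" for p
  define \<gamma> where "\<gamma> p = \<gamma>' (X p)" for p
  define A where "A p = monic_poly (l - 1) (Cf p)" for p
  define B where "B p = monic_poly 2 (\<lambda>r. Cf p (l - 1 + r))" for p
  define P where "P j = {p. Fp p \<in> deformation_params N m \<and> peval (($) (X p)) q = 0 \<and>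
      peval (($) (X p)) (s j) = 1 \<and> branch_poly m s (Fp p) (X p) = (A p)\<^sup>2 * B p}" for j
  \<comment> \<open>The coefficients of the pure powers of the j-th variable, for which the fibre
    equation will be solved.\<close>
  define L where "L j = (\<lambda>i. (i, Poly_Mapping.single j i)) ` {1..m}" for j :: nat
  \<comment> \<open>Free parameters: \<open>Inl\<close> for the coefficients of A and B,
    \<open>Inr\<close> for the remaining coefficients of F.\<close>
  define G where "G j = Inl ` {..<l + 1} \<union> Inr ` (V - L j)" for j
  define g where "g = case_sum (\<lambda>r p. Cf p r) (\<lambda>v p. param_coord (Fp p) v)"
  define Y where "Y = (\<lambda>v p. param_coord (Fp p) v)"
  have X: "\<exists>a b c. \<forall>p. X p $ v = a * \<alpha> p + b * \<beta> p + c * \<gamma> p" for v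
    using coords(4)[of v] unfolding \<alpha>_def \<beta>_def \<gamma>_def by blast
  have L: "L j \<subseteq> V" "card (L j) = m" if "j < N" for j
  proof -
    show "L j \<subseteq> V" using that by (auto simp: L_def V_eq monom_degree_def)
    have "inj_on (\<lambda>i. (i, Poly_Mapping.single j i)) {1..m}" by (auto simp: inj_on_def)
    then show "card (L j) = m" unfolding L_def by (subst card_image) auto
  qed
  have G: "finite (G j)" "card (G j) + 2 \<le> card V" if "j < N" for j
  proof -
    show "finite (G j)" using finV by (auto simp: G_def)
    have "card (V - L j) = card V - m"
      using L[OF that] finV by (subst card_Diff_subset) (auto intro: finite_subset)
    moreover have "card (G j) = card (Inl ` {..<l + 1} :: (nat + nat \<times> (nat \<Rightarrow>\<^sub>0 nat)) set) +
        card (Inr ` (V - L j) :: (nat + nat \<times> (nat \<Rightarrow>\<^sub>0 nat)) set)"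
      unfolding G_def using finV by (intro card_Un_disjoint) auto
    ultimately have "card (G j) = l + 1 + (card V - m)"
      by (simp add: card_image)
    moreover have "m \<le> card V" using L[OF that] finV by (metis card_mono)
    ultimately show "card (G j) + 2 \<le> card V" using l by (simp add: m_def)
  qed
  have red: "lspan (P j) (form_functions.fmon \<alpha> \<beta> \<gamma> (G j) g) (form_functions.fidx_red (G j) k k 0)
      (\<lambda>p. \<gamma> p ^ k)" if "j < N" for j
  proof (rule hspan_reduction[OF G(1)[OF that] q(1) X, where p\<^sub>0 = "(p\<^sub>0, \<lambda>_. 0, \<lambda>_. 0)"])
    show "\<alpha> (p\<^sub>0, \<lambda>_. 0, \<lambda>_. 0) = 0" "\<beta> (p\<^sub>0, \<lambda>_. 0, \<lambda>_. 0) = 0" "\<gamma> (p\<^sub>0, \<lambda>_. 0, \<lambda>_. 0) = 1"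
      "peval (($) (X (p\<^sub>0, \<lambda>_. 0, \<lambda>_. 0))) q \<noteq> 0"
      using coords q by (auto simp: \<alpha>_def \<beta>_def \<gamma>_def X_def)
  qed (auto simp: P_def)
  \<comment> \<open>Degree 3 in the parameters because A^2 B is cubic in the coefficients of A and
    B; degree m k in the plane coordinates because F_i(s) has degree i k \<le> m k.\<close>
  have main: "lspan (P j) (form_functions.fmon \<alpha> \<beta> \<gamma> (G j) g) (form_functions.fidx (G j) (m * k) 3) (\<lambda>_. 1)"
    "\<And>v. v \<in> V \<Longrightarrow>
     lspan (P j) (form_functions.fmon \<alpha> \<beta> \<gamma> (G j) g) (form_functions.fidx (G j) (m * k) 3) (Y v)"
    if j: "j < N" for j
  proof -
    interpret form_functions "P j" \<alpha> \<beta> \<gamma> "G j" g by unfold_locales (rule G(1)[OF j])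
    \<comment> \<open>On P j the form s_j equals 1, so its powers raise the degree without changing
      the function.\<close>
    have pad: "hspan (r * k) 0 (\<lambda>_. 1)" for r
    proof -
      have "hspan (r * k) (r * 0) (\<lambda>p. peval (($) (X p)) (s j) ^ r)"
        by (rule hspan_power[OF hspan_form[OF X s[OF j]]])
      then have "hspan (r * k) (r * 0) (\<lambda>_. 1)"
        by (rule lspan_cong) (simp add: P_def)
      then show ?thesis by simp
    qed
    have one: "hspan (m * k) D (\<lambda>_. 1)" for D
      by (rule hspan_mono[OF pad]) simp
    show "hspan (m * k) 3 (\<lambda>_. 1)" by (rule one)
    have padded: "hspan (m * k) 3 f" if f: "hspan (i * k) D f" "i \<le> m" "D \<le> 3" for f i D
    proof -
      have "hspan (i * k + (m - i) * k) (D + 0) (\<lambda>p. f p * 1)"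
        by (rule hspan_mult[OF f(1) pad])
      then have "hspan (m * k) D f"
        using f(2) by (simp flip: distrib_right)
      then show ?thesis using f(3) by (rule hspan_mono)
    qed
    have param: "hspan 0 1 (\<lambda>p. Cf p r)" if "r < l + 1" for r
      using hspan_param[of "Inl r"] that by (auto simp: G_def g_def)
    have free: "hspan 0 1 (Y v)" if "v \<in> V - L j" for v
      using hspan_param[of "Inr v"] that by (auto simp: G_def g_def Y_def cong: if_cong)
    have const: "hspan 0 1 (\<lambda>_. r)" for r :: complex
      by (rule hspan_mono[OF hspan_const]) simp
    have coeffA: "hspan 0 1 (\<lambda>p. coeff (A p) r)" for r
      unfolding A_def coeff_monic_poly using param[of r] const[of 1] const[of 0]
      by (cases "r < l - 1"; cases "r = l - 1") auto
    have coeffB: "hspan 0 1 (\<lambda>p. coeff (B p) r)" for r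
      unfolding B_def coeff_monic_poly using param[of "l - 1 + r"] const[of 1] const[of 0] l
      by (cases "r < 2"; cases "r = 2") auto
    have coeffAB: "hspan 0 3 (\<lambda>p. coeff ((A p)\<^sup>2 * B p) r)" for r
    proof -
      have AA: "hspan 0 2 (\<lambda>p. coeff (A p) i * coeff (A p) j)" for i j
        using hspan_mult[OF coeffA[of i] coeffA[of j]] by (simp add: numeral_2_eq_2)
      have "hspan (0 + 0) (2 + 1) (\<lambda>p. \<Sum>i\<le>r. (\<Sum>j\<le>i. coeff (A p) j * coeff (A p) (i - j)) * coeff (B p) (r - i))"
        by (intro lspan_sum hspan_mult AA coeffB)
      then show ?thesis by (simp add: coeff_square_mult)
    qed
    fix v assume v: "v \<in> V"
    show "hspan (m * k) 3 (Y v)"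
    proof (cases "v \<in> L j")
      case False
      then show ?thesis using padded[of 0 1 "Y v"] free[of v] v by simp
    next
      case True
      then obtain i where i: "i \<in> {1..m}" "v = (i, Poly_Mapping.single j i)" by (auto simp: L_def)
      let ?M = "{\<mu>. Poly_Mapping.keys \<mu> \<subseteq> {..<N} \<and> monom_degree \<mu> = i}"
      let ?S = "\<lambda>p j. peval (($) (X p)) (s j)"
      have mon: "hspan (i * k) 0 (\<lambda>p. monom_eval (?S p) \<mu>)" if \<mu>: "\<mu> \<in> ?M" for \<mu>
      proof -
        have "hspan (\<Sum>r<N. Poly_Mapping.lookup \<mu> r * k) (\<Sum>r<N. Poly_Mapping.lookup \<mu> r * 0)
           (\<lambda>p. \<Prod>r<N. ?S p r ^ Poly_Mapping.lookup \<mu> r)"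
          by (intro hspan_prod hspan_power hspan_form[OF X s]) auto
        moreover have "(\<Sum>r<N. Poly_Mapping.lookup \<mu> r * k) = i * k"
          using \<mu> monom_degree_superset[of "{..<N}" \<mu>] by (simp flip: sum_distrib_right)
        ultimately show ?thesis
          using \<mu> by (simp add: monom_eval_superset[of "{..<N}"])
      qed
      have rest: "hspan (m * k) 3 (\<lambda>p. Y (i, \<mu>) p * monom_eval (?S p) \<mu>)"
        if \<mu>: "\<mu> \<in> ?M - {Poly_Mapping.single j i}" for \<mu>
      proof -
        have "(i, \<mu>) \<in> V - L j" using \<mu> i by (auto simp: V_eq L_def)
        from hspan_mult[OF free[OF this] mon[of \<mu>]] show ?thesis
          using \<mu> i by (intro padded[of i 1]) auto
      qed
      \<comment> \<open>The equation for the coefficient of index m - i, solved for the coefficient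
        of the i-th power of the j-th variable.\<close>
      have "hspan (m * k) 3 (\<lambda>p. coeff ((A p)\<^sup>2 * B p) (m - i) +
          (-1) * (\<Sum>\<mu>\<in>?M - {Poly_Mapping.single j i}. Y (i, \<mu>) p * monom_eval (?S p) \<mu>))"
        using padded[of 0 3, OF _ _ order_refl] coeffAB by (intro lspan_add lspan_scale lspan_sum rest) auto
      then show ?thesis
      proof (rule lspan_cong)
        fix p assume p: "p \<in> P j"
        have F: "Fp p i \<in> forms {..<N} i"
          using p i by (intro deformation_params_forms) (auto simp: P_def)
        have jM: "Poly_Mapping.single j i \<in> ?M"
          using j i by (auto simp: monom_degree_def)
        have "coeff ((A p)\<^sup>2 * B p) (m - i) = peval (?S p) (Fp p i)"
          using p coeff_branch_poly[OF i(1), of s "Fp p" "X p"] by (simp add: P_def)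
        also have "\<dots> = (\<Sum>\<mu>\<in>?M. Y (i, \<mu>) p * monom_eval (?S p) \<mu>)"
          using F finite_monomials[of N i]
          by (subst peval_superset[of ?M]) (auto simp: forms_def Y_def param_coord_def)
        also have "\<dots> = Y v p * monom_eval (?S p) (Poly_Mapping.single j i) +
            (\<Sum>\<mu>\<in>?M - {Poly_Mapping.single j i}. Y (i, \<mu>) p * monom_eval (?S p) \<mu>)"
          using jM finite_monomials[of N i] i by (subst sum.remove[of ?M]) auto
        also have "monom_eval (?S p) (Poly_Mapping.single j i) = 1"
          using p by (simp add: P_def)
        finally show "coeff ((A p)\<^sup>2 * B p) (m - i) +
          (-1) * (\<Sum>\<mu>\<in>?M - {Poly_Mapping.single j i}. Y (i, \<mu>) p * monom_eval (?S p) \<mu>) = Y v p"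
          by simp
      qed
    qed
  qed
  have "\<exists>d w. (\<exists>e\<in>V \<rightarrow>\<^sub>E {..<d::nat}. w e \<noteq> 0) \<and>
     (\<forall>j\<in>{..<N}. \<forall>p\<in>P j. (\<Sum>e\<in>V \<rightarrow>\<^sub>E {..<d}. w e * (\<Prod>v\<in>V. Y v p ^ e v)) = 0)"
  proof (rule algebraic_relation_by_counting[where \<alpha> = \<alpha> and \<beta> = \<beta> and \<gamma> = \<gamma> and G = G and g = "\<lambda>_. g"
        and n\<^sub>0 = "m * k" and D\<^sub>0 = 3 and k = k])
    show "finite {..<N}" by simp
    show "finite V" by (rule finV)
    fix j assume "j \<in> {..<N}"
    then have j: "j < N" by simp
    show "finite (G j)" "card (G j) + 2 \<le> card V" by (rule G[OF j])+
    show "lspan (P j) (form_functions.fmon \<alpha> \<beta> \<gamma> (G j) g) (form_functions.fidx (G j) (m * k) 3) (\<lambda>_. 1)"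
      by (rule main(1)[OF j])
    show "lspan (P j) (form_functions.fmon \<alpha> \<beta> \<gamma> (G j) g) (form_functions.fidx (G j) (m * k) 3) (Y v)"
      if "v \<in> V" for v by (rule main(2)[OF j that])
    show "lspan (P j) (form_functions.fmon \<alpha> \<beta> \<gamma> (G j) g) (form_functions.fidx_red (G j) k k 0)
      (\<lambda>p. \<gamma> p ^ k)" by (rule red[OF j])
  qed
  then obtain d w where dw: "\<exists>e\<in>V \<rightarrow>\<^sub>E {..<d::nat}. w e \<noteq> 0" and
     "\<forall>j\<in>{..<N}. \<forall>p\<in>P j. (\<Sum>e\<in>V \<rightarrow>\<^sub>E {..<d}. w e * (\<Prod>v\<in>V. Y v p ^ e v)) = 0"
    by (elim exE conjE)
  then have dw2: "(\<Sum>e\<in>V \<rightarrow>\<^sub>E {..<d}. w e * (\<Prod>v\<in>V. Y v p ^ e v)) = 0" if "j < N" "p \<in> P j" for j p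
    using that by blast
  show "\<exists>d w. (\<exists>e\<in>V \<rightarrow>\<^sub>E {..<d::nat}. w e \<noteq> 0) \<and>
     (\<forall>F x c. F \<in> deformation_params N (2 * l) \<and> peval (($) x) q = 0 \<and> (\<exists>j<N. peval (($) x) (s j) = 1) \<and>
        branch_poly (2 * l) s F x =
          (monic_poly (l - 1) c)\<^sup>2 * monic_poly 2 (\<lambda>r. c (l - 1 + r)) \<longrightarrow>
        (\<Sum>e\<in>V \<rightarrow>\<^sub>E {..<d}. w e * (\<Prod>v\<in>V. param_coord F v ^ e v)) = 0)"
  proof (rule exI[of _ d], rule exI[of _ w], rule conjI, rule dw, intro allI impI, elim conjE exE)
    fix F x c j
    assume "F \<in> deformation_params N (2 * l)" "peval (($) x) q = 0" "j < N" "peval (($) x) (s j) = 1"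
      "branch_poly (2 * l) s F x = (monic_poly (l - 1) c)\<^sup>2 * monic_poly 2 (\<lambda>r. c (l - 1 + r))"
    then have "(x, c, F) \<in> P j"
      by (auto simp: P_def m_def A_def B_def X_def Cf_def Fp_def)
    from dw2[OF \<open>j < N\<close> this]
    show "(\<Sum>e\<in>V \<rightarrow>\<^sub>E {..<d}. w e * (\<Prod>v\<in>V. param_coord F v ^ e v)) = 0"
      by (simp add: Y_def Fp_def)
  qed
qed

lemma exists_complex_root_nonzero:
  assumes "(b::complex) \<noteq> 0" "k > 0"
  obtains c where "c \<noteq> 0" "c ^ k = b"
proof -
  have "(exp (ln b / of_nat k)) ^ k = b"
    using assms by (simp flip: exp_of_nat_mult)
  then show thesis using that exp_not_eq_zero by blast
qed

text \<open>The relation from the dimension count is a nonzero polynomial Q in the coefficients of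
  F, and U is the set where Q does not vanish. For a bad F the point x is first rescaled so that
  some s_j(x) = 1, which base point freeness allows.\<close>

theorem generic_params_not_bad:
  fixes q :: ternary_poly and s :: "nat \<Rightarrow> ternary_poly"
  assumes l: "l \<ge> 3" and k: "k > 0"
    and s: "\<And>j. j < N \<Longrightarrow> s j \<in> ternary_forms k"
    and bpf: "\<And>x. x \<noteq> 0 \<Longrightarrow> \<exists>j<N. peval (($) x) (s j) \<noteq> 0"
    and q: "q \<in> ternary_forms k" "peval (($) p\<^sub>0) q \<noteq> 0" "p\<^sub>0 \<noteq> 0"
  shows "\<exists>U. zariski_open_params N (2 * l) U \<and> U \<noteq> {} \<and>
     (\<forall>F\<in>U. F \<in> deformation_params N (2 * l) \<and> \<not> bad_param (2 * l) s q F)"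
proof -
  have s': "\<forall>j<N. s j \<in> ternary_forms k" using s by blast
  define V where "V = {(i, \<mu>). i \<in> {1..2 * l} \<and> Poly_Mapping.keys \<mu> \<subseteq> {..<N} \<and> monom_degree \<mu> = i}"
  have finV: "finite V"
    unfolding V_def by (rule bad_param_algebraic(1)[OF l s' q])
  obtain d w where w: "\<exists>e\<in>V \<rightarrow>\<^sub>E {..<d::nat}. w e \<noteq> 0"
    and rel': "\<forall>F x c. F \<in> deformation_params N (2 * l) \<and> peval (($) x) q = 0 \<and>
        (\<exists>j<N. peval (($) x) (s j) = 1) \<and>
        branch_poly (2 * l) s F x = (monic_poly (l - 1) c)\<^sup>2 * monic_poly 2 (\<lambda>r. c (l - 1 + r)) \<longrightarrow>
        (\<Sum>e\<in>V \<rightarrow>\<^sub>E {..<d}. w e * (\<Prod>v\<in>V. param_coord F v ^ e v)) = 0"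
    using bad_param_algebraic(2)[OF l s' q, folded V_def] by (elim exE conjE)
  have rel: "(\<Sum>e\<in>V \<rightarrow>\<^sub>E {..<d}. w e * (\<Prod>v\<in>V. param_coord F v ^ e v)) = 0"
    if "F \<in> deformation_params N (2 * l)" "peval (($) x) q = 0" "j < N" "peval (($) x) (s j) = 1"
       "branch_poly (2 * l) s F x = (monic_poly (l - 1) c)\<^sup>2 * monic_poly 2 (\<lambda>r. c (l - 1 + r))"
    for F x c j
    by (rule rel'[rule_format, of F x c]) (use that in auto)
  let ?E = "V \<rightarrow>\<^sub>E {..<d}"
  define Q where "Q = (\<Sum>e\<in>?E. Poly_Mapping.single (\<Sum>v\<in>V. Poly_Mapping.single v (e v)) (w e))"
  have Q: "peval Y Q = (\<Sum>e\<in>?E. w e * (\<Prod>v\<in>V. Y v ^ e v))" for Y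
    by (simp add: Q_def peval_sum peval_single monom_eval_sum)
  define U where "U = {F \<in> deformation_params N (2 * l). peval (param_coord F) Q \<noteq> 0}"
  have "zariski_open_params N (2 * l) U"
    unfolding zariski_open_params_def zariski_closed_params_def
    by (auto simp: U_def mpoly_eval_eq_peval simp del: id_apply intro!: exI[of _ "{Q}"])
  moreover have "U \<noteq> {}"
  proof -
    obtain Y where Y: "(\<Sum>e\<in>?E. w e * (\<Prod>v\<in>V. Y v ^ e v)) \<noteq> 0"
      using exists_nonzero_value[OF finV w] by blast
    let ?M = "\<lambda>i. {\<mu>. Poly_Mapping.keys \<mu> \<subseteq> {..<N} \<and> monom_degree \<mu> = i}"
    define F where "F i = (if i \<in> {1..2 * l} then \<Sum>\<mu>\<in>?M i. Poly_Mapping.single \<mu> (Y (i, \<mu>)) else 0)" for i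
    have lookup: "Poly_Mapping.lookup (F i) \<mu> = (if i \<in> {1..2 * l} \<and> \<mu> \<in> ?M i then Y (i, \<mu>) else 0)" for i \<mu>
      using finite_monomials[of N i]
      by (auto simp: F_def lookup_sum lookup_single when_def)
    have keys: "Poly_Mapping.keys (F i) \<subseteq> ?M i" for i
      unfolding subset_iff in_keys_iff lookup by (metis (no_types, lifting))
    have "F i \<in> (if i \<in> {1..2 * l} then forms {..<N} i else {0})" for i
      using keys[of i] by (cases "i \<in> {1..2 * l}") (auto simp: forms_def, simp_all add: F_def)
    then have "F \<in> deformation_params N (2 * l)"
      unfolding deformation_params_def by blast
    moreover have "peval (param_coord F) Q = (\<Sum>e\<in>?E. w e * (\<Prod>v\<in>V. Y v ^ e v))"
      unfolding Q by (intro sum.cong prod.cong refl arg_cong2[of _ _ _ _ "(*)"] arg_cong2[of _ _ _ _ "(^)"])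
        (auto simp: param_coord_def lookup V_def)
    ultimately have "F \<in> U" using Y by (simp add: U_def)
    then show ?thesis by blast
  qed
  moreover have "\<not> bad_param (2 * l) s q F" if FU: "F \<in> U" for F
  proof
    assume "bad_param (2 * l) s q F"
    then obtain x A B where x: "x \<noteq> 0" "peval (($) x) q = 0" and AB: "branch_poly (2 * l) s F x = A\<^sup>2 * B"
      "lead_coeff A = 1" "lead_coeff B = 1" "degree B = 2"
      by (auto simp: bad_param_def degenerate_fibre_def)
    have F: "F \<in> deformation_params N (2 * l)" using FU by (simp add: U_def)
    obtain j where j: "j < N" "peval (($) x) (s j) \<noteq> 0" using bpf[OF x(1)] by blast
    have nz: "1 / peval (($) x) (s j) \<noteq> 0" using j(2) by simp
    \<comment> \<open>With this c the form s_j takes the value 1 at c x.\<close>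
    obtain c where c: "c \<noteq> 0" "c ^ k = 1 / peval (($) x) (s j)"
      by (rule exists_complex_root_nonzero[OF nz k])
    define b where "b = c ^ k"
    have b: "b \<noteq> 0" using c(1) by (simp add: b_def)
    have lead: "lead_coeff (branch_poly (2 * l) s F x) = 1" "degree (branch_poly (2 * l) s F x) = 2 * l"
    proof -
      let ?R = "\<Sum>i=1..2 * l. monom (peval (\<lambda>j. peval (($) x) (s j)) (F i)) (2 * l - i)"
      have "degree ?R < 2 * l"
        using l by (intro le_less_trans[OF degree_sum_le[where n = "2 * l - 1"]])
          (auto intro!: order.trans[OF degree_monom_le])
      then show d: "degree (branch_poly (2 * l) s F x) = 2 * l"
        unfolding branch_poly_def by (subst degree_add_eq_left) (auto simp: degree_monom_eq)
      show "lead_coeff (branch_poly (2 * l) s F x) = 1"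
        unfolding d using \<open>degree ?R < 2 * l\<close> by (simp add: branch_poly_def coeff_eq_0)
    qed
    have A0: "A \<noteq> 0" "B \<noteq> 0" using AB by auto
    then have dA: "degree A = l - 1"
      using lead(2) AB by (simp add: degree_mult_eq degree_power_eq)
    let ?t = "\<lambda>p. smult (b ^ degree p) (pcompose p [:0, 1 / b:])"
    have tA: "lead_coeff (?t A) = 1" "degree (?t A) = l - 1"
      and tB: "lead_coeff (?t B) = 1" "degree (?t B) = 2"
      using lead_coeff_scaled[of A b] lead_coeff_scaled[of B b] AB b dA by auto
    have "branch_poly (2 * l) s F (c *s x) = smult (b ^ (2 * l)) (pcompose (A\<^sup>2 * B) [:0, 1 / b:])"
      using branch_poly_scaled[where m = "2 * l" and x = x, OF s F c(1)] AB by (simp add: b_def)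
    also have "\<dots> = (?t A)\<^sup>2 * ?t B"
    proof -
      have "b ^ (2 * l) = b ^ degree A * b ^ degree A * b ^ degree B"
      proof -
        have "2 * l = degree A + degree A + degree B" using dA AB(4) l by simp
        then show ?thesis by (simp only: power_add)
      qed
      then show ?thesis
        by (simp add: pcompose_mult power2_eq_square mult_ac)
    qed
    finally have eq: "branch_poly (2 * l) s F (c *s x) = (?t A)\<^sup>2 * ?t B" .
    \<comment> \<open>One sequence for both factors: the l - 1 lower coefficients of A, then the two
      of B.\<close>
    define e where "e r = (if r < l - 1 then coeff (?t A) r else coeff (?t B) (r - (l - 1)))" for r
    have "monic_poly (l - 1) e = monic_poly (l - 1) (coeff (?t A))"
      by (intro poly_eqI) (auto simp: coeff_monic_poly e_def)
    also have "\<dots> = ?t A" using tA by (intro monic_poly_coeff) auto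
    finally have eA: "monic_poly (l - 1) e = ?t A" .
    have "monic_poly 2 (\<lambda>r. e (l - 1 + r)) = monic_poly 2 (coeff (?t B))"
      by (intro poly_eqI) (auto simp: coeff_monic_poly e_def)
    also have "\<dots> = ?t B" using tB by (intro monic_poly_coeff) auto
    finally have eB: "monic_poly 2 (\<lambda>r. e (l - 1 + r)) = ?t B" .
    have "(\<Sum>e\<in>?E. w e * (\<Prod>v\<in>V. param_coord F v ^ e v)) = 0"
    proof (rule rel[OF F _ j(1)])
      show "peval (($) (c *s x)) q = 0" using x(2) by (simp add: peval_scaled[OF q(1)])
      show "peval (($) (c *s x)) (s j) = 1" using j(2) unfolding peval_scaled[OF s[OF j(1)]] c(2) by simp
      show "branch_poly (2 * l) s F (c *s x) = (monic_poly (l - 1) e)\<^sup>2 * monic_poly 2 (\<lambda>r. e (l - 1 + r))"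
        unfolding eA eB by (rule eq)
    qed
    then show False using FU Q[of "param_coord F"] by (simp add: U_def)
  qed
  ultimately show ?thesis by (intro exI[of _ U]) (auto simp: U_def)
qed

section \<open>Entire curves in hyperelliptic curves\<close>

lemma complex_poly_root:
  "degree (p :: complex poly) \<noteq> 0 \<Longrightarrow> \<exists>z. poly p z = 0"
  using Fundamental_Theorem_Algebra.fundamental_theorem_of_algebra[of p] by (simp add: constant_degree)

text \<open>A multiple root a gives a factor (u - a)^2, whose root u - a goes into A; this is
  repeated until no multiple root remains.\<close>

lemma squarefree_decomposition:
  fixes p :: "complex poly"
  assumes "lead_coeff p = 1"
  shows "\<exists>A B. p = A\<^sup>2 * B \<and> lead_coeff A = 1 \<and> lead_coeff B = 1 \<and> rsquarefree B"
  using assms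
proof (induction "degree p" arbitrary: p rule: less_induct)
  case less
  show ?case
  proof (cases "rsquarefree p")
    case True
    then show ?thesis using less.prems by (intro exI[of _ 1] exI[of _ p]) auto
  next
    case False
    have "p \<noteq> 0" using less.prems by auto
    then obtain a where "order a p \<noteq> 0" "order a p \<noteq> 1"
      using False by (auto simp: rsquarefree_def)
    then have "[:- a, 1:] ^ 2 dvd p"
      using order_1[of a p] le_imp_power_dvd[of 2 "order a p" "[:- a, 1:]"] dvd_trans by fastforce
    then obtain p' where p': "p = [:- a, 1:] ^ 2 * p'" by (auto simp: dvd_def)
    have "p' \<noteq> 0" using p' \<open>p \<noteq> 0\<close> by auto
    have "lead_coeff p' = 1"
      using less.prems unfolding p' by (simp add: lead_coeff_mult lead_coeff_power del: lead_coeff_pCons)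
    moreover have "degree p' < degree p"
      using \<open>p' \<noteq> 0\<close> by (simp add: p' degree_mult_eq degree_power_eq)
    ultimately obtain A B where "p' = A\<^sup>2 * B" "lead_coeff A = 1" "lead_coeff B = 1" "rsquarefree B"
      using less.hyps by blast
    then show ?thesis
      by (intro exI[of _ "[:- a, 1:] * A"] exI[of _ B])
         (simp add: p' lead_coeff_mult power_mult_distrib mult.assoc del: mult_pCons_left)
  qed
qed

text \<open>The degree of B is even, not 2 by hypothesis, and not 0: if p = A^2, then taking one
  linear factor u - a out of A gives a degenerate factorisation with B = (u - a)^2.\<close>

lemma degenerate_fibre_if_small:
  fixes p :: "complex poly"
  assumes "lead_coeff p = 1" "degree p = 2 * l" "l \<ge> 1" "\<not> degenerate_fibre p"
  obtains A B where "p = A\<^sup>2 * B" "lead_coeff A = 1" "lead_coeff B = 1" "rsquarefree B" "degree B \<ge> 4"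
proof -
  obtain A B where AB: "p = A\<^sup>2 * B" "lead_coeff A = 1" "lead_coeff B = 1" "rsquarefree B"
    using squarefree_decomposition[OF assms(1)] by blast
  have nz: "A \<noteq> 0" "B \<noteq> 0" using AB by auto
  have deg: "2 * degree A + degree B = 2 * l"
    using assms(2) nz unfolding AB(1) by (simp add: degree_mult_eq degree_power_eq)
  have "degree B \<noteq> 2" using assms(4) AB by (auto simp: degenerate_fibre_def)
  moreover have "degree B \<noteq> 0"
  proof
    assume "degree B = 0"
    then obtain b where "B = [:b:]" by (rule degree_eq_zeroE)
    then have "B = 1" using AB(3) by (simp add: one_pCons)
    have "degree A > 0" using deg assms(3) \<open>degree B = 0\<close> by simp
    then obtain a where "poly A a = 0"
      using complex_poly_root[of A] by auto
    then obtain A' where A': "A = [:- a, 1:] * A'" by (auto simp: poly_eq_0_iff_dvd dvd_def)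
    have "lead_coeff A' = 1" using AB(2) unfolding A' lead_coeff_mult by simp
    moreover have "p = A'\<^sup>2 * [:- a, 1:]\<^sup>2"
      unfolding AB(1) \<open>B = 1\<close> A' power_mult_distrib by (simp only: mult_1_right mult_1_left mult.commute)
    moreover have "degree ([:- a, 1:]\<^sup>2) = 2"
      by (simp add: degree_power_eq)
    moreover have "lead_coeff ([:- a, 1:]\<^sup>2) = 1"
      unfolding lead_coeff_power by simp
    ultimately have "degenerate_fibre p"
      unfolding degenerate_fibre_def by (intro exI[of _ A'] exI[of _ "[:- a, 1:]\<^sup>2"]) simp
    then show False using assms(4) by simp
  qed
  moreover have "even (degree B)" using deg by presburger
  ultimately have "degree B \<ge> 4" by presburger
  then show thesis using AB that by blast
qed

text \<open>This makes it possible to write U' / v without dividing by v.\<close>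

lemma rsquarefree_bezout:
  fixes B :: "complex poly"
  assumes "rsquarefree B"
  obtains a b where "a * B + b * pderiv B = 1"
proof -
  have "coprime B (pderiv B)"
  proof (rule coprimeI)
    fix d assume d: "d dvd B" "d dvd pderiv B"
    have "B \<noteq> 0" using assms by (auto simp: rsquarefree_def)
    then have "d \<noteq> 0" using d by auto
    have "degree d = 0"
    proof (rule ccontr)
      assume "degree d \<noteq> 0"
      then obtain z where "poly d z = 0"
        using complex_poly_root by blast
      then have "poly B z = 0" "poly (pderiv B) z = 0"
        using d by (auto simp: dvd_def)
      then show False using assms by (auto simp: rsquarefree_roots)
    qed
    then show "is_unit d" using \<open>d \<noteq> 0\<close> by (simp add: is_unit_iff_degree)
  qed
  then show thesis
    using that bezout_coefficients_fst_snd[of B "pderiv B"] by (metis coprime_iff_gcd_eq_1)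
qed

text \<open>B(u) / u^(deg B) is the reversed polynomial at 1 / u and tends to its constant
  coefficient 1. With T \<ge> 1 the exponent may then be lowered to 4.\<close>

lemma monic_poly_growth:
  fixes B :: "complex poly"
  assumes "lead_coeff B = 1" "degree B \<ge> 4"
  obtains T where "T \<ge> 1" "\<And>u. norm u \<ge> T \<Longrightarrow> norm (poly B u) \<ge> norm u ^ 4 / 2"
proof -
  have "((\<lambda>x. poly (reflect_poly B) x) \<longlongrightarrow> poly (reflect_poly B) 0) (at 0)"
    by (rule isContD) simp
  moreover have "poly (reflect_poly B) 0 = 1" using assms by (simp add: poly_0_coeff_0)
  ultimately have "\<forall>\<^sub>F x in at 0. dist (poly (reflect_poly B) x) 1 < 1 / 2"
    unfolding tendsto_iff using half_gt_zero_iff[of "1::real"] by (metis zero_less_one)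
  then obtain \<delta> where \<delta>: "\<delta> > 0" "\<And>x. x \<noteq> 0 \<Longrightarrow> norm x < \<delta> \<Longrightarrow> dist (poly (reflect_poly B) x) 1 < 1 / 2"
    by (auto simp: eventually_at)
  define T where "T = max 1 (2 / \<delta>)"
  show thesis
  proof (rule that[of T])
    fix u :: complex assume u: "norm u \<ge> T"
    then have u1: "norm u \<ge> 1" and nz: "u \<noteq> 0" by (auto simp: T_def)
    have "2 / \<delta> \<le> norm u" using u by (simp add: T_def)
    then have "2 \<le> norm u * \<delta>" using \<delta>(1) by (simp add: field_simps)
    moreover have "norm u > 0" using nz by simp
    ultimately have "1 / norm u < \<delta>" by (simp add: pos_divide_less_eq mult.commute)
    then have "norm (inverse u) < \<delta>" by (simp add: inverse_eq_divide norm_divide)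
    then have "dist (poly (reflect_poly B) (inverse u)) 1 < 1 / 2" using \<delta>(2) nz by simp
    then have half: "norm (poly (reflect_poly B) (inverse u)) \<ge> 1 / 2"
      using norm_triangle_ineq2[of 1 "1 - poly (reflect_poly B) (inverse u)"]
      by (simp add: dist_norm norm_minus_commute)
    have "poly B u = u ^ degree B * poly (reflect_poly B) (inverse u)"
      using nz poly_reflect_poly_nz[of "inverse u" B] by (simp add: power_inverse)
    then have "norm (poly B u) = norm u ^ degree B * norm (poly (reflect_poly B) (inverse u))"
      by (simp add: norm_mult norm_power)
    also have "\<dots> \<ge> norm u ^ 4 * (1 / 2)"
      using half u1 assms by (intro mult_mono power_increasing) auto
    finally show "norm (poly B u) \<ge> norm u ^ 4 / 2" by simp
  qed (simp add: T_def)
qed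

text \<open>The quotient V / f has square b, so it is locally bounded, and its singularities at the
  isolated zeros of f are removable.\<close>

lemma holomorphic_sqrt_cancel:
  assumes S: "open S" "connected S"
    and hol: "V holomorphic_on S" "f holomorphic_on S" "b holomorphic_on S"
    and eq: "\<And>z. z \<in> S \<Longrightarrow> (V z)\<^sup>2 = (f z)\<^sup>2 * b z"
    and nz: "z0 \<in> S" "f z0 \<noteq> 0"
  obtains v where "v holomorphic_on S" "\<And>z. z \<in> S \<Longrightarrow> (v z)\<^sup>2 = b z"
proof -
  define q where "q z = V z / f z" for z
  \<comment> \<open>Taking limits at the zeros of f gives a single function, with which every local
    extension agrees.\<close>
  define v where "v z = (if f z \<noteq> 0 then q z else Lim (at z) q)" for z
  have loc: "\<exists>r>0. ball z r \<subseteq> S \<and> (\<exists>g. g holomorphic_on ball z r \<and> (\<forall>w\<in>ball z r. v w = g w \<and> (g w)\<^sup>2 = b w))"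
    if z: "z \<in> S" for z
  proof -
    have "\<forall>\<^sub>F w in at z. f w \<noteq> 0 \<and> w \<in> S"
      using non_zero_neighbour_alt[OF hol(2) S z nz] by simp
    moreover have "continuous_on S b" using hol by (simp add: holomorphic_on_imp_continuous_on)
    then have "isCont b z" using S z by (simp add: continuous_on_eq_continuous_at)
    then have "\<forall>\<^sub>F w in at z. norm (b w) < norm (b z) + 1"
      by (intro order_tendstoD(2)[where y = "norm (b z)"]) (auto intro!: tendsto_norm isContD)
    ultimately have "\<forall>\<^sub>F w in at z. (f w \<noteq> 0 \<and> w \<in> S) \<and> norm (b w) < norm (b z) + 1"
      by (rule eventually_conj)
    then obtain r where r: "r > 0" "\<And>w. w \<in> ball z r - {z} \<Longrightarrow> f w \<noteq> 0 \<and> w \<in> S \<and> norm (b w) < norm (b z) + 1"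
      unfolding eventually_at by (auto simp: dist_commute)
    have sub: "ball z r \<subseteq> S" using r(2) z by blast
    have holq: "q holomorphic_on ball z r - {z}"
      unfolding q_def using r sub by (intro holomorphic_intros holomorphic_on_subset[OF hol(1)] holomorphic_on_subset[OF hol(2)]) auto
    have q2: "(q w)\<^sup>2 = b w" if "w \<in> ball z r - {z}" for w
      using eq[of w] r(2)[OF that] by (simp add: q_def power_divide)
    have "norm (q w) \<le> sqrt (norm (b z) + 1)" if "w \<in> ball z r - {z}" for w
    proof -
      have "norm (q w) ^ 2 = norm (b w)" using q2[OF that] by (metis norm_power)
      then show ?thesis using r(2)[OF that] by (intro real_le_rsqrt) simp
    qed
    then have "\<forall>\<^sub>F w in at z. norm (q w) \<le> sqrt (norm (b z) + 1)"
      unfolding eventually_at using r(1) by (intro exI[of _ r]) (auto simp: dist_commute)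
    then obtain g where g: "g holomorphic_on ball z r" "\<And>w. w \<in> ball z r - {z} \<Longrightarrow> g w = q w"
      using holomorphic_on_extend_bounded[OF holq] r(1) by auto
    have cont: "isCont g z"
      using holomorphic_on_imp_continuous_on[OF g(1)] r(1) by (simp add: continuous_on_eq_continuous_at)
    have ev: "\<forall>\<^sub>F w in at z. w \<in> ball z r - {z}"
      unfolding eventually_at using r(1) by (intro exI[of _ r]) (auto simp: dist_commute)
    have lim: "(q \<longlongrightarrow> g z) (at z)"
      by (rule Lim_transform_eventually[OF isContD[OF cont]]) (use ev g in \<open>auto elim: eventually_mono\<close>)
    have gz: "(g z)\<^sup>2 = b z"
    proof (rule tendsto_unique)
      show "((\<lambda>w. (q w)\<^sup>2) \<longlongrightarrow> (g z)\<^sup>2) (at z)" by (intro tendsto_intros lim)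
      show "((\<lambda>w. (q w)\<^sup>2) \<longlongrightarrow> b z) (at z)"
        by (rule Lim_transform_eventually[OF isContD[OF \<open>isCont b z\<close>]]) (use ev q2 in \<open>auto elim: eventually_mono\<close>)
    qed simp
    have vz: "v z = g z"
    proof (cases "f z = 0")
      case True
      then show ?thesis using tendsto_Lim[OF _ lim] by (simp add: v_def)
    next
      case False
      have "isCont q z"
        unfolding q_def using False S z hol
        by (intro continuous_intros) (auto simp: continuous_on_eq_continuous_at dest: holomorphic_on_imp_continuous_on)
      then show ?thesis using False tendsto_unique[OF _ isContD lim] by (simp add: v_def)
    qed
    have "v w = g w \<and> (g w)\<^sup>2 = b w" if "w \<in> ball z r" for w
      using that g(2)[of w] q2[of w] r(2)[of w] vz gz by (cases "w = z") (auto simp: v_def)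
    then show ?thesis using r(1) sub g(1) by blast
  qed
  show thesis
  proof (rule that)
    show "(v z)\<^sup>2 = b z" if "z \<in> S" for z using loc[OF that] by force
    have "v field_differentiable (at z)" if zS: "z \<in> S" for z
    proof -
      obtain r g where r: "r > 0" "g holomorphic_on ball z r" "\<forall>w\<in>ball z r. v w = g w"
        using loc[OF zS] by blast
      then have "v holomorphic_on ball z r" using holomorphic_cong[of "ball z r" "ball z r" v g] by simp
      then show ?thesis using r(1) by (simp add: holomorphic_on_imp_differentiable_at)
    qed
    then show "v holomorphic_on S"
      unfolding holomorphic_on_def using field_differentiable_at_within by blast
  qed
qed

text \<open>Cauchy's estimate on the circle of radius r / 2, since f is only given on the open ball;
  this costs the factor 2.\<close>

lemma deriv_bound_ball:
  assumes "f holomorphic_on ball z r" "\<And>w. w \<in> ball z r \<Longrightarrow> norm (f w) \<le> K" "r > 0"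
  shows "norm (deriv f z) \<le> 2 * K / r"
proof -
  have sub: "cball z (r / 2) \<subseteq> ball z r" using assms(3) by auto
  have "norm ((deriv ^^ 1) f z) \<le> fact 1 * K / (r / 2) ^ 1"
  proof (rule Cauchy_inequality)
    show "f holomorphic_on ball z (r / 2)" by (rule holomorphic_on_subset[OF assms(1)]) (use assms(3) in auto)
    show "continuous_on (cball z (r / 2)) f"
      using holomorphic_on_imp_continuous_on[OF assms(1)] sub by (rule continuous_on_subset)
    show "norm (f x) \<le> K" if "norm (z - x) = r / 2" for x
      using that assms(2)[of x] assms(3) by (simp add: dist_norm)
  qed (use assms(3) in auto)
  then show ?thesis by (simp add: mult.commute)
qed

text \<open>
  With \<open>v\<^sup>2 = B(U)\<close> and \<open>a B + b B' = 1\<close>, this is the polynomial expression for the pullback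
  \<open>U' / v\<close> of the holomorphic form \<open>dU / v\<close>.
\<close>

definition hyperelliptic_form ::
  "complex poly \<Rightarrow> complex poly \<Rightarrow> (complex \<Rightarrow> complex) \<Rightarrow> (complex \<Rightarrow> complex) \<Rightarrow> complex \<Rightarrow> complex" where
  "hyperelliptic_form a b U v z = poly a (U z) * v z * deriv U z + 2 * poly b (U z) * deriv v z"

text \<open>Differentiating v^2 = B(U) gives 2 v v' = B'(U) U', so v times the form is (a B + b
  B')(U) U' = U'.\<close>

lemma hyperelliptic_form_times:
  assumes bez: "a * B + b * pderiv B = 1"
    and hol: "U holomorphic_on S" "v holomorphic_on S" "open S" "z \<in> S"
    and sq: "\<And>w. w \<in> S \<Longrightarrow> (v w)\<^sup>2 = poly B (U w)"
  shows "hyperelliptic_form a b U v z * v z = deriv U z"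
proof -
  have dU: "(U has_field_derivative deriv U z) (at z)" and dv: "(v has_field_derivative deriv v z) (at z)"
    using hol by (auto intro: holomorphic_derivI)
  have "((\<lambda>w. (v w)\<^sup>2) has_field_derivative (2 * v z * deriv v z)) (at z)"
    by (rule derivative_eq_intros dv refl)+ simp
  moreover have "((\<lambda>w. poly B (U w)) has_field_derivative (poly (pderiv B) (U z) * deriv U z)) (at z)"
    by (rule DERIV_chain2[OF poly_DERIV dU])
  then have "((\<lambda>w. (v w)\<^sup>2) has_field_derivative (poly (pderiv B) (U z) * deriv U z)) (at z)"
    by (rule has_field_derivative_transform_within_open[OF _ hol(3,4)]) (simp add: sq)
  ultimately have eq: "2 * v z * deriv v z = poly (pderiv B) (U z) * deriv U z"
    by (rule DERIV_unique)
  have "poly a (U z) * poly B (U z) + poly b (U z) * poly (pderiv B) (U z) = 1"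
    using arg_cong[OF bez, of "\<lambda>p. poly p (U z)"] by simp
  then have "deriv U z = poly a (U z) * (v z)\<^sup>2 * deriv U z + poly b (U z) * (poly (pderiv B) (U z) * deriv U z)"
    using sq[OF hol(4)] by (metis (no_types, opaque_lifting) distrib_right mult.assoc mult_1)
  then show ?thesis
    unfolding eq[symmetric] hyperelliptic_form_def by (simp add: power2_eq_square algebra_simps)
qed

lemma holomorphic_hyperelliptic_form:
  assumes "U holomorphic_on S" "v holomorphic_on S" "open S"
  shows "hyperelliptic_form a b U v holomorphic_on S"
  unfolding hyperelliptic_form_def
  by (intro holomorphic_intros holomorphic_on_compose_gen[of U S "poly _" UNIV, unfolded o_def] assms
      holomorphic_deriv) (auto intro: holomorphic_intros)

text \<open>The bound is uniform in U, v and z: polynomials are bounded on the disc of radius M,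
  which bounds v through its square, and Cauchy's estimate bounds both derivatives.\<close>

lemma hyperelliptic_form_bound_bounded:
  assumes "r > 0"
  shows "\<exists>K. \<forall>U v z. U holomorphic_on ball z r \<and> v holomorphic_on ball z r \<and>
     (\<forall>w\<in>ball z r. (v w)\<^sup>2 = poly B (U w) \<and> norm (U w) \<le> M) \<longrightarrow> norm (hyperelliptic_form a b U v z) \<le> K"
proof -
  obtain CB where CB: "\<And>u. norm u \<le> M \<Longrightarrow> norm (poly B u) \<le> CB" using poly_bound_exists[of M B] by blast
  obtain Ca where Ca: "\<And>u. norm u \<le> M \<Longrightarrow> norm (poly a u) \<le> Ca" using poly_bound_exists[of M a] by blast
  obtain Cb where Cb: "\<And>u. norm u \<le> M \<Longrightarrow> norm (poly b u) \<le> Cb" using poly_bound_exists[of M b] by blast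
  show ?thesis
  proof (intro exI[of _ "Ca * sqrt CB * (2 * M / r) + 2 * Cb * (2 * sqrt CB / r)"] allI impI)
    fix U v z
    assume *: "U holomorphic_on ball z r \<and> v holomorphic_on ball z r \<and>
     (\<forall>w\<in>ball z r. (v w)\<^sup>2 = poly B (U w) \<and> norm (U w) \<le> M)"
    have v: "norm (v w) \<le> sqrt CB" if "w \<in> ball z r" for w
    proof -
      have "norm (v w) ^ 2 = norm (poly B (U w))" using * that by (metis norm_power)
      then show ?thesis using CB[of "U w"] * that by (intro real_le_rsqrt) auto
    qed
    have z: "z \<in> ball z r" using assms by simp
    have dU: "norm (deriv U z) \<le> 2 * M / r" by (rule deriv_bound_ball) (use * assms in auto)
    have dv: "norm (deriv v z) \<le> 2 * sqrt CB / r" by (rule deriv_bound_ball) (use * assms v in auto)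
    have Uz: "norm (U z) \<le> M" using * z by blast
    have nn: "0 \<le> Ca" "0 \<le> Cb" "0 \<le> sqrt CB"
      using Ca[OF Uz] Cb[OF Uz] v[OF z] norm_ge_zero by (meson order_trans)+
    have "norm (hyperelliptic_form a b U v z) \<le>
        norm (poly a (U z)) * norm (v z) * norm (deriv U z) + 2 * norm (poly b (U z)) * norm (deriv v z)"
      unfolding hyperelliptic_form_def by (rule norm_triangle_le) (simp add: norm_mult)
    also have "\<dots> \<le> Ca * sqrt CB * (2 * M / r) + 2 * Cb * (2 * sqrt CB / r)"
      using Ca[OF Uz] Cb[OF Uz] v[OF z] dU dv nn by (intro add_mono mult_mono) auto
    finally show "norm (hyperelliptic_form a b U v z) \<le> Ca * sqrt CB * (2 * M / r) + 2 * Cb * (2 * sqrt CB / r)" .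
  qed
qed

lemma deriv_inverse_comp:
  assumes "U holomorphic_on S" "open S" "z \<in> S" "U z \<noteq> 0"
  shows "deriv (\<lambda>w. inverse (U w)) z = - deriv U z / (U z)\<^sup>2"
proof -
  have "(U has_field_derivative deriv U z) (at z)" using assms by (auto intro: holomorphic_derivI)
  from DERIV_inverse_fun[OF this assms(4)] show ?thesis
    by (intro DERIV_imp_deriv) (simp add: power2_eq_square divide_inverse numeral_2_eq_2 mult_ac)
qed

text \<open>The form dU / v is regular at infinity because deg B \<ge> 4: where U is large, |U'|
  \<le> c |U|^2 by Cauchy's estimate for 1 / U, and |v|^2 = |B(U)| \<ge> |U|^4 / 2. Where U(z) is
  not large, 1 / U varies slowly, so U stays bounded on a smaller ball and the previous bound
  applies.\<close>

lemma hyperelliptic_form_bound_large: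
  assumes r: "r > 0" and m: "m > 0" and B: "lead_coeff B = 1" "degree B \<ge> 4"
    and bez: "a * B + b * pderiv B = 1"
  shows "\<exists>K. \<forall>U v z. U holomorphic_on ball z r \<and> v holomorphic_on ball z r \<and>
     (\<forall>w\<in>ball z r. (v w)\<^sup>2 = poly B (U w) \<and> norm (U w) \<ge> m) \<longrightarrow> norm (hyperelliptic_form a b U v z) \<le> K"
proof -
  obtain T where T: "T \<ge> 1" "\<And>u. norm u \<ge> T \<Longrightarrow> norm (poly B u) \<ge> norm u ^ 4 / 2"
    using monic_poly_growth[OF B] by blast
  \<comment> \<open>On the half ball the derivative of 1 / U is at most 4 / (m r). Over the distance
    m r / (8 T) this changes 1 / U by at most 1 / (2 T), half of its lower bound at z.\<close>
  define r' where "r' = min (r / 2) (m * r / (8 * T))"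
  have r': "r' > 0" "r' \<le> r / 2" "r' \<le> m * r / (8 * T)" using r m T by (auto simp: r'_def)
  obtain K where K: "\<And>U v z. U holomorphic_on ball z r' \<and> v holomorphic_on ball z r' \<and>
     (\<forall>w\<in>ball z r'. (v w)\<^sup>2 = poly B (U w) \<and> norm (U w) \<le> 2 * T) \<Longrightarrow> norm (hyperelliptic_form a b U v z) \<le> K"
    using hyperelliptic_form_bound_bounded[OF r'(1), of B "2 * T" a b] by blast
  define c where "c = 2 * (1 / m) / r"
  have c: "c > 0" using m r by (simp add: c_def)
  show ?thesis
  proof (intro exI[of _ "max K (2 * c)"] allI impI)
    fix U v z
    assume *: "U holomorphic_on ball z r \<and> v holomorphic_on ball z r \<and>
     (\<forall>w\<in>ball z r. (v w)\<^sup>2 = poly B (U w) \<and> norm (U w) \<ge> m)"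
    define W where "W w = inverse (U w)" for w
    have nz: "U w \<noteq> 0" if "w \<in> ball z r" for w using * that m by force
    have holW: "W holomorphic_on ball z r"
      unfolding W_def using * nz by (intro holomorphic_intros) auto
    have W: "norm (W w) \<le> 1 / m" if "w \<in> ball z r" for w
      using * that m nz[OF that] by (auto simp: W_def norm_inverse inverse_eq_divide norm_divide intro!: divide_left_mono)
    have z: "z \<in> ball z r" using r by simp
    show "norm (hyperelliptic_form a b U v z) \<le> max K (2 * c)"
    proof (cases "norm (U z) \<ge> T")
      case True
      have "norm (deriv W z) \<le> c"
        unfolding c_def by (rule deriv_bound_ball[OF holW W r])
      moreover have "deriv W z = - deriv U z / (U z)\<^sup>2"
        unfolding W_def using * z nz[OF z] by (intro deriv_inverse_comp[of _ "ball z r"]) auto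
      ultimately have dU: "norm (deriv U z) \<le> c * norm (U z) ^ 2"
        using nz[OF z] by (simp add: norm_divide norm_power divide_simps)
      let ?h = "hyperelliptic_form a b U v z"
      have "?h * v z = deriv U z"
        using * z by (intro hyperelliptic_form_times[OF bez, of _ "ball z r"]) auto
      then have "norm ?h ^ 2 * norm (v z) ^ 2 = norm (deriv U z) ^ 2"
        by (metis norm_mult power_mult_distrib)
      moreover have "norm (v z) ^ 2 = norm (poly B (U z))"
        using * z by (metis norm_power)
      ultimately have "norm ?h ^ 2 * norm (poly B (U z)) = norm (deriv U z) ^ 2" by simp
      also have "\<dots> \<le> (c * norm (U z) ^ 2) ^ 2" using dU by (intro power_mono) auto
      finally have "norm ?h ^ 2 * norm (poly B (U z)) \<le> c ^ 2 * norm (U z) ^ 4"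
        by (simp add: power_mult_distrib)
      moreover have "norm ?h ^ 2 * (norm (U z) ^ 4 / 2) \<le> norm ?h ^ 2 * norm (poly B (U z))"
        using T(2)[OF True] by (intro mult_left_mono) auto
      ultimately have "norm ?h ^ 2 * (norm (U z) ^ 4 / 2) \<le> c ^ 2 * norm (U z) ^ 4" by linarith
      then have "norm ?h ^ 2 / 2 \<le> c ^ 2" using nz[OF z]
        by (simp add: divide_simps mult_le_cancel_right)
      then have "norm ?h ^ 2 \<le> 2 * c ^ 2" by simp
      also have "\<dots> \<le> (2 * c) ^ 2" by (simp add: power_mult_distrib)
      finally have "norm ?h ^ 2 \<le> (2 * c) ^ 2" .
      then have "norm ?h \<le> 2 * c" by (rule power2_le_imp_le) (use c in auto)
      then show ?thesis by simp
    next
      case False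
      have "norm (U w) \<le> 2 * T" if w: "w \<in> ball z r'" for w
      proof -
        have sub: "ball z (r / 2) \<subseteq> ball z r" using r by auto
        have "norm (W w - W z) \<le> (2 * c) * norm (w - z)"
        proof (rule field_differentiable_bound[where S = "ball z (r / 2)"])
          show "convex (ball z (r / 2))" by simp
          show "(W has_field_derivative deriv W x) (at x within ball z (r / 2))" if "x \<in> ball z (r / 2)" for x
            by (rule holomorphic_derivI[OF holW open_ball subsetD[OF sub that]])
          show "norm (deriv W x) \<le> 2 * c" if x: "x \<in> ball z (r / 2)" for x
          proof -
            have "ball x (r / 2) \<subseteq> ball z r"
            proof
              fix y assume "y \<in> ball x (r / 2)"
              then show "y \<in> ball z r" using x dist_triangle[of z y x] by simp
            qed
            then have "norm (deriv W x) \<le> 2 * (1 / m) / (r / 2)"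
              using holW W r by (intro deriv_bound_ball) (auto intro: holomorphic_on_subset)
            then show ?thesis by (simp add: c_def)
          qed
        qed (use w r' r in auto)
        also have "\<dots> \<le> (2 * c) * (m * r / (8 * T))"
          using w r' c by (intro mult_left_mono) (auto simp: dist_norm norm_minus_commute)
        also have "\<dots> = 1 / (2 * T)" using m r T by (simp add: c_def)
        finally have "norm (W w - W z) \<le> 1 / (2 * T)" .
        moreover have "norm (W z) \<ge> 1 / T"
        proof -
          have "norm (W z) = 1 / norm (U z)" by (simp add: W_def inverse_eq_divide norm_divide)
          then show ?thesis using False nz[OF z] by (simp add: frac_le)
        qed
        moreover have "norm (W z) \<le> norm (W w - W z) + norm (W w)"
          by (metis norm_minus_commute norm_triangle_sub add.commute)
        moreover have "1 / T = 1 / (2 * T) + 1 / (2 * T)" using T by simp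
        ultimately have "norm (W w) \<ge> 1 / (2 * T)" by linarith
        moreover have "w \<in> ball z r" using w r' r by auto
        then have "norm (U w) > 0" using nz by auto
        moreover have "norm (W w) = 1 / norm (U w)" by (simp add: W_def inverse_eq_divide norm_divide)
        ultimately show ?thesis using T by (simp add: field_simps)
      qed
      moreover have "ball z r' \<subseteq> ball z r" using r' r by auto
      ultimately have "norm (hyperelliptic_form a b U v z) \<le> K"
        using * by (intro K) (auto intro: holomorphic_on_subset)
      then show ?thesis by simp
    qed
  qed
qed

text \<open>Liouville's theorem for functions that are only given on balls and need not agree with
  each other: on a fixed ball of radius R0 their derivatives are at most 2 |K| / (R - R0), which
  tends to 0.\<close>

lemma bounded_family_equal_values:
  assumes "\<And>R. R > 0 \<Longrightarrow> \<exists>f. f holomorphic_on ball 0 R \<and> (\<forall>z\<in>ball 0 R. norm (f z) \<le> K) \<and> f z1 = c1 \<and> f z2 = c2"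
  shows "c1 = (c2::complex)"
proof (rule ccontr)
  assume "c1 \<noteq> c2"
  define R0 where "R0 = max (norm z1) (norm z2) + 1"
  define d where "d = norm (c1 - c2)"
  have d: "d > 0" using \<open>c1 \<noteq> c2\<close> by (simp add: d_def)
  have "R0 > 0" using norm_ge_zero[of z1] unfolding R0_def by linarith
  then have R0: "R0 > 0" "z1 \<in> ball 0 R0" "z2 \<in> ball 0 R0" by (auto simp: R0_def)
  \<comment> \<open>Chosen so that d (R - R0) exceeds the bound 2 |K| |z1 - z2| by 1.\<close>
  define R where "R = R0 + (2 * \<bar>K\<bar> * norm (z1 - z2) + 1) / d"
  have R: "R > R0" using d by (simp add: R_def add_nonneg_pos)
  obtain f where f: "f holomorphic_on ball 0 R" "\<And>z. z \<in> ball 0 R \<Longrightarrow> norm (f z) \<le> K" "f z1 = c1" "f z2 = c2"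
    using assms[of R] R R0 by force
  have "norm (f z1 - f z2) \<le> (2 * \<bar>K\<bar> / (R - R0)) * norm (z1 - z2)"
  proof (rule field_differentiable_bound[where S = "ball 0 R0"])
    show "(f has_field_derivative deriv f x) (at x within ball 0 R0)" if "x \<in> ball 0 R0" for x
      using f(1) that R by (auto intro: holomorphic_derivI[of f "ball 0 R"])
    show "norm (deriv f x) \<le> 2 * \<bar>K\<bar> / (R - R0)" if x: "x \<in> ball 0 R0" for x
    proof -
      have "ball x (R - R0) \<subseteq> ball 0 R"
      proof
        fix y assume "y \<in> ball x (R - R0)"
        then show "y \<in> ball 0 R" using x dist_triangle[of 0 y x] by simp
      qed
      moreover have "norm (f w) \<le> \<bar>K\<bar>" if "w \<in> ball 0 R" for w
        using f(2)[OF that] by linarith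
      ultimately show ?thesis
        using R holomorphic_on_subset[OF f(1)] by (intro deriv_bound_ball) auto
    qed
  qed (use R0 in auto)
  then have "d * (R - R0) \<le> 2 * \<bar>K\<bar> * norm (z1 - z2)"
    using f R by (simp add: d_def field_simps)
  moreover have "d * (R - R0) = 2 * \<bar>K\<bar> * norm (z1 - z2) + 1"
    using d by (simp add: R_def)
  ultimately show False by simp
qed


section \<open>Constancy of tame entire curves in hyperelliptic curves\<close>

lemma entire_in_roots_constant:
  assumes "U holomorphic_on UNIV" "A \<noteq> 0" "\<And>z. poly A (U z) = 0"
  shows "U constant_on UNIV"
proof (rule Liouville_theorem[OF assms(1)])
  have "range U \<subseteq> {u. poly A u = 0}" using assms(3) by auto
  then show "bounded (range U)"
    using poly_roots_finite[OF assms(2)] by (meson finite_imp_bounded finite_subset)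
qed

text \<open>A nonconstant U is unbounded. Around points \<open>c n\<close> where U is large,
  tameness keeps 1 / U bounded; a limit g of the translates has g(0) = 0, so g = 0 by Hurwitz's
  theorem. Hence the derivative of 1 / U at such points becomes small, whereas the equation and deg
  B \<ge> 4 give |(1 / U)'|^2 = |\<kappa> B(U)| / |U|^4 \<ge> |\<kappa>| / 2.\<close>

lemma entire_with_quartic_ode_constant:
  assumes U: "U holomorphic_on UNIV"
    and ode: "\<And>z. (deriv U z)\<^sup>2 = \<kappa> * poly B (U z)"
    and B: "lead_coeff B = 1" "degree B \<ge> 4"
    and tame: "\<rho> > 0" "m > 0" "\<And>c. (\<forall>z\<in>ball c \<rho>. norm (U z) \<le> M) \<or> (\<forall>z\<in>ball c \<rho>. norm (U z) \<ge> m)"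
  shows "U constant_on UNIV"
proof (rule ccontr)
  assume nc: "\<not> U constant_on UNIV"
  have unb: "\<exists>z. norm (U z) > n" for n
    using nc Liouville_theorem[OF U] by (force simp: bounded_iff not_le)
  obtain T where T: "T \<ge> 1" "\<And>u. norm u \<ge> T \<Longrightarrow> norm (poly B u) \<ge> norm u ^ 4 / 2"
    using monic_poly_growth[OF B] by blast
  \<comment> \<open>|M| rules out the first alternative of tameness around \<open>c n\<close>, and T
    makes the growth bound for B available there.\<close>
  have "\<forall>n. \<exists>z. norm (U z) > real n + \<bar>M\<bar> + T" using unb by blast
  then obtain c where c: "\<And>n. norm (U (c n)) > real n + \<bar>M\<bar> + T" by metis
  define W where "W n z = inverse (U (c n + z))" for n z
  have large: "norm (U (c n + z)) \<ge> m" if "z \<in> ball 0 \<rho>" for n z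
  proof -
    have "\<not> (\<forall>z\<in>ball (c n) \<rho>. norm (U z) \<le> M)"
      using c[of n] tame(1) T(1) by (intro notI, drule_tac x="c n" in bspec) auto
    moreover have "c n + z \<in> ball (c n) \<rho>" using that by (simp add: dist_norm)
    ultimately show ?thesis using tame(3) by blast
  qed
  have nz: "U (c n + z) \<noteq> 0" if "z \<in> ball 0 \<rho>" for n z
    using large[OF that, of n] tame(2) by auto
  have "(\<lambda>z. U (c n + z)) holomorphic_on ball 0 \<rho>" for n
    by (rule holomorphic_on_compose_gen[of "\<lambda>z. c n + z" _ U UNIV, unfolded o_def])
       (auto intro!: holomorphic_intros U)
  then have holW: "W n holomorphic_on ball 0 \<rho>" for n
    unfolding W_def using nz by (intro holomorphic_intros) auto
  have bW: "norm (W n z) \<le> 1 / m" if "z \<in> ball 0 \<rho>" for n z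
    using large[OF that, of n] tame(2) nz[OF that, of n]
    by (auto simp: W_def inverse_eq_divide norm_divide intro!: divide_left_mono)
  obtain g r where g: "g holomorphic_on ball 0 \<rho>" "strict_mono (r :: nat \<Rightarrow> nat)"
      "\<And>x. x \<in> ball 0 \<rho> \<Longrightarrow> ((\<lambda>n. W (r n) x) \<longlongrightarrow> g x) sequentially"
      "\<And>K. compact K \<Longrightarrow> K \<subseteq> ball 0 \<rho> \<Longrightarrow> uniform_limit K (W \<circ> r) g sequentially"
    by (rule Montel[of "ball 0 \<rho>" "range W" W]) (use holW bW in \<open>auto intro!: exI[of _ "1 / m"]\<close>)
  have "(\<lambda>n. W (r n) 0) \<longlonglongrightarrow> 0"
  proof (rule Lim_null_comparison)
    show "\<forall>\<^sub>F n in sequentially. norm (W (r n) 0) \<le> inverse (real (Suc n))"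
    proof (rule always_eventually, rule allI)
      fix n
      have "real (Suc n) \<le> norm (U (c (r n)))"
        using c[of "r n"] T(1) seq_suble[OF g(2), of n] by linarith
      then show "norm (W (r n) 0) \<le> inverse (real (Suc n))"
        by (simp add: W_def norm_inverse le_imp_inverse_le)
    qed
    show "(\<lambda>n. inverse (real (Suc n))) \<longlonglongrightarrow> 0" by (rule LIMSEQ_inverse_real_of_nat)
  qed
  with g(3)[of 0] tame(1) have g0: "g 0 = 0" using LIMSEQ_unique by auto
  have "g constant_on ball 0 \<rho>"
  proof (rule ccontr)
    assume "\<not> g constant_on ball 0 \<rho>"
    then have "g 0 \<noteq> 0"
      by (intro Hurwitz_no_zeros[of "ball 0 \<rho>" "W \<circ> r" g])
         (use g holW tame(1) nz in \<open>auto simp: W_def\<close>)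
    then show False using g0 by simp
  qed
  then have gz: "g z = 0" if "z \<in> ball 0 \<rho>" for z
    using that g0 tame(1) by (metis centre_in_ball constant_on_def)
  have "\<kappa> \<noteq> 0"
  proof
    assume "\<kappa> = 0"
    then have "deriv U z = 0" for z using ode[of z] by simp
    moreover have "(U has_field_derivative deriv U z) (at z)" for z
      using U by (auto intro: holomorphic_derivI)
    ultimately have "U constant_on UNIV"
      by (intro has_field_derivative_0_imp_constant_on) auto
    then show False using nc by simp
  qed
  \<comment> \<open>Cauchy's estimate with radius \<rho> / 2 then gives 4 \<epsilon> / \<rho>, half
    of the lower bound \<open>sqrt (norm \<kappa> / 2)\<close>.\<close>
  define \<epsilon> where "\<epsilon> = \<rho> * sqrt (norm \<kappa> / 2) / 8"
  have \<epsilon>: "\<epsilon> > 0" using \<open>\<kappa> \<noteq> 0\<close> tame(1) by (simp add: \<epsilon>_def)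
  have "uniform_limit (cball 0 (\<rho> / 2)) (W \<circ> r) g sequentially"
    using tame(1) by (intro g(4)) auto
  then have "\<forall>\<^sub>F n in sequentially. \<forall>z\<in>cball 0 (\<rho> / 2). dist ((W \<circ> r) n z) (g z) < \<epsilon>"
    using \<epsilon> by (rule uniform_limitD)
  then obtain n where n: "\<And>z. z \<in> cball 0 (\<rho> / 2) \<Longrightarrow> norm (W (r n) z) < \<epsilon>"
    using gz tame(1) by (force simp: eventually_sequentially dist_norm)
  have "norm (deriv (W (r n)) 0) \<le> 2 * \<epsilon> / (\<rho> / 2)"
  proof (rule deriv_bound_ball)
    show "W (r n) holomorphic_on ball 0 (\<rho> / 2)"
      using holW by (rule holomorphic_on_subset) (use tame(1) in auto)
    show "norm (W (r n) w) \<le> \<epsilon>" if "w \<in> ball 0 (\<rho> / 2)" for w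
      using n[of w] that by simp
  qed (use tame(1) in auto)
  also have "\<dots> = sqrt (norm \<kappa> / 2) / 2" using tame(1) by (simp add: \<epsilon>_def)
  finally have small: "norm (deriv (W (r n)) 0) \<le> sqrt (norm \<kappa> / 2) / 2" .
  let ?u = "U (c (r n))"
  have u: "norm ?u \<ge> T" "?u \<noteq> 0" using c[of "r n"] T(1) nz[of 0 "r n"] tame(1) by auto
  have "deriv (W (r n)) 0 = - deriv U (c (r n)) / ?u\<^sup>2"
  proof -
    have "(U has_field_derivative deriv U (c (r n))) (at (0 + c (r n)))"
      using U by (auto intro: holomorphic_derivI)
    then have "((\<lambda>z. U (c (r n) + z)) has_field_derivative deriv U (c (r n))) (at 0)"
      unfolding DERIV_shift by (simp add: add.commute)
    from DERIV_inverse_fun[OF this] show ?thesis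
      using u unfolding W_def
      by (intro DERIV_imp_deriv) (simp add: power2_eq_square divide_inverse numeral_2_eq_2 mult_ac)
  qed
  then have "norm (deriv (W (r n)) 0) ^ 2 = norm ((deriv U (c (r n)))\<^sup>2) / norm ?u ^ 4"
    by (simp add: norm_divide norm_power power_divide)
  also have "\<dots> = norm \<kappa> * norm (poly B ?u) / norm ?u ^ 4"
    by (simp add: ode norm_mult)
  also have "\<dots> \<ge> norm \<kappa> * (norm ?u ^ 4 / 2) / norm ?u ^ 4"
    using T(2)[OF u(1)] by (intro divide_right_mono mult_left_mono) auto
  finally have "norm (deriv (W (r n)) 0) ^ 2 \<ge> norm \<kappa> / 2" using u(2) by simp
  then have "norm (deriv (W (r n)) 0) \<ge> sqrt (norm \<kappa> / 2)"
    by (intro real_le_lsqrt) auto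
  moreover have "sqrt (norm \<kappa> / 2) > 0" using \<open>\<kappa> \<noteq> 0\<close> by simp
  ultimately show False using small by linarith
qed

text \<open>The roots v on different balls may differ in sign, so the quantity to compare is h^2 =
  U'^2 / B(U) with h = U' / v. Its bound does not depend on the ball, so it is a constant \<kappa>,
  and U satisfies the differential equation excluded above.\<close>

theorem hyperelliptic_curve_constant:
  assumes U: "U holomorphic_on UNIV"
    and sq: "\<And>R. R > 0 \<Longrightarrow> \<exists>V. V holomorphic_on ball 0 R \<and> (\<forall>z\<in>ball 0 R. (V z)\<^sup>2 = poly p (U z))"
    and p: "lead_coeff p = 1" "degree p = 2 * l" "l \<ge> 1" "\<not> degenerate_fibre p"
    and tame: "\<rho> > 0" "m > 0" "\<And>c. (\<forall>z\<in>ball c \<rho>. norm (U z) \<le> M) \<or> (\<forall>z\<in>ball c \<rho>. norm (U z) \<ge> m)"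
  shows "U constant_on UNIV"
proof (rule ccontr)
  assume nc: "\<not> U constant_on UNIV"
  obtain A B where AB: "p = A\<^sup>2 * B" "lead_coeff A = 1" "lead_coeff B = 1" "rsquarefree B" "degree B \<ge> 4"
    using degenerate_fibre_if_small[OF p] by blast
  have nz: "A \<noteq> 0" "B \<noteq> 0" using AB by auto
  obtain a b where bez: "a * B + b * pderiv B = 1" using rsquarefree_bezout[OF AB(4)] by blast
  have holp: "(\<lambda>z. poly q (U z)) holomorphic_on S" for q S
    by (rule holomorphic_on_compose_gen[of U S "poly q" UNIV, unfolded o_def])
       (auto intro!: holomorphic_intros holomorphic_on_subset[OF U])
  have U': "U holomorphic_on S" for S using U by (rule holomorphic_on_subset) auto
  have v: "\<exists>v. v holomorphic_on ball 0 R \<and> (\<forall>z\<in>ball 0 R. (v z)\<^sup>2 = poly B (U z))" if R: "R > 0" for R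
  proof -
    obtain V where V: "V holomorphic_on ball 0 R" "\<forall>z\<in>ball 0 R. (V z)\<^sup>2 = poly p (U z)"
      using sq[OF R] by blast
    have "\<exists>z0\<in>ball 0 R. poly A (U z0) \<noteq> 0"
    proof (rule ccontr)
      assume "\<not> ?thesis"
      then have z: "\<And>z. z \<in> ball 0 R \<Longrightarrow> poly A (U z) = 0" by blast
      have "poly A (U z) = 0" for z
        by (rule analytic_continuation[OF holp[of A UNIV], of "ball 0 R" 0])
           (use z R in \<open>auto simp: islimpt_ball\<close>)
      then show False using entire_in_roots_constant[OF U nz(1)] nc by blast
    qed
    then obtain z0 where "z0 \<in> ball 0 R" "poly A (U z0) \<noteq> 0" by blast
    from holomorphic_sqrt_cancel[OF open_ball connected_ball V(1) holp[of A] holp[of B] _ this]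
    show ?thesis using V(2) AB(1) by (metis (no_types, lifting) poly_mult poly_power)
  qed
  obtain K1 where K1: "\<And>U v z. U holomorphic_on ball z \<rho> \<and> v holomorphic_on ball z \<rho> \<and>
     (\<forall>w\<in>ball z \<rho>. (v w)\<^sup>2 = poly B (U w) \<and> norm (U w) \<le> M) \<Longrightarrow> norm (hyperelliptic_form a b U v z) \<le> K1"
    using hyperelliptic_form_bound_bounded[OF tame(1), of B M a b] by blast
  obtain K2 where K2: "\<And>U v z. U holomorphic_on ball z \<rho> \<and> v holomorphic_on ball z \<rho> \<and>
     (\<forall>w\<in>ball z \<rho>. (v w)\<^sup>2 = poly B (U w) \<and> norm (U w) \<ge> m) \<Longrightarrow> norm (hyperelliptic_form a b U v z) \<le> K2"
    using hyperelliptic_form_bound_large[OF tame(1,2) AB(3,5) bez] by blast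
  define K where "K = max K1 K2"
  have h: "\<exists>v h. h holomorphic_on ball 0 R \<and> (\<forall>z\<in>ball 0 R. norm (h z) \<le> K \<and> h z * v z = deriv U z \<and>
      (v z)\<^sup>2 = poly B (U z))" if R: "R > 0" for R
  proof -
    \<comment> \<open>Enlarged by \<rho>, so that the bound at a point of \<open>ball 0 R\<close>
      may use the whole ball of radius \<rho> around it.\<close>
    obtain v where v: "v holomorphic_on ball 0 (R + \<rho>)" "\<forall>z\<in>ball 0 (R + \<rho>). (v z)\<^sup>2 = poly B (U z)"
      using v[of "R + \<rho>"] R tame(1) by auto
    have sub: "ball z \<rho> \<subseteq> ball 0 (R + \<rho>)" if "z \<in> ball 0 R" for z
    proof
      fix y assume "y \<in> ball z \<rho>"
      then show "y \<in> ball 0 (R + \<rho>)" using that dist_triangle[of 0 y z] by simp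
    qed
    let ?h = "hyperelliptic_form a b U v"
    have "?h holomorphic_on ball 0 (R + \<rho>)"
      by (rule holomorphic_hyperelliptic_form[OF U' v(1) open_ball])
    then have "?h holomorphic_on ball 0 R" by (rule holomorphic_on_subset) (use tame(1) in auto)
    moreover have "norm (?h z) \<le> K" if z: "z \<in> ball 0 R" for z
    proof -
      have "v holomorphic_on ball z \<rho>" using v(1) sub[OF z] by (rule holomorphic_on_subset)
      moreover have "(v w)\<^sup>2 = poly B (U w)" if "w \<in> ball z \<rho>" for w
        using v(2) sub[OF z] that by blast
      ultimately have "norm (?h z) \<le> K1 \<or> norm (?h z) \<le> K2"
        using tame(3)[of z] K1[of U z v] K2[of U z v] U'[of "ball z \<rho>"] by blast
      then show ?thesis by (auto simp: K_def)
    qed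
    moreover have "?h z * v z = deriv U z \<and> (v z)\<^sup>2 = poly B (U z)" if z: "z \<in> ball 0 R" for z
    proof
      have z': "z \<in> ball 0 (R + \<rho>)" using z tame(1) by auto
      show "?h z * v z = deriv U z"
        using v z' by (intro hyperelliptic_form_times[OF bez U' v(1) open_ball]) auto
      show "(v z)\<^sup>2 = poly B (U z)" using v z' by blast
    qed
    ultimately show ?thesis by (intro exI[of _ v] exI[of _ ?h]) blast
  qed
  obtain z0 where z0: "poly B (U z0) \<noteq> 0"
    using entire_in_roots_constant[OF U nz(2)] nc by blast
  define \<kappa> where "\<kappa> = (deriv U z0)\<^sup>2 / poly B (U z0)"
  have ode: "(deriv U z)\<^sup>2 = \<kappa> * poly B (U z)" for z
  proof (cases "poly B (U z) = 0")
    case True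
    \<comment> \<open>Here v vanishes, hence so does U' = h v.\<close>
    obtain v h where "\<forall>z\<in>ball 0 (norm z + 1). norm (h z) \<le> K \<and> h z * v z = deriv U z \<and> (v z)\<^sup>2 = poly B (U z)"
      using h[of "norm z + 1"] by (metis add_nonneg_pos norm_ge_zero zero_less_one)
    then have "h z * v z = deriv U z" "(v z)\<^sup>2 = poly B (U z)" by auto
    then show ?thesis using True by auto
  next
    case False
    have "(deriv U z)\<^sup>2 / poly B (U z) = (deriv U z0)\<^sup>2 / poly B (U z0)"
    proof (rule bounded_family_equal_values)
      fix R :: real assume R: "R > 0"
      define R' where "R' = R + norm z + norm z0 + 1"
      have "R' > 0" using R by (simp add: R'_def add_nonneg_pos add_pos_nonneg)
      then obtain v h where vh: "h holomorphic_on ball 0 R'" "\<forall>z\<in>ball 0 R'. norm (h z) \<le> K \<and>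
          h z * v z = deriv U z \<and> (v z)\<^sup>2 = poly B (U z)" using h by blast
      have le: "norm z < R'" "norm z0 < R'" "R \<le> R'"
        using R norm_ge_zero[of z] norm_ge_zero[of z0] unfolding R'_def by linarith+
      then have mem: "z \<in> ball 0 R'" "z0 \<in> ball 0 R'" "ball 0 R \<subseteq> ball 0 R'" by auto
      have val: "(h w)\<^sup>2 = (deriv U w)\<^sup>2 / poly B (U w)" if "w \<in> ball 0 R'" "poly B (U w) \<noteq> 0" for w
      proof -
        have "(deriv U w)\<^sup>2 = (h w)\<^sup>2 * poly B (U w)" using vh(2) that by (metis power_mult_distrib)
        then show ?thesis using that by simp
      qed
      show "\<exists>f. f holomorphic_on ball 0 R \<and> (\<forall>z\<in>ball 0 R. norm (f z) \<le> K\<^sup>2) \<and>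
          f z = (deriv U z)\<^sup>2 / poly B (U z) \<and> f z0 = (deriv U z0)\<^sup>2 / poly B (U z0)"
      proof (intro exI[of _ "\<lambda>w. (h w)\<^sup>2"] conjI ballI val mem False z0)
        show "(\<lambda>w. (h w)\<^sup>2) holomorphic_on ball 0 R"
          by (intro holomorphic_intros holomorphic_on_subset[OF vh(1) mem(3)])
        show "norm ((h w)\<^sup>2) \<le> K\<^sup>2" if "w \<in> ball 0 R" for w
        proof -
          have "norm (h w) \<le> K" using vh(2) subsetD[OF mem(3) that] by blast
          then show ?thesis by (simp add: norm_power power_mono)
        qed
      qed
    qed
    then have "(deriv U z)\<^sup>2 / poly B (U z) = \<kappa>" by (simp only: \<kappa>_def)
    then show ?thesis using False by (simp add: nonzero_divide_eq_eq)
  qed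
  show False
    using entire_with_quartic_ode_constant[OF U ode AB(3,5) tame] nc by blast
qed

section \<open>Limits of projective curves\<close>

lemma norm_scalar_mult: "norm (c *s v) = norm c * norm (v :: complex ^ 3)"
  by (simp add: norm_vec_def L2_set_def norm_mult power_mult_distrib sum_distrib_left[symmetric] real_sqrt_mult)

section \<open>Locally uniform convergence as a joint limit in the index and the point\<close>

lemma eventually_compact_uniform:
  assumes "compact K" "\<And>z. z \<in> K \<Longrightarrow> eventually P (sequentially \<times>\<^sub>F nhds z)"
  shows "\<forall>\<^sub>F n in sequentially. \<forall>z\<in>K. P (n, z)"
proof -
  have "\<exists>N S. open S \<and> z \<in> S \<and> (\<forall>n\<ge>N. \<forall>w\<in>S. P (n, w))" if z: "z \<in> K" for z
  proof -
    obtain Pf Pg where *: "eventually Pf sequentially" "eventually Pg (nhds z)" "\<And>x y. Pf x \<Longrightarrow> Pg y \<Longrightarrow> P (x, y)"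
      using assms(2)[OF z] unfolding eventually_prod_filter by blast
    obtain N where "\<And>n. n \<ge> N \<Longrightarrow> Pf n" using *(1) by (auto simp: eventually_sequentially)
    moreover obtain S where "open S" "z \<in> S" "\<And>w. w \<in> S \<Longrightarrow> Pg w" using *(2) by (auto simp: eventually_nhds)
    ultimately show ?thesis using *(3) by blast
  qed
  then obtain N S where S: "\<And>z. z \<in> K \<Longrightarrow> open (S z) \<and> z \<in> S z \<and> (\<forall>n\<ge>N z. \<forall>w\<in>S z. P (n, w))"
    by metis
  obtain C where C: "C \<subseteq> K" "finite C" "K \<subseteq> (\<Union>c\<in>C. S c)"
    by (rule compactE_image[OF assms(1), of K S]) (use S in auto)
  define M where "M = Max (insert 0 (N ` C))"
  have "P (n, z)" if nz: "n \<ge> M" "z \<in> K" for n z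
  proof -
    obtain c where c: "c \<in> C" "z \<in> S c" using C(3) nz(2) by blast
    have "N c \<le> M" using c(1) C(2) by (auto simp: M_def)
    then show ?thesis using S[of c] c C(1) nz(1) by (meson le_trans subsetD)
  qed
  then show ?thesis by (auto simp: eventually_sequentially)
qed

lemma prod_nhds_nontrivial [simp]: "sequentially \<times>\<^sub>F nhds z \<noteq> bot"
  by (simp add: prod_filter_eq_bot)

text \<open>Limits along \<open>sequentially \<times>\<^sub>F nhds z\<close> at every z express
  locally uniform convergence. In this form they can be combined by the \<open>tendsto\<close>
  rules, and divergence to infinity is expressed in the same way.\<close>

lemma tendsto_prod_nhds_if_uniform_limit:
  fixes f :: "nat \<Rightarrow> complex \<Rightarrow> complex"
  assumes "open S" "z \<in> S" "continuous_on S g"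
    and "\<And>K. compact K \<Longrightarrow> K \<subseteq> S \<Longrightarrow> uniform_limit K f g sequentially"
  shows "((\<lambda>(n, w). f n w) \<longlongrightarrow> g z) (sequentially \<times>\<^sub>F nhds z)"
proof (rule tendstoI)
  fix e :: real assume e: "e > 0"
  obtain r where r: "r > 0" "cball z r \<subseteq> S" using assms(1,2) open_contains_cball by blast
  have 1: "\<forall>\<^sub>F n in sequentially. \<forall>w\<in>cball z r. dist (f n w) (g w) < e / 2"
    using uniform_limitD[OF assms(4)[OF compact_cball r(2)], of "e / 2"] e by simp
  have "isCont g z" using assms(1-3) by (simp add: continuous_on_eq_continuous_at)
  then have "(g \<longlongrightarrow> g z) (nhds z)"
    by (simp add: isCont_def tendsto_at_iff_tendsto_nhds)
  then have "\<forall>\<^sub>F w in nhds z. dist (g w) (g z) < e / 2"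
    using e by (intro tendstoD) auto
  moreover have "\<forall>\<^sub>F w in nhds z. w \<in> cball z r"
    using r(1) eventually_nhds_in_open[of "ball z r" z] by (auto elim: eventually_mono)
  ultimately have 2: "\<forall>\<^sub>F w in nhds z. w \<in> cball z r \<and> dist (g w) (g z) < e / 2"
    by eventually_elim auto
  show "\<forall>\<^sub>F x in sequentially \<times>\<^sub>F nhds z. dist (case x of (n, w) \<Rightarrow> f n w) (g z) < e"
    unfolding eventually_prod_filter
  proof (rule exI, rule exI, rule conjI[OF 1], rule conjI[OF 2], intro allI impI)
    fix n w assume "\<forall>w\<in>cball z r. dist (f n w) (g w) < e / 2" "w \<in> cball z r \<and> dist (g w) (g z) < e / 2"
    then have "dist (f n w) (g w) < e / 2" "dist (g w) (g z) < e / 2" by auto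
    then show "dist (case (n, w) of (n, w) \<Rightarrow> f n w) (g z) < e"
      using dist_triangle[of "f n w" "g z" "g w"] by simp
  qed
qed

lemma uniform_limit_if_tendsto_prod_nhds:
  fixes f :: "nat \<Rightarrow> complex \<Rightarrow> complex"
  assumes "compact K" "\<And>z. z \<in> K \<Longrightarrow> ((\<lambda>(n, w). f n w) \<longlongrightarrow> g z) (sequentially \<times>\<^sub>F nhds z)"
    and "\<And>z. z \<in> K \<Longrightarrow> isCont g z"
  shows "uniform_limit K f g sequentially"
proof (rule uniform_limitI)
  fix e :: real assume e: "e > 0"
  have "\<forall>\<^sub>F n in sequentially. \<forall>z\<in>K. (\<lambda>(n, w). dist (f n w) (g w) < e) (n, z)"
  proof (rule eventually_compact_uniform[OF assms(1)])
    fix z assume z: "z \<in> K"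
    have "(g \<longlongrightarrow> g z) (nhds z)"
      using assms(3)[OF z] by (simp add: isCont_def tendsto_at_iff_tendsto_nhds)
    then have "((\<lambda>(n, w). g w) \<longlongrightarrow> g z) (sequentially \<times>\<^sub>F nhds z)"
      using filterlim_compose[OF _ filterlim_snd] by (simp add: case_prod_beta')
    from tendsto_dist[OF assms(2)[OF z] this]
    have "((\<lambda>x. dist (case x of (n, w) \<Rightarrow> f n w) (case x of (n, w) \<Rightarrow> g w)) \<longlongrightarrow> 0) (sequentially \<times>\<^sub>F nhds z)"
      by simp
    from order_tendstoD(2)[OF this e]
    show "eventually (\<lambda>(n, w). dist (f n w) (g w) < e) (sequentially \<times>\<^sub>F nhds z)"
      by eventually_elim auto
  qed
  then show "\<forall>\<^sub>F n in sequentially. \<forall>x\<in>K. dist (f n x) (g x) < e" by simp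
qed

lemma tendsto_prod_nhds_pointwise:
  assumes "filterlim (\<lambda>(n, w). f n w) F (sequentially \<times>\<^sub>F nhds z)"
  shows "filterlim (\<lambda>n. f n z) F sequentially"
proof -
  have "filterlim (\<lambda>n. (n, z)) (sequentially \<times>\<^sub>F nhds z) sequentially"
    by (intro filterlim_Pair filterlim_ident tendsto_const)
  from filterlim_compose[OF assms this] show ?thesis by simp
qed

lemma filterlim_prod_nhds_reindex:
  assumes "filterlim (\<lambda>(n, w). f n w) F (sequentially \<times>\<^sub>F nhds z)"
    and "filterlim g sequentially sequentially" "\<forall>\<^sub>F n in sequentially. f' n = f (g n)"
  shows "filterlim (\<lambda>(n, w). f' n w) F (sequentially \<times>\<^sub>F nhds z)"
proof -
  have "filterlim (\<lambda>x. (g (fst x), snd x)) (sequentially \<times>\<^sub>F nhds z) (sequentially \<times>\<^sub>F nhds z)"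
    by (intro filterlim_Pair filterlim_snd filterlim_compose[OF assms(2) filterlim_fst])
  from filterlim_compose[OF assms(1) this]
  have lim: "filterlim (\<lambda>x. f (g (fst x)) (snd x)) F (sequentially \<times>\<^sub>F nhds z)" by simp
  have ev: "\<forall>\<^sub>F x in sequentially \<times>\<^sub>F nhds z. f (g (fst x)) (snd x) = (\<lambda>(n, w). f' n w) x"
    using eventually_compose_filterlim[OF assms(3) filterlim_fst[of sequentially "nhds z"]]
    by eventually_elim (simp add: case_prod_beta)
  show ?thesis using lim by (rule filterlim_cong[OF refl refl ev, THEN iffD1])
qed

lemma Montel_finite_family:
  fixes f :: "'j \<Rightarrow> nat \<Rightarrow> complex \<Rightarrow> complex"
  assumes "open S" "finite J"
    and "\<And>j n. j \<in> J \<Longrightarrow> f j n holomorphic_on S"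
    and "\<And>j n z. j \<in> J \<Longrightarrow> z \<in> S \<Longrightarrow> norm (f j n z) \<le> M"
  shows "\<exists>r g. strict_mono (r :: nat \<Rightarrow> nat) \<and> (\<forall>j\<in>J. g j holomorphic_on S \<and>
     (\<forall>z\<in>S. ((\<lambda>(n, w). f j (r n) w) \<longlongrightarrow> g j z) (sequentially \<times>\<^sub>F nhds z)))"
  using assms(2-)
proof (induction J rule: finite_induct)
  case empty
  show ?case by (intro exI[of _ id]) (auto simp: strict_mono_def)
next
  case (insert i J)
  obtain r g where r: "strict_mono (r :: nat \<Rightarrow> nat)" "\<forall>j\<in>J. g j holomorphic_on S \<and>
     (\<forall>z\<in>S. ((\<lambda>(n, w). f j (r n) w) \<longlongrightarrow> g j z) (sequentially \<times>\<^sub>F nhds z))"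
    using insert by blast
  obtain h r' where h: "h holomorphic_on S" "strict_mono (r' :: nat \<Rightarrow> nat)"
      "\<And>K. compact K \<Longrightarrow> K \<subseteq> S \<Longrightarrow> uniform_limit K ((\<lambda>n. f i (r n)) \<circ> r') h sequentially"
    by (rule Montel[OF \<open>open S\<close>, of "range (f i)" "\<lambda>n. f i (r n)"])
       (use insert.prems in \<open>auto intro!: exI[of _ M]\<close>)
  let ?r = "\<lambda>n. r (r' n)"
  have "strict_mono ?r" using strict_mono_o[OF r(1) h(2)] by (simp add: o_def)
  moreover have "((\<lambda>(n, w). f i (?r n) w) \<longlongrightarrow> h z) (sequentially \<times>\<^sub>F nhds z)" if "z \<in> S" for z
    using tendsto_prod_nhds_if_uniform_limit[OF \<open>open S\<close> that holomorphic_on_imp_continuous_on[OF h(1)] h(3)]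
    by (simp add: o_def)
  moreover have "((\<lambda>(n, w). f j (?r n) w) \<longlongrightarrow> g j z) (sequentially \<times>\<^sub>F nhds z)" if "z \<in> S" "j \<in> J" for z j
    using filterlim_prod_nhds_reindex[of "\<lambda>n. f j (r n)" _ z r' "\<lambda>n. f j (?r n)"] r(2) that
      filterlim_subseq[OF h(2)] by simp
  ultimately show ?case
    using insert.hyps r(2) h(1) by (intro exI[of _ ?r] exI[of _ "g(i := h)"]) auto
qed

lemma Hurwitz_prod_nhds:
  fixes f :: "nat \<Rightarrow> complex \<Rightarrow> complex"
  assumes S: "open S" "connected S"
    and f: "\<forall>\<^sub>F n in sequentially. f n holomorphic_on S \<and> (\<forall>z\<in>S. f n z \<noteq> 0)"
    and g: "g holomorphic_on S"
    and lim: "\<And>z. z \<in> S \<Longrightarrow> ((\<lambda>(n, w). f n w) \<longlongrightarrow> g z) (sequentially \<times>\<^sub>F nhds z)"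
  shows "(\<forall>z\<in>S. g z \<noteq> 0) \<or> (\<forall>z\<in>S. g z = 0)"
proof (rule disjCI)
  assume "\<not> (\<forall>z\<in>S. g z = 0)"
  then obtain z1 where z1: "z1 \<in> S" "g z1 \<noteq> 0" by blast
  obtain N where N: "\<And>n. n \<ge> N \<Longrightarrow> f n holomorphic_on S \<and> (\<forall>z\<in>S. f n z \<noteq> 0)"
    using f by (auto simp: eventually_sequentially)
  show "\<forall>z\<in>S. g z \<noteq> 0"
  proof (intro ballI notI)
    fix z0 assume z0: "z0 \<in> S" "g z0 = 0"
    then have "\<not> g constant_on S" using z1 by (metis constant_on_def)
    then have "g z0 \<noteq> 0"
    \<comment> \<open>Shifting by N turns the eventual hypotheses into hypotheses for all n.\<close>
    proof (rule Hurwitz_no_zeros[OF S _ g, of "\<lambda>n. f (n + N)", rotated 2])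
      fix K assume K: "compact K" "K \<subseteq> S"
      show "uniform_limit K (\<lambda>n. f (n + N)) g sequentially"
      proof (rule uniform_limit_if_tendsto_prod_nhds[OF K(1)])
        fix z assume "z \<in> K"
        then have z: "z \<in> S" using K by blast
        show "((\<lambda>(n, w). f (n + N) w) \<longlongrightarrow> g z) (sequentially \<times>\<^sub>F nhds z)"
          using lim[OF z] filterlim_add_const_nat_at_top[of N]
          by (rule filterlim_prod_nhds_reindex) simp
        show "isCont g z"
          using holomorphic_on_imp_continuous_on[OF g] S(1) z by (simp add: continuous_on_eq_continuous_at)
      qed
    qed (use N z0 in auto)
    then show False using z0 by simp
  qed
qed

text \<open>
  A substitute for Brody's reparametrisation, with a monotone local property \<open>T\<close> of balls in place
  of a bound on the derivative.
\<close>

lemma good_failure_ball: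
  fixes T :: "'a::complete_space set \<Rightarrow> bool"
  assumes mono: "\<And>A B. T A \<Longrightarrow> B \<subseteq> A \<Longrightarrow> T B"
    and loc: "\<And>z. \<exists>r>0. T (ball z r)"
    and fail: "\<not> T (ball z0 r0)" "r0 > 0"
    and L: "L > 0"
  obtains z R where "R > 0" "\<not> T (ball z (2 * R))" "\<And>w. w \<in> ball z (L * R) \<Longrightarrow> T (ball w (R / 4))"
proof (rule ccontr)
  assume neg: "\<not> thesis"
  note found = that
  \<comment> \<open>The first failing ball has radius \<open>2 * \<rho> 0\<close>. The factor 8
    makes \<open>2 * \<rho> (Suc n)\<close> equal to \<open>\<rho> n / 4\<close>, so a centre that
    violates the conclusion at scale n starts the search at scale n + 1.\<close>
  define \<rho> where "\<rho> n = r0 / 2 / 8 ^ n" for n :: nat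
  have \<rho>: "\<rho> n > 0" "\<rho> (Suc n) = \<rho> n / 8" for n using fail(2) by (simp_all add: \<rho>_def)
  have step: "\<exists>w. \<not> T (ball w (2 * \<rho> (Suc n))) \<and> dist z w < L * \<rho> n" if z: "\<not> T (ball z (2 * \<rho> n))" for z n
  proof (rule ccontr)
    assume "\<not> ?thesis"
    then have "\<And>w. w \<in> ball z (L * \<rho> n) \<Longrightarrow> T (ball w (\<rho> n / 4))" using \<rho>(2)[of n] by auto
    then show False using neg found[OF \<rho>(1) z] by blast
  qed
  have "\<not> T (ball z0 (2 * \<rho> 0))" using fail by (simp add: \<rho>_def)
  then obtain f where f: "\<And>n. \<not> T (ball (f n) (2 * \<rho> n))" "\<And>n. dist (f n) (f (Suc n)) < L * \<rho> n"
    using dependent_nat_choice[of "\<lambda>n z. \<not> T (ball z (2 * \<rho> n))" "\<lambda>n z w. dist z w < L * \<rho> n"] step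
    by metis
  \<comment> \<open>The distances L \<rho> i are summed as a geometric series; 2 is a convenient
    bound for the factor 8/7.\<close>
  have tele: "dist (f n) (f (n + m)) \<le> 2 * L * (\<rho> n - \<rho> (n + m))" for n m
  proof (induction m)
    case (Suc m)
    have "L * \<rho> (n + m) \<le> 2 * L * (\<rho> (n + m) - \<rho> (Suc (n + m)))"
      using L \<rho>(1)[of "n + m"] by (simp add: \<rho>(2) algebra_simps)
    then show ?case
      using Suc f(2)[of "n + m"] dist_triangle[of "f n" "f (n + Suc m)" "f (n + m)"]
      by (simp add: algebra_simps)
  qed simp
  have tail: "dist (f n) (f m) \<le> 2 * L * \<rho> n" if nm: "n \<le> m" for n m
  proof -
    have "2 * L * (\<rho> n - \<rho> m) \<le> 2 * L * \<rho> n" using L \<rho>(1)[of m] by (simp add: algebra_simps)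
    then show ?thesis using tele[of n "m - n"] nm by simp
  qed
  have \<rho>0: "(\<lambda>n. c * \<rho> n) \<longlonglongrightarrow> 0" for c
  proof -
    have "(\<lambda>n. c * (r0 / 2) * (1 / 8) ^ n) \<longlonglongrightarrow> c * (r0 / 2) * 0"
      by (intro tendsto_intros LIMSEQ_realpow_zero) auto
    then show ?thesis by (simp add: \<rho>_def power_divide)
  qed
  have "Cauchy f"
    unfolding Cauchy_altdef
  proof (intro allI impI)
    fix e :: real assume "e > 0"
    then obtain N where "\<And>n. n \<ge> N \<Longrightarrow> 2 * L * \<rho> n < e"
      using order_tendstoD(2)[OF \<rho>0[of "2 * L"]] by (auto simp: eventually_sequentially)
    then show "\<exists>M. \<forall>m\<ge>M. \<forall>n>m. dist (f m) (f n) < e"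
      using tail by (meson le_less_trans less_imp_le)
  qed
  then obtain z where z: "f \<longlonglongrightarrow> z" using Cauchy_convergent convergent_def by blast
  have dz: "dist (f n) z \<le> 2 * L * \<rho> n" for n
  proof (rule tendsto_upperbound)
    show "(\<lambda>m. dist (f n) (f m)) \<longlonglongrightarrow> dist (f n) z" by (intro tendsto_intros z)
    show "\<forall>\<^sub>F m in sequentially. dist (f n) (f m) \<le> 2 * L * \<rho> n"
      using tail by (auto simp: eventually_sequentially)
  qed simp
  \<comment> \<open>T holds near the limit z, but the failing balls eventually lie in that
    neighbourhood.\<close>
  obtain r where r: "r > 0" "T (ball z r)" using loc by blast
  obtain n where n: "(2 * L + 2) * \<rho> n < r"
    using order_tendstoD(2)[OF \<rho>0[of "2 * L + 2"] r(1)] by (auto simp: eventually_sequentially)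
  have "ball (f n) (2 * \<rho> n) \<subseteq> ball z r"
  proof
    fix w assume "w \<in> ball (f n) (2 * \<rho> n)"
    then have "dist z w < 2 * L * \<rho> n + 2 * \<rho> n"
      using dz[of n] dist_triangle[of z w "f n"] by (simp add: dist_commute)
    then show "w \<in> ball z r" using n by (simp add: algebra_simps)
  qed
  then show False using mono[OF r(2)] f(1) by blast
qed

text \<open>
  Curves in the projective plane are represented by lifts to \<open>\<complex>\<^sup>3\<close> that need not be continuous; only
  the ratios of the coordinates are holomorphic. This allows lifts of norm \<open>1\<close>.
\<close>

definition proj_curve :: "(complex \<Rightarrow> complex ^ 3) \<Rightarrow> bool" where
  "proj_curve X \<longleftrightarrow> (\<forall>z. X z \<noteq> 0) \<and>
     (\<forall>z i. X z $ i \<noteq> 0 \<longrightarrow> (\<exists>r>0. \<forall>j. (\<forall>w\<in>ball z r. X w $ i \<noteq> 0) \<and>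
        (\<lambda>w. X w $ j / X w $ i) holomorphic_on ball z r))"

definition proj_const :: "(complex \<Rightarrow> complex ^ 3) \<Rightarrow> bool" where
  "proj_const X \<longleftrightarrow> (\<forall>z. \<exists>c. X z = c *s X 0)"

text \<open>Convergence of points of the plane, not of the chosen unit vectors, whose phases may
  vary without control. One chart suffices; \<open>proj_tendsto_chart\<close> gives the
  others.\<close>

definition proj_tendsto :: "('a \<Rightarrow> complex ^ 3) \<Rightarrow> complex ^ 3 \<Rightarrow> 'a filter \<Rightarrow> bool" where
  "proj_tendsto Y x F \<longleftrightarrow> (\<forall>\<^sub>F p in F. norm (Y p) = 1) \<and> norm x = 1 \<and>
     (\<exists>i. x $ i \<noteq> 0 \<and> (\<forall>\<^sub>F p in F. Y p $ i \<noteq> 0) \<and>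
       (\<forall>j. ((\<lambda>p. Y p $ j / Y p $ i) \<longlongrightarrow> x $ j / x $ i) F))"

lemma proj_tendsto_chart:
  assumes "proj_tendsto Y x F" "x $ i \<noteq> 0"
  shows "\<forall>\<^sub>F p in F. Y p $ i \<noteq> 0" "((\<lambda>p. Y p $ j / Y p $ i) \<longlongrightarrow> x $ j / x $ i) F"
proof -
  obtain i0 where i0: "x $ i0 \<noteq> 0" "\<forall>\<^sub>F p in F. Y p $ i0 \<noteq> 0"
    "\<And>j. ((\<lambda>p. Y p $ j / Y p $ i0) \<longlongrightarrow> x $ j / x $ i0) F"
    using assms(1) by (auto simp: proj_tendsto_def)
  have "x $ i / x $ i0 \<noteq> 0" using assms i0 by simp
  from tendsto_imp_eventually_ne[OF i0(3) this]
  have nz: "\<forall>\<^sub>F p in F. Y p $ i / Y p $ i0 \<noteq> 0" .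
  then show ev: "\<forall>\<^sub>F p in F. Y p $ i \<noteq> 0" by eventually_elim auto
  have "((\<lambda>p. (Y p $ j / Y p $ i0) / (Y p $ i / Y p $ i0)) \<longlongrightarrow> (x $ j / x $ i0) / (x $ i / x $ i0)) F"
    by (intro tendsto_divide i0(3)) fact
  then have "((\<lambda>p. (Y p $ j / Y p $ i0) / (Y p $ i / Y p $ i0)) \<longlongrightarrow> x $ j / x $ i) F"
    using i0(1) by simp
  then show "((\<lambda>p. Y p $ j / Y p $ i) \<longlongrightarrow> x $ j / x $ i) F"
    by (rule Lim_transform_eventually) (use i0(2) ev in eventually_elim, auto)
qed

lemma vec_norm_ratio:
  fixes x :: "complex ^ 3"
  assumes "x $ i \<noteq> 0"
  shows "norm (\<chi> j. x $ j / x $ i) = norm x / norm (x $ i)"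
proof -
  have "(\<chi> j. x $ j / x $ i) = (1 / x $ i) *s x" by (simp add: vec_eq_iff)
  moreover have "norm (c *s x) = norm c * norm x" for c :: complex
    by (simp add: norm_vec_def L2_set_def norm_mult power_mult_distrib sum_distrib_left[symmetric]
        real_sqrt_mult)
  ultimately show ?thesis by (simp add: norm_divide)
qed

lemma peval_ratio:
  fixes x :: "complex ^ 3"
  assumes "q \<in> forms V k" "x $ i \<noteq> 0"
  shows "peval (\<lambda>j. x $ j / x $ i) q = peval (($) x) q / x $ i ^ k"
proof -
  have "(\<lambda>j. x $ j / x $ i) = (\<lambda>j. 1 / x $ i * x $ j)" by (simp add: fun_eq_iff)
  then show ?thesis by (simp only: peval_forms[OF assms(1)]) (simp add: power_divide)
qed

text \<open>Absolute values do not see the phase, and for a unit vector |Y_i| is the reciprocal of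
  the norm of the affine vector, which does converge.\<close>

lemma proj_tendsto_norm:
  assumes "proj_tendsto Y x F"
  shows "((\<lambda>p. norm (Y p $ j)) \<longlongrightarrow> norm (x $ j)) F"
    and "q \<in> forms V k \<Longrightarrow> ((\<lambda>p. norm (peval (($) (Y p)) q)) \<longlongrightarrow> norm (peval (($) x) q)) F"
proof -
  obtain i where i: "x $ i \<noteq> 0" using assms by (auto simp: proj_tendsto_def)
  note chart = proj_tendsto_chart[OF assms i]
  have nY: "\<forall>\<^sub>F p in F. norm (Y p) = 1" and nx: "norm x = 1" using assms by (auto simp: proj_tendsto_def)
  have "((\<lambda>p. norm (\<chi> j. Y p $ j / Y p $ i)) \<longlongrightarrow> norm (\<chi> j. x $ j / x $ i)) F"
    by (intro tendsto_norm tendsto_vec_lambda chart(2))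
  then have "((\<lambda>p. 1 / norm (Y p $ i)) \<longlongrightarrow> 1 / norm (x $ i)) F"
    unfolding vec_norm_ratio[OF i] nx
    by (rule Lim_transform_eventually) (use nY chart(1) in eventually_elim, simp add: vec_norm_ratio)
  from tendsto_inverse[OF this] have *: "((\<lambda>p. norm (Y p $ i)) \<longlongrightarrow> norm (x $ i)) F"
    using i by (simp add: inverse_eq_divide)
  have "((\<lambda>p. norm (Y p $ j / Y p $ i) * norm (Y p $ i)) \<longlongrightarrow> norm (x $ j / x $ i) * norm (x $ i)) F"
    by (intro tendsto_intros chart(2) *)
  then have "((\<lambda>p. norm (Y p $ j / Y p $ i) * norm (Y p $ i)) \<longlongrightarrow> norm (x $ j)) F"
    using i by (simp add: norm_divide)
  then show "((\<lambda>p. norm (Y p $ j)) \<longlongrightarrow> norm (x $ j)) F"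
    by (rule Lim_transform_eventually) (use chart(1) in eventually_elim, simp add: norm_divide)
  assume q: "q \<in> forms V k"
  have "((\<lambda>p. norm (peval (\<lambda>j. Y p $ j / Y p $ i) q) * norm (Y p $ i) ^ k) \<longlongrightarrow>
      norm (peval (\<lambda>j. x $ j / x $ i) q) * norm (x $ i) ^ k) F"
    by (intro tendsto_intros chart(2) *)
  then have "((\<lambda>p. norm (peval (\<lambda>j. Y p $ j / Y p $ i) q) * norm (Y p $ i) ^ k) \<longlongrightarrow>
      norm (peval (($) x) q)) F"
    using i by (simp add: peval_ratio[OF q i] norm_divide norm_power)
  then show "((\<lambda>p. norm (peval (($) (Y p)) q)) \<longlongrightarrow> norm (peval (($) x) q)) F"
    by (rule Lim_transform_eventually)
       (use chart(1) in eventually_elim, simp add: peval_ratio[OF q] norm_divide norm_power)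
qed

lemma proj_curve_tendsto:
  assumes "proj_curve X" "\<And>z. norm (X z) = 1"
  shows "proj_tendsto X (X z) (nhds z)"
proof -
  have "X z \<noteq> 0" using assms(1) by (auto simp: proj_curve_def)
  then obtain i where i: "X z $ i \<noteq> 0" by (auto simp: vec_eq_iff)
  then obtain r where r: "r > 0" "\<forall>w\<in>ball z r. X w $ i \<noteq> 0" "\<And>j. (\<lambda>w. X w $ j / X w $ i) holomorphic_on ball z r"
    using assms(1) unfolding proj_curve_def by blast
  have "((\<lambda>w. X w $ j / X w $ i) \<longlongrightarrow> X z $ j / X z $ i) (nhds z)" for j
  proof -
    have "isCont (\<lambda>w. X w $ j / X w $ i) z"
      using holomorphic_on_imp_continuous_on[OF r(3)] r(1) by (simp add: continuous_on_eq_continuous_at)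
    then show ?thesis
      using tendsto_at_iff_tendsto_nhds[of "\<lambda>w. X w $ j / X w $ i" z] by (simp add: isCont_def)
  qed
  moreover have "\<forall>\<^sub>F w in nhds z. X w $ i \<noteq> 0"
    using eventually_nhds_in_open[of "ball z r" z] r by (auto elim: eventually_mono)
  ultimately show ?thesis using assms i unfolding proj_tendsto_def by auto
qed

lemma proj_curve_holomorphic:
  assumes "proj_curve X" "open S" "\<And>z. z \<in> S \<Longrightarrow> X z $ i \<noteq> 0"
  shows "(\<lambda>z. X z $ j / X z $ i) holomorphic_on S"
proof -
  have "(\<lambda>z. X z $ j / X z $ i) field_differentiable (at z)" if z: "z \<in> S" for z
  proof -
    obtain r where "r > 0" "(\<lambda>w. X w $ j / X w $ i) holomorphic_on ball z r"
      using assms(1) assms(3)[OF z] unfolding proj_curve_def by blast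
    then show ?thesis by (simp add: holomorphic_on_imp_differentiable_at)
  qed
  then show ?thesis unfolding holomorphic_on_def using field_differentiable_at_within by blast
qed

text \<open>
  A tame set is mapped into a single affine chart, and there it stays away from the zero or from the
  infinity section of the degeneration, whose fibre coordinate is \<open>normal_coord\<close>.
\<close>

definition tame :: "ternary_poly \<Rightarrow> complex \<Rightarrow> (complex \<Rightarrow> complex ^ 3) \<Rightarrow> complex set \<Rightarrow> bool" where
  "tame q t X S \<longleftrightarrow> (\<exists>i. \<forall>z\<in>S. norm (X z $ i) \<ge> 1 / 4) \<and>
     ((\<forall>z\<in>S. norm (peval (($) (X z)) q) \<le> 2 * norm t) \<or> (\<forall>z\<in>S. norm t \<le> 2 * norm (peval (($) (X z)) q)))"

definition normal_coord :: "ternary_poly \<Rightarrow> nat \<Rightarrow> complex \<Rightarrow> 3 \<Rightarrow> complex ^ 3 \<Rightarrow> complex" where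
  "normal_coord q k t i x = peval (($) x) q / (t * x $ i ^ k)"

lemma normal_coord_ratio:
  assumes "q \<in> forms V k" "x $ i \<noteq> 0"
  shows "normal_coord q k t i x = peval (\<lambda>j. x $ j / x $ i) q / t"
  using peval_ratio[OF assms] by (simp add: normal_coord_def)

lemma normal_coord_holomorphic:
  assumes "proj_curve X" "open S" "\<And>z. z \<in> S \<Longrightarrow> X z $ i \<noteq> 0" "q \<in> forms V k" "t \<noteq> 0"
  shows "(\<lambda>z. normal_coord q k t i (X z)) holomorphic_on S"
proof -
  have "(\<lambda>z. peval (\<lambda>j. X z $ j / X z $ i) q / t) holomorphic_on S"
    using assms by (intro holomorphic_intros holomorphic_mpoly_eval proj_curve_holomorphic) auto
  then show ?thesis
    by (rule holomorphic_transform) (simp add: normal_coord_ratio[OF assms(4) assms(3)])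
qed

section \<open>Extraction of subsequences that converge in charts\<close>

lemma norm_component_le: "norm (x $ i) \<le> norm (x :: complex ^ 3)"
  by (rule Finite_Cartesian_Product.norm_nth_le)

text \<open>A predicate on the subsequence \<sigma>, as the diagonal argument requires. The second
  alternative records that q does not vanish on the curves, so that Hurwitz's theorem can later be
  applied to q itself.\<close>

definition local_limit where
  "local_limit q k X t \<sigma> S \<longleftrightarrow> (\<exists>i a. (\<forall>\<^sub>F n in sequentially. \<forall>z\<in>S. norm (X (\<sigma> n) z $ i) \<ge> 1 / 4) \<and>
     (\<forall>j. a j holomorphic_on S \<and> (\<forall>\<zeta>\<in>S.
        ((\<lambda>(n, z). X (\<sigma> n) z $ j / X (\<sigma> n) z $ i) \<longlongrightarrow> a j \<zeta>) (sequentially \<times>\<^sub>F nhds \<zeta>))) \<and>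
     ((\<exists>w. w holomorphic_on S \<and> (\<forall>\<zeta>\<in>S.
        ((\<lambda>(n, z). normal_coord q k (t (\<sigma> n)) i (X (\<sigma> n) z)) \<longlongrightarrow> w \<zeta>) (sequentially \<times>\<^sub>F nhds \<zeta>))) \<or>
      ((\<forall>\<^sub>F n in sequentially. \<forall>z\<in>S. peval (($) (X (\<sigma> n) z)) q \<noteq> 0) \<and> (\<forall>\<zeta>\<in>S.
        filterlim (\<lambda>(n, z). normal_coord q k (t (\<sigma> n)) i (X (\<sigma> n) z)) at_infinity
          (sequentially \<times>\<^sub>F nhds \<zeta>)))))"

text \<open>Agreement is only asked for eventually, because the diagonal subsequence is a
  subsequence of each of the successive ones only up to finitely many terms.\<close>

lemma local_limit_reindex:
  fixes X :: "nat \<Rightarrow> complex \<Rightarrow> complex ^ 3" and t :: "nat \<Rightarrow> complex"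
  assumes "local_limit q k X t \<sigma> S" and g: "filterlim g sequentially sequentially"
    "\<forall>\<^sub>F n in sequentially. \<sigma>' n = \<sigma> (g n)"
  shows "local_limit q k X t \<sigma>' S"
proof -
  have re: "filterlim (\<lambda>(n, z). h (\<sigma>' n) z) F (sequentially \<times>\<^sub>F nhds \<zeta>)"
    if "filterlim (\<lambda>(n, z). h (\<sigma> n) z) F (sequentially \<times>\<^sub>F nhds \<zeta>)"
    for h :: "nat \<Rightarrow> complex \<Rightarrow> complex" and F \<zeta>
    by (rule filterlim_prod_nhds_reindex[OF that g(1)]) (use g(2) in eventually_elim, simp)
  have ev: "\<forall>\<^sub>F n in sequentially. P (\<sigma>' n)" if "\<forall>\<^sub>F n in sequentially. P (\<sigma> n)" for P
    using eventually_compose_filterlim[OF that g(1)] g(2) by eventually_elim simp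
  obtain i a where 1: "\<forall>\<^sub>F n in sequentially. \<forall>z\<in>S. norm (X (\<sigma> n) z $ i) \<ge> 1 / 4"
    and 2: "\<And>j. a j holomorphic_on S" "\<And>j \<zeta>. \<zeta> \<in> S \<Longrightarrow>
        ((\<lambda>(n, z). X (\<sigma> n) z $ j / X (\<sigma> n) z $ i) \<longlongrightarrow> a j \<zeta>) (sequentially \<times>\<^sub>F nhds \<zeta>)"
    and 3: "(\<exists>w. w holomorphic_on S \<and> (\<forall>\<zeta>\<in>S.
        ((\<lambda>(n, z). normal_coord q k (t (\<sigma> n)) i (X (\<sigma> n) z)) \<longlongrightarrow> w \<zeta>) (sequentially \<times>\<^sub>F nhds \<zeta>))) \<or>
      ((\<forall>\<^sub>F n in sequentially. \<forall>z\<in>S. peval (($) (X (\<sigma> n) z)) q \<noteq> 0) \<and> (\<forall>\<zeta>\<in>S.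
        filterlim (\<lambda>(n, z). normal_coord q k (t (\<sigma> n)) i (X (\<sigma> n) z)) at_infinity
          (sequentially \<times>\<^sub>F nhds \<zeta>)))"
    using assms(1) unfolding local_limit_def by blast
  show ?thesis
    unfolding local_limit_def
  proof (intro exI[of _ i] exI[of _ a] conjI allI ballI)
    show "\<forall>\<^sub>F n in sequentially. \<forall>z\<in>S. norm (X (\<sigma>' n) z $ i) \<ge> 1 / 4" by (rule ev[OF 1])
    show "a j holomorphic_on S" for j by (rule 2)
    show "((\<lambda>(n, z). X (\<sigma>' n) z $ j / X (\<sigma>' n) z $ i) \<longlongrightarrow> a j \<zeta>) (sequentially \<times>\<^sub>F nhds \<zeta>)"
      if "\<zeta> \<in> S" for j \<zeta>
      by (rule re[of "\<lambda>n z. X n z $ j / X n z $ i"]) (rule 2(2)[OF that])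
    show "(\<exists>w. w holomorphic_on S \<and> (\<forall>\<zeta>\<in>S.
        ((\<lambda>(n, z). normal_coord q k (t (\<sigma>' n)) i (X (\<sigma>' n) z)) \<longlongrightarrow> w \<zeta>) (sequentially \<times>\<^sub>F nhds \<zeta>))) \<or>
      ((\<forall>\<^sub>F n in sequentially. \<forall>z\<in>S. peval (($) (X (\<sigma>' n) z)) q \<noteq> 0) \<and> (\<forall>\<zeta>\<in>S.
        filterlim (\<lambda>(n, z). normal_coord q k (t (\<sigma>' n)) i (X (\<sigma>' n) z)) at_infinity
          (sequentially \<times>\<^sub>F nhds \<zeta>)))"
      using 3
    proof (elim disjE exE conjE)
      fix w assume w: "w holomorphic_on S" "\<forall>\<zeta>\<in>S.
        ((\<lambda>(n, z). normal_coord q k (t (\<sigma> n)) i (X (\<sigma> n) z)) \<longlongrightarrow> w \<zeta>) (sequentially \<times>\<^sub>F nhds \<zeta>)"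
      show ?thesis
        by (intro disjI1 exI[of _ w] conjI ballI w(1) re[of "\<lambda>n z. normal_coord q k (t n) i (X n z)"])
           (use w(2) in blast)
    next
      assume w: "\<forall>\<^sub>F n in sequentially. \<forall>z\<in>S. peval (($) (X (\<sigma> n) z)) q \<noteq> 0" "\<forall>\<zeta>\<in>S.
        filterlim (\<lambda>(n, z). normal_coord q k (t (\<sigma> n)) i (X (\<sigma> n) z)) at_infinity
          (sequentially \<times>\<^sub>F nhds \<zeta>)"
      show ?thesis
        by (intro disjI2 conjI ballI ev[OF w(1)] re[of "\<lambda>n z. normal_coord q k (t n) i (X n z)"])
           (use w(2) in blast)
    qed
  qed
qed

text \<open>There are finitely many choices of chart and of side in \<open>tame\<close>, so a
  subsequence realises one of them throughout. Montel's theorem applies to the coordinate ratios and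
  to the normal coordinate or its inverse. A limit of inverses is zero-free or identically zero by
  Hurwitz's theorem, which gives the finite and the infinite alternative.\<close>

lemma local_limit_exists:
  fixes X :: "nat \<Rightarrow> complex \<Rightarrow> complex ^ 3" and t :: "nat \<Rightarrow> complex"
  assumes X: "\<And>n. proj_curve (X n)" "\<And>n z. norm (X n z) = 1" and t: "\<And>n. t n \<noteq> 0"
    and q: "q \<in> forms UNIV k" and S: "open S" "connected S"
    and tame: "\<forall>\<^sub>F n in sequentially. tame q (t (\<sigma> n)) (X (\<sigma> n)) S"
  shows "\<exists>r. strict_mono r \<and> local_limit q k X t (\<sigma> \<circ> r) S"
proof -
  \<comment> \<open>i is the chart, and b tells which bound on q / t holds.\<close>
  define Q where "Q = (\<lambda>(i, b) n. (\<forall>z\<in>S. norm (X n z $ i) \<ge> 1 / 4) \<and>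
     (if b then \<forall>z\<in>S. norm (peval (($) (X n z)) q) \<le> 2 * norm (t n)
      else \<forall>z\<in>S. norm (t n) \<le> 2 * norm (peval (($) (X n z)) q)))"
  have ev: "\<forall>\<^sub>F n in sequentially. \<exists>x. Q x (\<sigma> n)"
    using tame
  proof eventually_elim
    case (elim n)
    then obtain i where i: "\<forall>z\<in>S. norm (X (\<sigma> n) z $ i) \<ge> 1 / 4" by (auto simp: tame_def)
    show "\<exists>x. Q x (\<sigma> n)"
    proof (cases "\<forall>z\<in>S. norm (peval (($) (X (\<sigma> n) z)) q) \<le> 2 * norm (t (\<sigma> n))")
      case True
      then show ?thesis using i by (intro exI[of _ "(i, True)"]) (simp add: Q_def)
    next
      case False
      then have "\<forall>z\<in>S. norm (t (\<sigma> n)) \<le> 2 * norm (peval (($) (X (\<sigma> n) z)) q)"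
        using elim unfolding tame_def by blast
      then show ?thesis using i by (intro exI[of _ "(i, False)"]) (simp add: Q_def)
    qed
  qed
  have "\<exists>x. \<not> (\<forall>\<^sub>F n in sequentially. \<not> Q x (\<sigma> n))"
  proof (rule ccontr)
    assume "\<not> ?thesis"
    then have "\<forall>\<^sub>F n in sequentially. \<forall>x\<in>UNIV. \<not> Q x (\<sigma> n)"
      by (subst eventually_ball_finite_distrib) auto
    with ev have "\<forall>\<^sub>F n in sequentially. False" by eventually_elim auto
    then show False by simp
  qed
  then obtain i b where ib: "\<not> (\<forall>\<^sub>F n in sequentially. \<not> Q (i, b) (\<sigma> n))" by (metis surj_pair)
  then have "infinite {n. Q (i, b) (\<sigma> n)}"
    unfolding cofinite_eq_sequentially[symmetric] eventually_cofinite by simp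
  then obtain r1 :: "nat \<Rightarrow> nat" where r1: "strict_mono r1" "\<And>n. Q (i, b) (\<sigma> (r1 n))"
    using infinite_enumerate by blast
  define \<tau> where "\<tau> n = \<sigma> (r1 n)" for n
  have idx: "norm (X (\<tau> n) z $ i) \<ge> 1 / 4" if "z \<in> S" for n z
    using r1(2)[of n] that by (simp add: Q_def \<tau>_def)
  have nz: "X (\<tau> n) z $ i \<noteq> 0" if "z \<in> S" for n z using idx[OF that, of n] by auto
  let ?W = "\<lambda>n z. normal_coord q k (t (\<tau> n)) i (X (\<tau> n) z)"
  \<comment> \<open>The index \<open>None\<close> carries the normal coordinate, or its inverse if
    that is the bounded one.\<close>
  define f where "f j n z = (case j of Some j \<Rightarrow> X (\<tau> n) z $ j / X (\<tau> n) z $ i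
      | None \<Rightarrow> if b then ?W n z else inverse (?W n z))" for j n z
  have bq: "if b then norm (peval (($) (X (\<tau> n) z)) q) \<le> 2 * norm (t (\<tau> n))
      else norm (t (\<tau> n)) \<le> 2 * norm (peval (($) (X (\<tau> n) z)) q)" if "z \<in> S" for n z
    using r1(2)[of n] that by (auto simp: Q_def \<tau>_def split: if_splits)
  have qnz: "peval (($) (X (\<tau> n) z)) q \<noteq> 0" if "z \<in> S" "\<not> b" for n z
  proof -
    have "norm (t (\<tau> n)) > 0" using t by simp
    then show ?thesis using bq[OF that(1), of n] that(2) by auto
  qed
  have Wnz: "?W n z \<noteq> 0" if "z \<in> S" "\<not> b" for n z
    using qnz[OF that, of n] t[of "\<tau> n"] nz[OF that(1), of n] by (simp add: normal_coord_def)
  have holW: "?W n holomorphic_on S" for n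
    by (rule normal_coord_holomorphic[OF X(1) S(1) nz q t])
  have hol: "f j n holomorphic_on S" for j n
  proof (cases j)
    case None
    then show ?thesis
      unfolding f_def using holW[of n] Wnz by (cases b) (auto intro!: holomorphic_intros)
  next
    case (Some j')
    then show ?thesis unfolding f_def by (simp add: proj_curve_holomorphic[OF X(1) S(1) nz])
  qed
  \<comment> \<open>4 bounds the ratios, as the i-th component is at least 1/4; 2 * 4^k bounds the
    normal coordinate, and its inverse is bounded by 2.\<close>
  define M where "M = (4::real) + 2 * 4 ^ k"
  have bound: "norm (f j n z) \<le> M" if z: "z \<in> S" for j n z
  proof (cases j)
    case (Some j')
    have "norm (X (\<tau> n) z $ j') / norm (X (\<tau> n) z $ i) \<le> 1 / (1 / 4)"
      using idx[OF z, of n] norm_component_le[of "X (\<tau> n) z" j'] X(2) by (intro frac_le) auto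
    then show ?thesis using Some by (simp add: f_def norm_divide M_def add_increasing2)
  next
    case None
    show ?thesis
    proof (cases b)
      case True
      have "norm (?W n z) = norm (peval (($) (X (\<tau> n) z)) q) / (norm (t (\<tau> n)) * norm (X (\<tau> n) z $ i) ^ k)"
        by (simp add: normal_coord_def norm_divide norm_mult norm_power)
      also have "\<dots> \<le> (2 * norm (t (\<tau> n))) / (norm (t (\<tau> n)) * (1 / 4) ^ k)"
        using bq[OF z, of n] True idx[OF z, of n] t by (intro frac_le mult_left_mono power_mono) auto
      also have "\<dots> = 2 * 4 ^ k" using t by (simp add: power_divide)
      finally show ?thesis using None True by (simp add: f_def M_def)
    next
      case False
      have "norm (inverse (?W n z)) = norm (t (\<tau> n)) * norm (X (\<tau> n) z $ i) ^ k / norm (peval (($) (X (\<tau> n) z)) q)"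
        by (simp add: normal_coord_def norm_divide norm_mult norm_power norm_inverse)
      also have "\<dots> \<le> (2 * norm (peval (($) (X (\<tau> n) z)) q)) * 1 / norm (peval (($) (X (\<tau> n) z)) q)"
        using bq[OF z, of n] False norm_component_le[of "X (\<tau> n) z" i] X(2)
        by (intro divide_right_mono mult_mono power_le_one) auto
      also have "\<dots> = 2" using qnz[OF z False, of n] by simp
      also have "\<dots> \<le> M" by (simp add: M_def add_increasing2)
      finally show ?thesis using None False by (simp add: f_def)
    qed
  qed
  have "\<exists>r g. strict_mono (r :: nat \<Rightarrow> nat) \<and> (\<forall>j\<in>UNIV. g j holomorphic_on S \<and>
     (\<forall>z\<in>S. ((\<lambda>(n, w). f j (r n) w) \<longlongrightarrow> g j z) (sequentially \<times>\<^sub>F nhds z)))"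
    by (rule Montel_finite_family[OF S(1), where M = M]) (simp_all add: hol bound)
  then obtain r2 g where r2: "strict_mono (r2 :: nat \<Rightarrow> nat)" and gg: "\<forall>j\<in>UNIV. g j holomorphic_on S \<and>
     (\<forall>z\<in>S. ((\<lambda>(n, w). f j (r2 n) w) \<longlongrightarrow> g j z) (sequentially \<times>\<^sub>F nhds z))"
    by (elim exE conjE)
  have g1: "g j holomorphic_on S" for j using bspec[OF gg UNIV_I, of j] by (rule conjunct1)
  have g2: "((\<lambda>(n, w). f j (r2 n) w) \<longlongrightarrow> g j z) (sequentially \<times>\<^sub>F nhds z)" if "z \<in> S" for j z
    by (rule bspec[OF conjunct2[OF bspec[OF gg UNIV_I, of j]] that])
  note g = g1 g2
  have \<sigma>: "\<sigma> ((r1 \<circ> r2) n) = \<tau> (r2 n)" for n by (simp add: \<tau>_def)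
  have limSome: "((\<lambda>(n, w). X (\<tau> (r2 n)) w $ j / X (\<tau> (r2 n)) w $ i) \<longlongrightarrow> g (Some j) z) (sequentially \<times>\<^sub>F nhds z)"
    if "z \<in> S" for j z using g(2)[OF that, of "Some j"] by (simp add: f_def)
  have evS: "\<forall>\<^sub>F x in sequentially \<times>\<^sub>F nhds z. snd x \<in> S" if "z \<in> S" for z
    using eventually_compose_filterlim[OF eventually_nhds_in_open[OF S(1) that] filterlim_snd] .
  have types: "(\<exists>w. w holomorphic_on S \<and> (\<forall>\<zeta>\<in>S.
        ((\<lambda>(n, z). ?W (r2 n) z) \<longlongrightarrow> w \<zeta>) (sequentially \<times>\<^sub>F nhds \<zeta>))) \<or>
      ((\<forall>\<^sub>F n in sequentially. \<forall>z\<in>S. peval (($) (X (\<tau> (r2 n)) z)) q \<noteq> 0) \<and> (\<forall>\<zeta>\<in>S.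
        filterlim (\<lambda>(n, z). ?W (r2 n) z) at_infinity (sequentially \<times>\<^sub>F nhds \<zeta>)))"
  proof (cases b)
    case True
    then show ?thesis
      using g(1)[of None] g(2)[of _ None] by (intro disjI1 exI[of _ "g None"]) (simp add: f_def)
  next
    case False
    have lim: "((\<lambda>(n, z). inverse (?W (r2 n) z)) \<longlongrightarrow> g None \<zeta>) (sequentially \<times>\<^sub>F nhds \<zeta>)" if "\<zeta> \<in> S" for \<zeta>
      using g(2)[OF that, of None] False by (simp add: f_def)
    have "(\<forall>z\<in>S. g None z \<noteq> 0) \<or> (\<forall>z\<in>S. g None z = 0)"
    proof (rule Hurwitz_prod_nhds[OF S _ g(1)])
      show "\<forall>\<^sub>F n in sequentially. (\<lambda>z. inverse (?W (r2 n) z)) holomorphic_on S \<and> (\<forall>z\<in>S. inverse (?W (r2 n) z) \<noteq> 0)"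
        using holW Wnz[OF _ False] by (auto intro!: always_eventually holomorphic_intros)
    qed (rule lim)
    then show ?thesis
    proof
      assume nz: "\<forall>z\<in>S. g None z \<noteq> 0"
      show ?thesis
      proof (intro disjI1 exI[of _ "\<lambda>z. inverse (g None z)"] conjI ballI)
        show "(\<lambda>z. inverse (g None z)) holomorphic_on S" using g(1) nz by (intro holomorphic_intros) auto
        fix \<zeta> assume \<zeta>: "\<zeta> \<in> S"
        from tendsto_inverse[OF lim[OF this]] nz \<zeta>
        show "((\<lambda>(n, z). ?W (r2 n) z) \<longlongrightarrow> inverse (g None \<zeta>)) (sequentially \<times>\<^sub>F nhds \<zeta>)"
          by (simp add: case_prod_beta')
      qed
    next
      assume zero: "\<forall>z\<in>S. g None z = 0"
      have "filterlim (\<lambda>(n, z). ?W (r2 n) z) at_infinity (sequentially \<times>\<^sub>F nhds \<zeta>)" if \<zeta>: "\<zeta> \<in> S" for \<zeta>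
      proof -
        let ?v = "\<lambda>p. inverse (?W (r2 (fst p)) (snd p))"
        have "(?v \<longlongrightarrow> 0) (sequentially \<times>\<^sub>F nhds \<zeta>)"
          using lim[OF \<zeta>] zero \<zeta> by (simp add: case_prod_beta')
        moreover have "\<forall>\<^sub>F p in sequentially \<times>\<^sub>F nhds \<zeta>. ?v p \<noteq> 0"
          using evS[OF \<zeta>] by eventually_elim (simp add: Wnz[OF _ False])
        ultimately have "filterlim ?v (at 0) (sequentially \<times>\<^sub>F nhds \<zeta>)"
          by (simp add: filterlim_at)
        from filterlim_compose[OF filterlim_inverse_at_infinity this] show ?thesis
          by (simp add: case_prod_beta')
      qed
      then show ?thesis using qnz[OF _ False] by (intro disjI2 conjI always_eventually) auto
    qed
  qed
  have "local_limit q k X t (\<sigma> \<circ> (r1 \<circ> r2)) S"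
    unfolding local_limit_def o_apply[of \<sigma>] \<sigma>
    by (intro exI[of _ i] exI[of _ "\<lambda>j. g (Some j)"] conjI allI ballI types g(1) limSome)
       (use idx in \<open>auto intro!: always_eventually\<close>)
  moreover have "strict_mono (r1 \<circ> r2)" using r1(1) r2 by (rule strict_mono_o)
  ultimately show ?thesis by blast
qed

lemma local_limits_exist:
  fixes X :: "nat \<Rightarrow> complex \<Rightarrow> complex ^ 3" and t :: "nat \<Rightarrow> complex"
  assumes X: "\<And>n. proj_curve (X n)" "\<And>n z. norm (X n z) = 1" and t: "\<And>n. t n \<noteq> 0"
    and q: "q \<in> forms UNIV k" and S: "\<And>m::nat. open (S m)" "\<And>m. connected (S m)"
    and tame: "\<And>m. \<forall>\<^sub>F n in sequentially. tame q (t n) (X n) (S m)"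
  shows "\<exists>\<sigma>. strict_mono \<sigma> \<and> (\<forall>m. local_limit q k X t \<sigma> (S m))"
proof -
  interpret subseqs "\<lambda>m \<sigma>. local_limit q k X t \<sigma> (S m)"
  proof
    fix m and s :: "nat \<Rightarrow> nat" assume "strict_mono s"
    then have ev: "\<forall>\<^sub>F n in sequentially. tame q (t (s n)) (X (s n)) (S m)"
      using eventually_compose_filterlim[OF tame filterlim_subseq] by blast
    show "\<exists>r'. strict_mono r' \<and> local_limit q k X t (s \<circ> r') (S m)"
    proof -
      have "\<exists>r. strict_mono r \<and> local_limit q k X t (s \<circ> r) (S m)"
      proof (rule local_limit_exists)
        show "\<And>n. proj_curve (X n)" by (rule X)
        show "\<And>n z. norm (X n z) = 1" by (rule X)
        show "\<And>n. t n \<noteq> 0" by (rule t)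
        show "q \<in> forms UNIV k" by (rule q)
        show "open (S m)" "connected (S m)" by (rule S)+
        show "\<forall>\<^sub>F n in sequentially. tame q (t (s n)) (X (s n)) (S m)" by (rule ev)
      qed
      then show ?thesis .
    qed
  qed
  have "local_limit q k X t diagseq (S m)" for m
  proof -
    have "local_limit q k X t (diagseq \<circ> ((+) (Suc m))) (S m)"
    proof (rule diagseq_holds)
      fix n and s r :: "nat \<Rightarrow> nat"
      assume r: "strict_mono r" and s: "local_limit q k X t s (S n)"
      show "local_limit q k X t (s \<circ> r) (S n)"
        by (rule local_limit_reindex[OF s filterlim_subseq[OF r]]) simp
    qed
    then show ?thesis
    proof (rule local_limit_reindex)
      show "filterlim (\<lambda>n. n - Suc m) sequentially sequentially" by (rule filterlim_minus_const_nat_at_top)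
      show "\<forall>\<^sub>F n in sequentially. diagseq n = (diagseq \<circ> ((+) (Suc m))) (n - Suc m)"
        using eventually_ge_at_top[of "Suc m"] by eventually_elim simp
    qed
  qed
  then show ?thesis using subseq_diagseq by blast
qed


text \<open>Balls of radius \<rho> around a countable dense set cover the source, so one diagonal
  subsequence converges on all of them. The limits in the charts are glued by choosing a unit vector
  at each point.\<close>

theorem projective_limit:
  fixes X :: "nat \<Rightarrow> complex \<Rightarrow> complex ^ 3" and t :: "nat \<Rightarrow> complex"
  assumes X: "\<And>n. proj_curve (X n)" "\<And>n z. norm (X n z) = 1" and t: "\<And>n. t n \<noteq> 0"
    and q: "q \<in> forms UNIV k" and \<rho>: "\<rho> > 0"
    and tame: "\<And>c. \<forall>\<^sub>F n in sequentially. tame q (t n) (X n) (ball c \<rho>)"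
  obtains \<sigma> X' where "strict_mono \<sigma>" "proj_curve X'" "\<And>z. norm (X' z) = 1"
    "\<And>\<zeta>. proj_tendsto (\<lambda>(n, z). X (\<sigma> n) z) (X' \<zeta>) (sequentially \<times>\<^sub>F nhds \<zeta>)"
    "\<And>\<zeta>. (\<exists>r i w. r > 0 \<and> (\<forall>z\<in>ball \<zeta> r. X' z $ i \<noteq> 0) \<and> w holomorphic_on ball \<zeta> r \<and> (\<forall>y\<in>ball \<zeta> r.
          ((\<lambda>(n, z). normal_coord q k (t (\<sigma> n)) i (X (\<sigma> n) z)) \<longlongrightarrow> w y) (sequentially \<times>\<^sub>F nhds y))) \<or>
       (\<exists>r i. r > 0 \<and> (\<forall>z\<in>ball \<zeta> r. X' z $ i \<noteq> 0) \<and>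
          (\<forall>\<^sub>F n in sequentially. \<forall>z\<in>ball \<zeta> r. X (\<sigma> n) z $ i \<noteq> 0 \<and> peval (($) (X (\<sigma> n) z)) q \<noteq> 0) \<and>
          (\<forall>y\<in>ball \<zeta> r. filterlim (\<lambda>(n, z). normal_coord q k (t (\<sigma> n)) i (X (\<sigma> n) z)) at_infinity
            (sequentially \<times>\<^sub>F nhds y)))"
proof -
  obtain D :: "complex set" where D: "countable D" "\<And>U. open U \<Longrightarrow> U \<noteq> {} \<Longrightarrow> \<exists>d\<in>D. d \<in> U"
    using countable_dense_exists by metis
  have "D \<noteq> {}" using D(2)[of UNIV] by auto
  define S where "S m = ball (from_nat_into D m) \<rho>" for m
  have cover: "\<exists>m. \<zeta> \<in> S m" for \<zeta>
  proof -
    obtain d where d: "d \<in> D" "d \<in> ball \<zeta> \<rho>" using D(2)[of "ball \<zeta> \<rho>"] \<rho> by auto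
    then obtain m where "d = from_nat_into D m" using from_nat_into_surj[OF D(1)] by metis
    then show ?thesis using d by (auto simp: S_def dist_commute)
  qed
  have "\<exists>\<sigma>. strict_mono \<sigma> \<and> (\<forall>m. local_limit q k X t \<sigma> (S m))"
    by (rule local_limits_exist[where X = X and t = t and S = S and q = q and k = k])
       (simp_all add: X t q S_def tame)
  then obtain \<sigma> where \<sigma>: "strict_mono \<sigma>" "\<And>m. local_limit q k X t \<sigma> (S m)" by blast
  have data: "\<exists>m i a. \<zeta> \<in> S m \<and>
     (\<forall>\<^sub>F n in sequentially. \<forall>z\<in>S m. norm (X (\<sigma> n) z $ i) \<ge> 1 / 4) \<and>
     (\<forall>j. a j holomorphic_on S m \<and> (\<forall>\<zeta>\<in>S m.
        ((\<lambda>(n, z). X (\<sigma> n) z $ j / X (\<sigma> n) z $ i) \<longlongrightarrow> a j \<zeta>) (sequentially \<times>\<^sub>F nhds \<zeta>))) \<and>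
     ((\<exists>w. w holomorphic_on S m \<and> (\<forall>\<zeta>\<in>S m.
        ((\<lambda>(n, z). normal_coord q k (t (\<sigma> n)) i (X (\<sigma> n) z)) \<longlongrightarrow> w \<zeta>) (sequentially \<times>\<^sub>F nhds \<zeta>))) \<or>
      ((\<forall>\<^sub>F n in sequentially. \<forall>z\<in>S m. peval (($) (X (\<sigma> n) z)) q \<noteq> 0) \<and> (\<forall>\<zeta>\<in>S m.
        filterlim (\<lambda>(n, z). normal_coord q k (t (\<sigma> n)) i (X (\<sigma> n) z)) at_infinity
          (sequentially \<times>\<^sub>F nhds \<zeta>))))" for \<zeta>
  proof -
    obtain m where m: "\<zeta> \<in> S m" using cover by blast
    from \<sigma>(2)[of m] show ?thesis
      unfolding local_limit_def by (intro exI[of _ m]) (simp only: m simp_thms)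
  qed
  have evS: "\<forall>\<^sub>F p in sequentially \<times>\<^sub>F nhds \<zeta>. norm (X (\<sigma> (fst p)) (snd p) $ i) \<ge> 1 / 4"
    if "\<zeta> \<in> S m" "\<forall>\<^sub>F n in sequentially. \<forall>z\<in>S m. norm (X (\<sigma> n) z $ i) \<ge> 1 / 4" for \<zeta> m i
  proof -
    have "open (S m)" by (simp add: S_def)
    then have "\<forall>\<^sub>F p in sequentially \<times>\<^sub>F nhds \<zeta>. snd p \<in> S m"
      using eventually_compose_filterlim[OF eventually_nhds_in_open[OF _ that(1)] filterlim_snd] by blast
    moreover have "\<forall>\<^sub>F p in sequentially \<times>\<^sub>F nhds \<zeta>. \<forall>z\<in>S m. norm (X (\<sigma> (fst p)) z $ i) \<ge> 1 / 4"
      by (rule eventually_compose_filterlim[OF that(2) filterlim_fst])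
    ultimately show ?thesis by eventually_elim auto
  qed
  have "\<exists>x. proj_tendsto (\<lambda>p. X (\<sigma> (fst p)) (snd p)) x (sequentially \<times>\<^sub>F nhds \<zeta>)" for \<zeta>
  proof -
    obtain m i a where m: "\<zeta> \<in> S m" and i: "\<forall>\<^sub>F n in sequentially. \<forall>z\<in>S m. norm (X (\<sigma> n) z $ i) \<ge> 1 / 4"
      and a: "\<And>j. ((\<lambda>(n, z). X (\<sigma> n) z $ j / X (\<sigma> n) z $ i) \<longlongrightarrow> a j \<zeta>) (sequentially \<times>\<^sub>F nhds \<zeta>)"
      using data[of \<zeta>] by blast
    let ?F = "sequentially \<times>\<^sub>F nhds \<zeta>"
    have nz: "\<forall>\<^sub>F p in ?F. X (\<sigma> (fst p)) (snd p) $ i \<noteq> 0"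
      using evS[OF m i] by eventually_elim auto
    have a': "((\<lambda>p. X (\<sigma> (fst p)) (snd p) $ j / X (\<sigma> (fst p)) (snd p) $ i) \<longlongrightarrow> a j \<zeta>) ?F" for j
      using a[of j] by (simp add: case_prod_beta')
    have "((\<lambda>p. X (\<sigma> (fst p)) (snd p) $ i / X (\<sigma> (fst p)) (snd p) $ i) \<longlongrightarrow> 1) ?F"
      by (rule tendsto_eventually) (use nz in eventually_elim, simp)
    with a'[of i] have ai: "a i \<zeta> = 1" by (rule tendsto_unique[rotated]) simp
    define v where "v = (\<chi> j. a j \<zeta>)"
    have v: "v $ i = 1" using ai by (simp add: v_def)
    then have "v \<noteq> 0" by auto
    define x where "x = (1 / complex_of_real (norm v)) *s v"
    have xj: "x $ j = a j \<zeta> / norm v" for j by (simp add: x_def v_def)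
    have "norm x = 1"
    proof -
      have "norm (c *s v) = norm c * norm v" for c :: complex
        by (simp add: norm_vec_def L2_set_def norm_mult power_mult_distrib sum_distrib_left[symmetric]
            real_sqrt_mult)
      then show ?thesis using \<open>v \<noteq> 0\<close> by (simp add: x_def norm_divide)
    qed
    moreover have "x $ i \<noteq> 0" using \<open>v \<noteq> 0\<close> ai by (simp add: xj)
    moreover have "x $ j / x $ i = a j \<zeta>" for j using \<open>v \<noteq> 0\<close> ai by (simp add: xj)
    ultimately show ?thesis
      unfolding proj_tendsto_def using nz a' X(2) by (intro exI[of _ x]) auto
  qed
  then obtain X' where X': "\<And>\<zeta>. proj_tendsto (\<lambda>p. X (\<sigma> (fst p)) (snd p)) (X' \<zeta>) (sequentially \<times>\<^sub>F nhds \<zeta>)"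
    by metis
  have n1: "norm (X' z) = 1" for z using X'[of z] by (simp add: proj_tendsto_def)
  have chart: "X' \<zeta> $ i \<noteq> 0" "X' \<zeta> $ j / X' \<zeta> $ i = a j \<zeta>"
    if \<zeta>: "\<zeta> \<in> S m" and i: "\<forall>\<^sub>F n in sequentially. \<forall>z\<in>S m. norm (X (\<sigma> n) z $ i) \<ge> 1 / 4"
      and a: "\<And>j \<zeta>. \<zeta> \<in> S m \<Longrightarrow>
        ((\<lambda>(n, z). X (\<sigma> n) z $ j / X (\<sigma> n) z $ i) \<longlongrightarrow> a j \<zeta>) (sequentially \<times>\<^sub>F nhds \<zeta>)"
    for \<zeta> m i j and a :: "3 \<Rightarrow> complex \<Rightarrow> complex"
  proof -
    have "norm (X' \<zeta> $ i) \<ge> 1 / 4"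
      by (rule tendsto_lowerbound[OF proj_tendsto_norm(1)[OF X'] evS[OF \<zeta> i]]) simp
    then show nz: "X' \<zeta> $ i \<noteq> 0" by auto
    show "X' \<zeta> $ j / X' \<zeta> $ i = a j \<zeta>"
      using proj_tendsto_chart(2)[OF X' nz, of j] a[OF \<zeta>, of j]
      by (intro tendsto_unique[of "sequentially \<times>\<^sub>F nhds \<zeta>"]) (auto simp: case_prod_beta')
  qed
  have pc: "proj_curve X'"
    unfolding proj_curve_def
  proof (intro conjI allI impI)
    show "X' z \<noteq> 0" for z using n1[of z] by auto
    fix \<zeta> i' assume i': "X' \<zeta> $ i' \<noteq> 0"
    obtain m i a where m: "\<zeta> \<in> S m" and i: "\<forall>\<^sub>F n in sequentially. \<forall>z\<in>S m. norm (X (\<sigma> n) z $ i) \<ge> 1 / 4"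
      and a: "\<And>j. a j holomorphic_on S m" "\<And>j \<zeta>. \<zeta> \<in> S m \<Longrightarrow>
        ((\<lambda>(n, z). X (\<sigma> n) z $ j / X (\<sigma> n) z $ i) \<longlongrightarrow> a j \<zeta>) (sequentially \<times>\<^sub>F nhds \<zeta>)"
      using data[of \<zeta>] by blast
    note ch = chart(2)[OF _ i a(2)]
    have op: "open (S m)" by (simp add: S_def)
    have "a i' \<zeta> \<noteq> 0" using ch[OF m, of i'] chart(1)[OF m i a(2)] i' by auto
    then obtain r where r: "r > 0" "ball \<zeta> r \<subseteq> S m" "\<And>z. z \<in> ball \<zeta> r \<Longrightarrow> a i' z \<noteq> 0"
    proof -
      have "continuous_on (S m) (a i')" by (rule holomorphic_on_imp_continuous_on[OF a(1)])
      then have "isCont (a i') \<zeta>" using op m by (simp add: continuous_on_eq_continuous_at)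
      from continuous_at_avoid[OF this \<open>a i' \<zeta> \<noteq> 0\<close>] obtain e where e: "e > 0" "\<And>y. dist \<zeta> y < e \<Longrightarrow> a i' y \<noteq> 0"
        by blast
      obtain e' where e': "e' > 0" "ball \<zeta> e' \<subseteq> S m" using op m open_contains_ball by blast
      then have "ball \<zeta> (min e e') \<subseteq> S m" by (meson min.cobounded2 order_trans subset_ball)
      then show thesis using e e'(1) that[of "min e e'"] by auto
    qed
    have nz: "X' w $ i' \<noteq> 0" if "w \<in> ball \<zeta> r" for w
      using ch[of w i'] chart(1)[OF _ i a(2), of w] r(2) r(3)[OF that] that by auto
    moreover have "(\<lambda>w. X' w $ j / X' w $ i') holomorphic_on ball \<zeta> r" for j
    proof -
      have "(\<lambda>w. a j w / a i' w) holomorphic_on ball \<zeta> r"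
        using r by (intro holomorphic_intros holomorphic_on_subset[OF a(1)]) auto
      then show ?thesis
      proof (rule holomorphic_transform)
        fix w assume w: "w \<in> ball \<zeta> r"
        then have "w \<in> S m" using r(2) by blast
        then show "a j w / a i' w = X' w $ j / X' w $ i'"
          using ch[of w j] ch[of w i'] chart(1)[OF _ i a(2), of w] nz[OF w] by (auto simp: field_simps)
      qed
    qed
    ultimately show "\<exists>r>0. \<forall>j. (\<forall>w\<in>ball \<zeta> r. X' w $ i' \<noteq> 0) \<and> (\<lambda>w. X' w $ j / X' w $ i') holomorphic_on ball \<zeta> r"
      using r(1) by blast
  qed
  show thesis
  proof (rule that[OF \<sigma>(1) pc n1])
    show "proj_tendsto (\<lambda>(n, z). X (\<sigma> n) z) (X' \<zeta>) (sequentially \<times>\<^sub>F nhds \<zeta>)" for \<zeta>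
      using X'[of \<zeta>] by (simp add: case_prod_beta')
    fix \<zeta>
    obtain m i a where m: "\<zeta> \<in> S m" and i: "\<forall>\<^sub>F n in sequentially. \<forall>z\<in>S m. norm (X (\<sigma> n) z $ i) \<ge> 1 / 4"
      and a: "\<And>j. a j holomorphic_on S m" "\<And>j \<zeta>. \<zeta> \<in> S m \<Longrightarrow>
        ((\<lambda>(n, z). X (\<sigma> n) z $ j / X (\<sigma> n) z $ i) \<longlongrightarrow> a j \<zeta>) (sequentially \<times>\<^sub>F nhds \<zeta>)"
      and ty: "(\<exists>w. w holomorphic_on S m \<and> (\<forall>\<zeta>\<in>S m.
        ((\<lambda>(n, z). normal_coord q k (t (\<sigma> n)) i (X (\<sigma> n) z)) \<longlongrightarrow> w \<zeta>) (sequentially \<times>\<^sub>F nhds \<zeta>))) \<or>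
      ((\<forall>\<^sub>F n in sequentially. \<forall>z\<in>S m. peval (($) (X (\<sigma> n) z)) q \<noteq> 0) \<and> (\<forall>\<zeta>\<in>S m.
        filterlim (\<lambda>(n, z). normal_coord q k (t (\<sigma> n)) i (X (\<sigma> n) z)) at_infinity
          (sequentially \<times>\<^sub>F nhds \<zeta>)))"
      using data[of \<zeta>] by blast
    obtain r where r: "r > 0" "ball \<zeta> r \<subseteq> S m"
    proof -
      have "open (S m)" by (simp add: S_def)
      then show thesis using m that open_contains_ball by blast
    qed
    have nz: "\<forall>z\<in>ball \<zeta> r. X' z $ i \<noteq> 0" using chart(1)[OF _ i a(2)] r(2) by blast
    show "(\<exists>r i w. r > 0 \<and> (\<forall>z\<in>ball \<zeta> r. X' z $ i \<noteq> 0) \<and> w holomorphic_on ball \<zeta> r \<and> (\<forall>y\<in>ball \<zeta> r.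
          ((\<lambda>(n, z). normal_coord q k (t (\<sigma> n)) i (X (\<sigma> n) z)) \<longlongrightarrow> w y) (sequentially \<times>\<^sub>F nhds y))) \<or>
       (\<exists>r i. r > 0 \<and> (\<forall>z\<in>ball \<zeta> r. X' z $ i \<noteq> 0) \<and>
          (\<forall>\<^sub>F n in sequentially. \<forall>z\<in>ball \<zeta> r. X (\<sigma> n) z $ i \<noteq> 0 \<and> peval (($) (X (\<sigma> n) z)) q \<noteq> 0) \<and>
          (\<forall>y\<in>ball \<zeta> r. filterlim (\<lambda>(n, z). normal_coord q k (t (\<sigma> n)) i (X (\<sigma> n) z)) at_infinity
            (sequentially \<times>\<^sub>F nhds y)))"
      using ty
    proof (elim disjE exE conjE)
      fix w assume w: "w holomorphic_on S m" "\<forall>\<zeta>\<in>S m.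
        ((\<lambda>(n, z). normal_coord q k (t (\<sigma> n)) i (X (\<sigma> n) z)) \<longlongrightarrow> w \<zeta>) (sequentially \<times>\<^sub>F nhds \<zeta>)"
      show ?thesis
        by (intro disjI1 exI[of _ r] exI[of _ i] exI[of _ w] conjI r(1) nz holomorphic_on_subset[OF w(1) r(2)])
           (use w(2) r(2) in blast)
    next
      assume w: "\<forall>\<^sub>F n in sequentially. \<forall>z\<in>S m. peval (($) (X (\<sigma> n) z)) q \<noteq> 0" "\<forall>\<zeta>\<in>S m.
        filterlim (\<lambda>(n, z). normal_coord q k (t (\<sigma> n)) i (X (\<sigma> n) z)) at_infinity
          (sequentially \<times>\<^sub>F nhds \<zeta>)"
      have "\<forall>\<^sub>F n in sequentially. \<forall>z\<in>ball \<zeta> r. X (\<sigma> n) z $ i \<noteq> 0 \<and> peval (($) (X (\<sigma> n) z)) q \<noteq> 0"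
        using i w(1)
      proof eventually_elim
        case (elim n)
        show ?case
        proof
          fix z assume "z \<in> ball \<zeta> r"
          then have "z \<in> S m" using r(2) by blast
          then have "norm (X (\<sigma> n) z $ i) \<ge> 1 / 4" "peval (($) (X (\<sigma> n) z)) q \<noteq> 0" using elim by auto
          then show "X (\<sigma> n) z $ i \<noteq> 0 \<and> peval (($) (X (\<sigma> n) z)) q \<noteq> 0" by auto
        qed
      qed
      then show ?thesis
        by (intro disjI2 exI[of _ r] exI[of _ i] conjI r(1) nz) (use w(2) r(2) in blast)+
    qed
  qed
qed

section \<open>Entire curves in smooth plane curves\<close>

lemma monom_eval_scaled:
  "monom_eval (\<lambda>v. c * x v) \<alpha> = c ^ monom_degree \<alpha> * monom_eval x \<alpha>"
  by (simp add: monom_eval_def monom_degree_def power_mult_distrib prod.distrib power_sum)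

lemma peval_deriv_scaled:
  fixes p :: "('v::finite, 'a::comm_semiring_1) mpoly"
  assumes "p \<in> forms V d"
  shows "peval (\<lambda>v. c * x v) (mpoly_deriv v p) = c ^ (d - 1) * peval x (mpoly_deriv v p)"
  unfolding peval_deriv sum_distrib_left
proof (intro sum.cong refl)
  fix \<alpha> assume "\<alpha> \<in> Poly_Mapping.keys p"
  then have d: "monom_degree \<alpha> = d" using assms by (auto simp: forms_def)
  show "of_nat (Poly_Mapping.lookup \<alpha> v) * Poly_Mapping.lookup p \<alpha> *
      monom_eval (\<lambda>v. c * x v) (\<alpha> - Poly_Mapping.single v 1) =
    c ^ (d - 1) * (of_nat (Poly_Mapping.lookup \<alpha> v) * Poly_Mapping.lookup p \<alpha> *
      monom_eval x (\<alpha> - Poly_Mapping.single v 1))"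
  \<comment> \<open>If v does not occur in \<alpha>, both sides are 0; otherwise the subtraction
    lowers the degree by exactly 1.\<close>
  proof (cases "Poly_Mapping.lookup \<alpha> v = 0")
    case False
    have "monom_degree (\<alpha> - Poly_Mapping.single v 1) =
        (\<Sum>w\<in>UNIV. Poly_Mapping.lookup \<alpha> w - (if w = v then 1 else 0))"
      by (subst monom_degree_superset[of UNIV]) (auto simp: lookup_minus lookup_single when_def intro!: sum.cong)
    also have "\<dots> = (Poly_Mapping.lookup \<alpha> v - 1) + (\<Sum>w\<in>UNIV - {v}. Poly_Mapping.lookup \<alpha> w)"
      by (subst sum.remove[of UNIV v]) auto
    also have "\<dots> = monom_degree \<alpha> - 1"
      using False by (simp add: monom_degree_superset[of UNIV] sum.remove[of UNIV v "Poly_Mapping.lookup \<alpha>"])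
    finally show ?thesis by (simp add: monom_eval_scaled d mult_ac)
  qed simp
qed

definition cross :: "complex ^ 3 \<Rightarrow> complex ^ 3 \<Rightarrow> complex ^ 3" where
  "cross u v = vector [u $ 2 * v $ 3 - u $ 3 * v $ 2, u $ 3 * v $ 1 - u $ 1 * v $ 3, u $ 1 * v $ 2 - u $ 2 * v $ 1]"

text \<open>The cross product of two vectors that pair to 0 with g is parallel to g. Stating this
  through 2 by 2 minors avoids choosing a nonzero component of g.\<close>

lemma cross_parallel:
  fixes u v g :: "complex ^ 3"
  assumes "(\<Sum>j\<in>UNIV. u $ j * g $ j) = 0" "(\<Sum>j\<in>UNIV. v $ j * g $ j) = 0"
  shows "cross u v $ a * g $ b = cross u v $ b * g $ a"
proof -
  have u: "u $ 1 * g $ 1 + u $ 2 * g $ 2 + u $ 3 * g $ 3 = 0"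
    and v: "v $ 1 * g $ 1 + v $ 2 * g $ 2 + v $ 3 * g $ 3 = 0"
    using assms by (simp_all add: sum_3)
  have "\<forall>a b. cross u v $ a * g $ b = cross u v $ b * g $ a"
    unfolding forall_3 cross_def vector_3
  proof (intro conjI refl)
    show "(u $ 2 * v $ 3 - u $ 3 * v $ 2) * g $ 2 = (u $ 3 * v $ 1 - u $ 1 * v $ 3) * g $ 1" using u v by algebra
    then show "(u $ 3 * v $ 1 - u $ 1 * v $ 3) * g $ 1 = (u $ 2 * v $ 3 - u $ 3 * v $ 2) * g $ 2" by simp
    show "(u $ 2 * v $ 3 - u $ 3 * v $ 2) * g $ 3 = (u $ 1 * v $ 2 - u $ 2 * v $ 1) * g $ 1" using u v by algebra
    then show "(u $ 1 * v $ 2 - u $ 2 * v $ 1) * g $ 1 = (u $ 2 * v $ 3 - u $ 3 * v $ 2) * g $ 3" by simp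
    show "(u $ 3 * v $ 1 - u $ 1 * v $ 3) * g $ 3 = (u $ 1 * v $ 2 - u $ 2 * v $ 1) * g $ 2" using u v by algebra
    then show "(u $ 1 * v $ 2 - u $ 2 * v $ 1) * g $ 2 = (u $ 3 * v $ 1 - u $ 1 * v $ 3) * g $ 3" by simp
  qed
  then show ?thesis by blast
qed

text \<open>For a function c with derivative d, this is how the cross product of a lift and its
  derivative changes when the lift is multiplied by c.\<close>

lemma cross_scaled: "cross (c *s u) (d *s u + c *s v) = c\<^sup>2 *s cross u v"
  unfolding vec_eq_iff forall_3 cross_def by (simp add: vector_3 power2_eq_square algebra_simps)

lemma cross_zero_component:
  assumes "cross u v = 0" "u $ i = 1" "v $ i = 0"
  shows "v = 0"
proof -
  have "u $ 2 * v $ 3 = u $ 3 * v $ 2" "u $ 3 * v $ 1 = u $ 1 * v $ 3" "u $ 1 * v $ 2 = u $ 2 * v $ 1"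
    using assms(1) unfolding vec_eq_iff forall_3 cross_def vector_3 by auto
  then have "v $ 1 = 0 \<and> v $ 2 = 0 \<and> v $ 3 = 0"
    using assms(2,3) exhaust_3[of i] by auto
  then show ?thesis unfolding vec_eq_iff forall_3 by simp
qed

definition grad :: "ternary_poly \<Rightarrow> complex ^ 3 \<Rightarrow> complex ^ 3" where
  "grad q x = (\<chi> j. peval (($) x) (mpoly_deriv j q))"

lemma grad_scaled:
  assumes "q \<in> ternary_forms k"
  shows "grad q (c *s x) = c ^ (k - 1) *s grad q x"
proof -
  have "(($) (c *s x)) = (\<lambda>j. c * x $ j)" by (auto simp: fun_eq_iff)
  then show ?thesis
    by (simp add: grad_def vec_eq_iff peval_deriv_scaled[OF assms])
qed

definition chart_vec :: "(complex \<Rightarrow> complex ^ 3) \<Rightarrow> 3 \<Rightarrow> complex \<Rightarrow> complex ^ 3" where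
  "chart_vec X i z = (\<chi> j. X z $ j / X z $ i)"

definition chart_deriv :: "(complex \<Rightarrow> complex ^ 3) \<Rightarrow> 3 \<Rightarrow> complex \<Rightarrow> complex ^ 3" where
  "chart_deriv X i z = (\<chi> j. deriv (\<lambda>w. X w $ j / X w $ i) z)"

locale curve_in_smooth_curve =
  fixes q :: ternary_poly and k :: nat and X :: "complex \<Rightarrow> complex ^ 3"
  assumes smooth: "smooth_plane_curve k q" and k: "k \<ge> 4"
    and X: "proj_curve X" and in_curve: "\<And>z. peval (($) (X z)) q = 0"
begin

text \<open>
  The coefficient function of the pullback of the residue form, in the chart \<open>i\<close>. Multiplied by
  \<open>x\<^sub>j\<^sup>k\<^sup>-\<^sup>3 / x\<^sub>i\<^sup>k\<^sup>-\<^sup>3\<close> it gives the pullback of a holomorphic differential, which no longer depends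
  on \<open>i\<close>.
\<close>

definition res_coeff :: "3 \<Rightarrow> complex \<Rightarrow> complex" where
  "res_coeff i z = (THE h. cross (chart_vec X i z) (chart_deriv X i z) = h *s grad q (chart_vec X i z))"

lemma q: "q \<in> ternary_forms k" using smooth by (simp add: smooth_plane_curve_def)

lemma grad_nonzero: "x \<noteq> 0 \<Longrightarrow> peval (($) x) q = 0 \<Longrightarrow> grad q x \<noteq> 0"
  using smooth unfolding smooth_plane_curve_def mpoly_eval_eq_peval by (auto simp: grad_def vec_eq_iff)

lemma chart_ball:
  assumes "X z $ i \<noteq> 0"
  shows "\<exists>r>0. (\<forall>w\<in>ball z r. X w $ i \<noteq> 0) \<and> (\<forall>j. (\<lambda>w. X w $ j / X w $ i) holomorphic_on ball z r)"
  using X assms unfolding proj_curve_def by blast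

lemma chart_vec_in_curve:
  assumes "X z $ i \<noteq> 0"
  shows "peval (($) (chart_vec X i z)) q = 0" "chart_vec X i z $ i = 1" "chart_vec X i z \<noteq> 0"
proof -
  have "chart_vec X i z = (1 / X z $ i) *s X z" by (simp add: chart_vec_def vec_eq_iff)
  then show "peval (($) (chart_vec X i z)) q = 0"
    using peval_scaled[OF q] in_curve by simp
  show *: "chart_vec X i z $ i = 1" using assms by (simp add: chart_vec_def)
  then show "chart_vec X i z \<noteq> 0" by auto
qed

lemma chart_has_derivative:
  assumes "X z $ i \<noteq> 0"
  shows "((\<lambda>w. X w $ j / X w $ i) has_field_derivative chart_deriv X i z $ j) (at z)"
proof -
  obtain r where r': "r > 0" "\<forall>w\<in>ball z r. X w $ i \<noteq> 0"
    "\<forall>j. (\<lambda>w. X w $ j / X w $ i) holomorphic_on ball z r" using chart_ball[OF assms] by blast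
  note r = r'(1) r'(2)[rule_format] r'(3)[rule_format]
  show ?thesis
    unfolding chart_deriv_def vec_lambda_beta by (rule holomorphic_derivI[OF r(3) open_ball]) (simp add: r(1))
qed

text \<open>The first part is Euler's identity on q = 0, the second the derivative of q along the
  curve. With \<open>cross_parallel\<close> they show that the multiplier h in
  \<open>res_coeff\<close> exists.\<close>

lemma chart_orthogonal:
  assumes i: "X z $ i \<noteq> 0"
  shows "(\<Sum>j\<in>UNIV. chart_vec X i z $ j * grad q (chart_vec X i z) $ j) = 0"
    and "(\<Sum>j\<in>UNIV. chart_deriv X i z $ j * grad q (chart_vec X i z) $ j) = 0"
proof -
  show "(\<Sum>j\<in>UNIV. chart_vec X i z $ j * grad q (chart_vec X i z) $ j) = 0"
    using euler_identity[OF q, of "($) (chart_vec X i z)"] chart_vec_in_curve[OF i] by (simp add: grad_def)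
  obtain r where r': "r > 0" "\<forall>w\<in>ball z r. X w $ i \<noteq> 0"
    "\<forall>j. (\<lambda>w. X w $ j / X w $ i) holomorphic_on ball z r" using chart_ball[OF i] by blast
  note r = r'(1) r'(2)[rule_format] r'(3)[rule_format]
  have "((\<lambda>w. peval (\<lambda>j. X w $ j / X w $ i) q) has_field_derivative
      (\<Sum>v\<in>UNIV. peval (\<lambda>j. X z $ j / X z $ i) (mpoly_deriv v q) * chart_deriv X i z $ v)) (at z)"
    by (rule has_field_derivative_mpoly_eval) (rule chart_has_derivative[OF i])
  moreover have "((\<lambda>w. peval (\<lambda>j. X w $ j / X w $ i) q) has_field_derivative 0) (at z)"
  proof (rule has_field_derivative_transform_within_open[OF DERIV_const open_ball])
    show "z \<in> ball z r" using r by simp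
    fix w assume "w \<in> ball z r"
    then show "0 = peval (\<lambda>j. X w $ j / X w $ i) q"
      using r(2) in_curve by (simp add: peval_ratio[OF q])
  qed
  ultimately have "(\<Sum>v\<in>UNIV. peval (\<lambda>j. X z $ j / X z $ i) (mpoly_deriv v q) * chart_deriv X i z $ v) = 0"
    by (rule DERIV_unique)
  moreover have "(($) (chart_vec X i z)) = (\<lambda>j. X z $ j / X z $ i)" by (simp add: chart_vec_def fun_eq_iff)
  ultimately show "(\<Sum>j\<in>UNIV. chart_deriv X i z $ j * grad q (chart_vec X i z) $ j) = 0"
    by (simp add: grad_def mult.commute)
qed

lemma res_coeff_eq:
  assumes i: "X z $ i \<noteq> 0" and l: "grad q (chart_vec X i z) $ l \<noteq> 0"
  shows "cross (chart_vec X i z) (chart_deriv X i z) = res_coeff i z *s grad q (chart_vec X i z)"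
    and "res_coeff i z = cross (chart_vec X i z) (chart_deriv X i z) $ l / grad q (chart_vec X i z) $ l"
proof -
  let ?h = "cross (chart_vec X i z) (chart_deriv X i z) $ l / grad q (chart_vec X i z) $ l"
  have h: "cross (chart_vec X i z) (chart_deriv X i z) = ?h *s grad q (chart_vec X i z)"
    unfolding vec_eq_iff
    using cross_parallel[OF chart_orthogonal[OF i], of _ l] l by (auto simp: field_simps)
  have u: "h = ?h" if "cross (chart_vec X i z) (chart_deriv X i z) = h *s grad q (chart_vec X i z)" for h
    using that l by simp
  show eq: "res_coeff i z = ?h"
    unfolding res_coeff_def by (rule the_equality) (rule h, rule u)
  show "cross (chart_vec X i z) (chart_deriv X i z) = res_coeff i z *s grad q (chart_vec X i z)"
    unfolding eq by (rule h)
qed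

lemma grad_component:
  assumes "X z $ i \<noteq> 0"
  obtains l where "grad q (chart_vec X i z) $ l \<noteq> 0"
  using grad_nonzero[OF chart_vec_in_curve(3,1)[OF assms]] by (auto simp: vec_eq_iff)

text \<open>If c is the ratio of the two lifts, the cross product scales by c^2 and the gradient by
  c^(k-1). The coefficient therefore scales by c^(3-k), which the power of the coordinate
  compensates.\<close>

lemma res_coeff_chart_change:
  assumes i: "X z $ i \<noteq> 0" and i': "X z $ i' \<noteq> 0"
  shows "chart_vec X i z $ j ^ (k - 3) * res_coeff i z = chart_vec X i' z $ j ^ (k - 3) * res_coeff i' z"
proof -
  let ?A = "chart_vec X i z" and ?A' = "chart_vec X i' z"
  define c where "c = X z $ i / X z $ i'"
  have c: "c \<noteq> 0" using i i' by (simp add: c_def)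
  have A': "?A' = c *s ?A" using i by (simp add: chart_vec_def vec_eq_iff c_def)
  obtain r where r': "r > 0" "\<forall>w\<in>ball z r. X w $ i \<noteq> 0"
    "\<forall>j. (\<lambda>w. X w $ j / X w $ i) holomorphic_on ball z r" using chart_ball[OF i] by blast
  note r = r'(1) r'(2)[rule_format] r'(3)[rule_format]
  have d: "chart_deriv X i' z $ j = chart_deriv X i' z $ i * ?A $ j + c * chart_deriv X i z $ j" for j
  proof -
    have "((\<lambda>w. (X w $ i / X w $ i') * (X w $ j / X w $ i)) has_field_derivative
        (chart_deriv X i' z $ i * (X z $ j / X z $ i) + chart_deriv X i z $ j * (X z $ i / X z $ i'))) (at z)"
      by (rule DERIV_mult[OF chart_has_derivative[OF i'] chart_has_derivative[OF i]])
    then have "((\<lambda>w. X w $ j / X w $ i') has_field_derivative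
        (chart_deriv X i' z $ i * (X z $ j / X z $ i) + chart_deriv X i z $ j * (X z $ i / X z $ i'))) (at z)"
      by (rule has_field_derivative_transform_within_open[OF _ open_ball[of z r]]) (use r in auto)
    from DERIV_unique[OF chart_has_derivative[OF i'] this] show ?thesis
      by (simp add: chart_vec_def c_def mult.commute)
  qed
  have dA': "chart_deriv X i' z = chart_deriv X i' z $ i *s ?A + c *s chart_deriv X i z"
    unfolding vec_eq_iff vector_add_component vector_smult_component by (intro allI d)
  have cr: "cross ?A' (chart_deriv X i' z) = c\<^sup>2 *s cross ?A (chart_deriv X i z)"
    by (subst dA', subst A', rule cross_scaled)
  have gr: "grad q ?A' = c ^ (k - 1) *s grad q ?A" unfolding A' by (rule grad_scaled[OF q])
  obtain l where l: "grad q ?A $ l \<noteq> 0" using grad_component[OF i] by blast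
  then have l': "grad q ?A' $ l \<noteq> 0" using c by (simp add: gr)
  have "res_coeff i' z = c\<^sup>2 * res_coeff i z / c ^ (k - 1)"
    unfolding res_coeff_eq(2)[OF i l] res_coeff_eq(2)[OF i' l'] cr gr by simp
  moreover have "c ^ (k - 1) = c\<^sup>2 * c ^ (k - 3)"
  proof -
    have "k - 1 = 2 + (k - 3)" using k by simp
    then show ?thesis by (simp only: power_add)
  qed
  ultimately have "c ^ (k - 3) * res_coeff i' z = res_coeff i z" using c by simp
  then show ?thesis by (simp add: A' power_mult_distrib mult_ac)
qed

definition pulled_back_form :: "3 \<Rightarrow> complex \<Rightarrow> complex" where
  "pulled_back_form j z = (let i = (SOME i. X z $ i \<noteq> 0) in chart_vec X i z $ j ^ (k - 3) * res_coeff i z)"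

lemma pulled_back_form_eq:
  assumes "X z $ i \<noteq> 0"
  shows "pulled_back_form j z = chart_vec X i z $ j ^ (k - 3) * res_coeff i z"
  unfolding pulled_back_form_def Let_def
  by (rule res_coeff_chart_change[OF someI assms]) (rule assms)

lemma pulled_back_form_local:
  "\<exists>r i l. r > 0 \<and> (\<forall>w\<in>ball z r. X w $ i \<noteq> 0) \<and>
    (\<forall>w\<in>ball z r. grad q (chart_vec X i w) $ l \<noteq> 0) \<and>
    (\<forall>j. (\<lambda>w. X w $ j / X w $ i) holomorphic_on ball z r)"
proof -
  have "X z \<noteq> 0" using X by (auto simp: proj_curve_def)
  then obtain i where i: "X z $ i \<noteq> 0" by (auto simp: vec_eq_iff)
  obtain r where r': "r > 0" "\<forall>w\<in>ball z r. X w $ i \<noteq> 0"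
    "\<forall>j. (\<lambda>w. X w $ j / X w $ i) holomorphic_on ball z r" using chart_ball[OF i] by blast
  note r = r'(1) r'(2)[rule_format] r'(3)[rule_format]
  obtain l where l: "grad q (chart_vec X i z) $ l \<noteq> 0" using grad_component[OF i] by blast
  have hol: "(\<lambda>w. grad q (chart_vec X i w) $ l) holomorphic_on ball z r"
    unfolding grad_def vec_lambda_beta
    by (rule holomorphic_mpoly_eval) (simp add: chart_vec_def r(3))
  then have "isCont (\<lambda>w. grad q (chart_vec X i w) $ l) z"
    using r(1) holomorphic_on_imp_continuous_on[OF hol] by (simp add: continuous_on_eq_continuous_at)
  from continuous_at_avoid[OF this l] obtain e where
    e: "e > 0" "\<And>w. dist z w < e \<Longrightarrow> grad q (chart_vec X i w) $ l \<noteq> 0" by blast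
  have "(\<lambda>w. X w $ j / X w $ i) holomorphic_on ball z (min r e)" for j
    by (rule holomorphic_on_subset[OF r(3)]) auto
  then show ?thesis
    by (intro exI[of _ "min r e"] exI[of _ i] exI[of _ l]) (use r e in auto)
qed

lemma pulled_back_form_holomorphic: "pulled_back_form j holomorphic_on UNIV"
proof -
  have "pulled_back_form j field_differentiable (at z)" for z
  proof -
    obtain r i l where r': "r > 0" "\<forall>w\<in>ball z r. X w $ i \<noteq> 0"
      "\<forall>w\<in>ball z r. grad q (chart_vec X i w) $ l \<noteq> 0"
      "\<forall>j. (\<lambda>w. X w $ j / X w $ i) holomorphic_on ball z r" using pulled_back_form_local by blast
    note r = r'(1) r'(2)[rule_format] r'(3)[rule_format] r'(4)[rule_format]
    have hA: "(\<lambda>w. chart_vec X i w $ j) holomorphic_on ball z r" for j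
      by (simp add: chart_vec_def r(4))
    have hdA: "(\<lambda>w. chart_deriv X i w $ j) holomorphic_on ball z r" for j
      unfolding chart_deriv_def vec_lambda_beta by (rule holomorphic_deriv[OF r(4) open_ball])
    have hg: "(\<lambda>w. grad q (chart_vec X i w) $ l) holomorphic_on ball z r"
      unfolding grad_def vec_lambda_beta by (rule holomorphic_mpoly_eval) (rule hA)
    have "\<forall>l. (\<lambda>w. cross (chart_vec X i w) (chart_deriv X i w) $ l) holomorphic_on ball z r"
      unfolding forall_3 cross_def vector_3 by (intro conjI holomorphic_intros hA hdA)
    then have hc: "(\<lambda>w. cross (chart_vec X i w) (chart_deriv X i w) $ l) holomorphic_on ball z r" by blast
    have "(\<lambda>w. chart_vec X i w $ j ^ (k - 3) *
        (cross (chart_vec X i w) (chart_deriv X i w) $ l / grad q (chart_vec X i w) $ l)) holomorphic_on ball z r"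
      using r(3) by (intro holomorphic_intros hA hc hg) auto
    then have "pulled_back_form j holomorphic_on ball z r"
      by (rule holomorphic_transform) (simp add: pulled_back_form_eq[OF r(2)] res_coeff_eq(2)[OF r(2) r(3)])
    then show ?thesis using r(1) by (simp add: holomorphic_on_imp_differentiable_at)
  qed
  then show ?thesis unfolding holomorphic_on_def using field_differentiable_at_within by blast
qed

lemma norm_cross_le: "norm (cross u v) \<le> 6 * norm u * norm v"
proof -
  have c: "norm (u $ a * v $ b - u $ b * v $ a) \<le> 2 * norm u * norm v" for a b
  proof -
    have "norm (u $ a * v $ b - u $ b * v $ a) \<le> norm (u $ a) * norm (v $ b) + norm (u $ b) * norm (v $ a)"
      by (rule order_trans[OF norm_triangle_ineq4]) (simp add: norm_mult)
    also have "\<dots> \<le> norm u * norm v + norm u * norm v"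
      by (intro add_mono mult_mono Finite_Cartesian_Product.norm_nth_le) auto
    finally show ?thesis by simp
  qed
  have "norm (cross u v) \<le> (\<Sum>l\<in>UNIV. norm (cross u v $ l))"
    unfolding norm_vec_def by (rule L2_set_le_sum) simp
  also have "\<dots> \<le> 6 * norm u * norm v"
    unfolding sum_3 cross_def vector_3 using c[of 2 3] c[of 3 1] c[of 1 2] by linarith
  finally show ?thesis .
qed

text \<open>Compactness. A unit vector with 1/4 \<le> |x_i| has an affine vector of norm between 1
  and 4, and the gradient has no zero on the part of q = 0 in this shell.\<close>

lemma grad_lower_bound: "\<exists>\<delta>>0. \<forall>a. 1 \<le> norm a \<and> norm a \<le> 4 \<and> peval (($) a) q = 0 \<longrightarrow> norm (grad q a) \<ge> \<delta>"
proof -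
  have cont: "continuous_on UNIV (\<lambda>a::complex^3. peval (($) a) p)" for p :: ternary_poly
    unfolding continuous_on_def by (intro ballI tendsto_intros)
  define K where "K = {a::complex^3. 1 \<le> norm a} \<inter> cball 0 4 \<inter> {a. peval (($) a) q = 0}"
  have "closed {a::complex^3. 1 \<le> norm a}"
    by (intro closed_Collect_le continuous_intros)
  moreover have "closed {a::complex^3. peval (($) a) q = 0}"
    by (intro closed_Collect_eq cont continuous_intros)
  ultimately have "compact K"
    unfolding K_def by (metis closed_Int_compact compact_Int_closed compact_cball)
  show ?thesis
  proof (cases "K = {}")
    case True
    then show ?thesis by (intro exI[of _ 1]) (auto simp: K_def)
  next
    case False
    have "continuous_on UNIV (grad q)"
      unfolding grad_def by (intro continuous_on_vec_lambda cont)
    then have "continuous_on K (\<lambda>a. norm (grad q a))"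
      by (intro continuous_on_norm) (rule continuous_on_subset, auto)
    from continuous_attains_inf[OF \<open>compact K\<close> False this]
    obtain a0 where a0: "a0 \<in> K" "\<And>a. a \<in> K \<Longrightarrow> norm (grad q a0) \<le> norm (grad q a)" by blast
    have "a0 \<noteq> 0" "peval (($) a0) q = 0" using a0(1) by (auto simp: K_def)
    then have "norm (grad q a0) > 0" using grad_nonzero by simp
    then show ?thesis using a0(2) by (intro exI[of _ "norm (grad q a0)"]) (auto simp: K_def)
  qed
qed

text \<open>Liouville's theorem: on a ball of fixed radius that stays in one chart, Cauchy's
  estimate bounds the derivative of the affine vector, and the gradient is bounded away from
  0.\<close>

lemma pulled_back_form_constant:
  assumes n1: "\<And>z. norm (X z) = 1" and \<rho>: "\<rho> > 0"
    and idx: "\<And>\<zeta>. \<exists>i. \<forall>z\<in>ball \<zeta> \<rho>. norm (X z $ i) \<ge> 1 / 4"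
  shows "pulled_back_form j constant_on UNIV"
proof (rule Liouville_theorem[OF pulled_back_form_holomorphic])
  obtain \<delta> where \<delta>: "\<delta> > 0" "\<And>a. 1 \<le> norm a \<Longrightarrow> norm a \<le> 4 \<Longrightarrow> peval (($) a) q = 0 \<Longrightarrow> norm (grad q a) \<ge> \<delta>"
    using grad_lower_bound by blast
  \<comment> \<open>4 bounds the affine vector, 2 * 4 / \<rho> is Cauchy's bound for each of the 3
    components of its derivative, and 6 comes from \<open>norm_cross_le\<close>.\<close>
  have "norm (pulled_back_form j \<zeta>) \<le> 4 ^ (k - 3) * (6 * 4 * (3 * (2 * 4 / \<rho>)) / \<delta>)" for \<zeta>
  proof -
    obtain i where i: "\<And>z. z \<in> ball \<zeta> \<rho> \<Longrightarrow> norm (X z $ i) \<ge> 1 / 4" using idx by blast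
    have nz: "X z $ i \<noteq> 0" if "z \<in> ball \<zeta> \<rho>" for z using i[OF that] by auto
    have \<zeta>: "\<zeta> \<in> ball \<zeta> \<rho>" using \<rho> by simp
    let ?a = "chart_vec X i \<zeta>" and ?d = "chart_deriv X i \<zeta>"
    have na: "norm (chart_vec X i z) = 1 / norm (X z $ i)" if "z \<in> ball \<zeta> \<rho>" for z
      unfolding chart_vec_def using vec_norm_ratio[OF nz[OF that]] n1 by simp
    have le1: "norm (X z $ i) \<le> 1" for z using Finite_Cartesian_Product.norm_nth_le[of "X z" i] n1 by simp
    have na4: "norm (chart_vec X i z) \<le> 4" if "z \<in> ball \<zeta> \<rho>" for z
      using i[OF that] nz[OF that] unfolding na[OF that] by (simp add: field_simps)
    have na1: "norm ?a \<ge> 1" using le1[of \<zeta>] nz[OF \<zeta>] unfolding na[OF \<zeta>] by (simp add: field_simps)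
    have dj: "norm (?d $ l) \<le> 2 * 4 / \<rho>" for l
      unfolding chart_deriv_def vec_lambda_beta
    proof (rule deriv_bound_ball[OF _ _ \<rho>])
      show "(\<lambda>w. X w $ l / X w $ i) holomorphic_on ball \<zeta> \<rho>"
      proof -
        have "(\<lambda>w. X w $ l / X w $ i) field_differentiable (at z)" if z: "z \<in> ball \<zeta> \<rho>" for z
          using chart_has_derivative[OF nz[OF z], of l] field_differentiable_def by blast
        then show ?thesis unfolding holomorphic_on_def using field_differentiable_at_within by blast
      qed
      show "norm (X w $ l / X w $ i) \<le> 4" if "w \<in> ball \<zeta> \<rho>" for w
        using order_trans[OF Finite_Cartesian_Product.norm_nth_le na4[OF that], of l] by (simp add: chart_vec_def)
    qed
    have "norm ?d \<le> (\<Sum>l\<in>UNIV. norm (?d $ l))" unfolding norm_vec_def by (rule L2_set_le_sum) simp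
    also have "\<dots> \<le> 3 * (2 * 4 / \<rho>)" unfolding sum_3 using dj[of 1] dj[of 2] dj[of 3] by linarith
    finally have nd: "norm ?d \<le> 3 * (2 * 4 / \<rho>)" .
    obtain l where l: "grad q ?a $ l \<noteq> 0" using grad_component[OF nz[OF \<zeta>]] by blast
    have g\<delta>: "norm (grad q ?a) \<ge> \<delta>"
      using \<delta>(2)[OF na1 na4[OF \<zeta>]] chart_vec_in_curve(1)[OF nz[OF \<zeta>]] by blast
    have "norm (res_coeff i \<zeta>) * norm (grad q ?a) = norm (cross ?a ?d)"
      unfolding res_coeff_eq(1)[OF nz[OF \<zeta>] l] norm_scalar_mult by simp
    also have "\<dots> \<le> 6 * norm ?a * norm ?d" by (rule norm_cross_le)
    also have "\<dots> \<le> 6 * 4 * (3 * (2 * 4 / \<rho>))"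
      using na4[OF \<zeta>] nd by (intro mult_mono) auto
    finally have "norm (res_coeff i \<zeta>) * norm (grad q ?a) \<le> 6 * 4 * (3 * (2 * 4 / \<rho>))" .
    moreover have "norm (res_coeff i \<zeta>) * \<delta> \<le> norm (res_coeff i \<zeta>) * norm (grad q ?a)"
      using g\<delta> by (rule mult_left_mono) simp
    ultimately have "norm (res_coeff i \<zeta>) * \<delta> \<le> 6 * 4 * (3 * (2 * 4 / \<rho>))" by linarith
    then have nh: "norm (res_coeff i \<zeta>) \<le> 6 * 4 * (3 * (2 * 4 / \<rho>)) / \<delta>"
      using pos_le_divide_eq[OF \<delta>(1)] by blast
    have "norm (?a $ j) ^ (k - 3) \<le> 4 ^ (k - 3)"
      using order_trans[OF Finite_Cartesian_Product.norm_nth_le na4[OF \<zeta>]] by (rule power_mono) simp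
    then show ?thesis
      unfolding pulled_back_form_eq[OF nz[OF \<zeta>]] norm_mult norm_power
      using nh by (intro mult_mono) auto
  qed
  then show "bounded (range (pulled_back_form j))" by (auto simp: bounded_iff)
qed

text \<open>The i-th component of the affine vector in chart i is 1, so there the i-th form is the
  residue coefficient itself. If it is nonzero, dividing the other constant forms by it makes the
  (k-3)-th powers of the ratios constant, so the derivative of the affine vector vanishes and with
  it the residue coefficient. Hence this coefficient is always 0, the derivative is parallel to the
  affine vector, and it vanishes because its i-th component does.\<close>

theorem proj_curve_constant:
  assumes n1: "\<And>z. norm (X z) = 1" and \<rho>: "\<rho> > 0"
    and idx: "\<And>\<zeta>. \<exists>i. \<forall>z\<in>ball \<zeta> \<rho>. norm (X z $ i) \<ge> 1 / 4"
  shows "proj_const X"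
proof -
  have "\<exists>e. \<forall>j z. pulled_back_form j z = e j"
    using pulled_back_form_constant[OF assms] unfolding constant_on_def by (metis UNIV_I)
  then obtain e where e: "\<And>j z. pulled_back_form j z = e j" by blast
  have res0: "res_coeff i z = 0" if i: "X z $ i \<noteq> 0" for i z
  proof (rule ccontr)
    assume h: "res_coeff i z \<noteq> 0"
    obtain r where r': "r > 0" "\<forall>w\<in>ball z r. X w $ i \<noteq> 0"
      "\<forall>j. (\<lambda>w. X w $ j / X w $ i) holomorphic_on ball z r" using chart_ball[OF i] by blast
    note r = r'(1) r'(2)[rule_format] r'(3)[rule_format]
    have z: "z \<in> ball z r" using r by simp
    have ei: "e i = res_coeff i w" if "w \<in> ball z r" for w
      using pulled_back_form_eq[OF r(2)[OF that], of i] e chart_vec_in_curve(2)[OF r(2)[OF that]] by simp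
    then have "e i \<noteq> 0" using h z by metis
    have pw: "(X w $ j / X w $ i) ^ (k - 3) = e j / e i" if "w \<in> ball z r" for w j
      using pulled_back_form_eq[OF r(2)[OF that], of j] e[of j w] ei[OF that] \<open>e i \<noteq> 0\<close>
      by (simp add: chart_vec_def)
    have "chart_deriv X i z $ j = 0" for j
    proof (cases "X z $ j / X z $ i = 0")
      \<comment> \<open>The power rule says nothing where the ratio is 0; but there e_j = 0, and the
        ratio vanishes on the whole ball.\<close>
      case True
      have "k - 3 \<noteq> 0" using k by simp
      then have "e j / e i = 0" unfolding pw[OF z, of j, symmetric] True by simp
      then have "(X w $ j / X w $ i) ^ (k - 3) = 0" if "w \<in> ball z r" for w unfolding pw[OF that] .
      then have zero: "X w $ j / X w $ i = 0" if "w \<in> ball z r" for w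
        using that power_eq_0_iff[of "X w $ j / X w $ i" "k - 3"] by blast
      have "((\<lambda>w. X w $ j / X w $ i) has_field_derivative 0) (at z)"
        by (rule has_field_derivative_transform_within_open[OF DERIV_const[of 0] open_ball z])
           (use zero in simp)
      then show ?thesis using DERIV_unique[OF chart_has_derivative[OF i]] by blast
    next
      case False
      have "((\<lambda>w. (X w $ j / X w $ i) ^ (k - 3)) has_field_derivative
          of_nat (k - 3) * ((X z $ j / X z $ i) ^ (k - 3 - Suc 0) * chart_deriv X i z $ j)) (at z)"
        using DERIV_power[OF chart_has_derivative[OF i, of j], of "k - 3"] by (simp add: mult_ac)
      moreover have "((\<lambda>w. (X w $ j / X w $ i) ^ (k - 3)) has_field_derivative 0) (at z)"
        by (rule has_field_derivative_transform_within_open[OF DERIV_const[of "e j / e i"] open_ball z])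
           (use pw in simp)
      ultimately have "of_nat (k - 3) * ((X z $ j / X z $ i) ^ (k - 3 - Suc 0) * chart_deriv X i z $ j) = 0"
        by (rule DERIV_unique)
      moreover have "of_nat (k - 3) \<noteq> (0::complex)" using k by (subst of_nat_eq_0_iff) simp
      moreover have "(X z $ j / X z $ i) ^ (k - 3 - Suc 0) \<noteq> 0" using False by (intro power_not_zero)
      ultimately show ?thesis by (metis mult_eq_0_iff)
    qed
    then have "chart_deriv X i z = 0" by (simp add: vec_eq_iff)
    then have c0: "cross (chart_vec X i z) (chart_deriv X i z) $ l = 0" for l
      using exhaust_3[of l] by (auto simp: cross_def vector_3)
    obtain l where l: "grad q (chart_vec X i z) $ l \<noteq> 0" using grad_component[OF i] by blast
    show False using res_coeff_eq(2)[OF i l] c0 h by simp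
  qed
  have d0: "chart_deriv X i z = 0" if i: "X z $ i \<noteq> 0" for i z
  proof -
    obtain l where l: "grad q (chart_vec X i z) $ l \<noteq> 0" using grad_component[OF i] by blast
    obtain r where r: "r > 0" "\<forall>w\<in>ball z r. X w $ i \<noteq> 0" using chart_ball[OF i] by blast
    have "((\<lambda>w. X w $ i / X w $ i) has_field_derivative 0) (at z)"
      by (rule has_field_derivative_transform_within_open[OF DERIV_const[of 1] open_ball[of z r]])
         (use r in auto)
    then have "chart_deriv X i z $ i = 0" using DERIV_unique[OF chart_has_derivative[OF i]] by blast
    moreover have "cross (chart_vec X i z) (chart_deriv X i z) = 0"
      unfolding res_coeff_eq(1)[OF i l] res0[OF i] by simp
    ultimately show ?thesis
      using cross_zero_component[OF _ chart_vec_in_curve(2)[OF i]] by blast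
  qed
  \<comment> \<open>X itself may still vary by scalars, so local constancy is stated for the line
    spanned by X.\<close>
  define L where "L z = range (\<lambda>c. c *s X z)" for z
  have loc: "\<forall>\<^sub>F w in at z. L z = L w" for z
  proof -
    have "X z \<noteq> 0" using X by (auto simp: proj_curve_def)
    then obtain i where i: "X z $ i \<noteq> 0" by (auto simp: vec_eq_iff)
    obtain r where r': "r > 0" "\<forall>w\<in>ball z r. X w $ i \<noteq> 0" using chart_ball[OF i] by blast
    note r = r'(1) r'(2)[rule_format]
    have ratio: "X w $ j / X w $ i = X z $ j / X z $ i" if w: "w \<in> ball z r" for w j
    proof -
      have "\<exists>c. \<forall>w\<in>ball z r. X w $ j / X w $ i = c"
        by (rule has_field_derivative_zero_constant)
           (use chart_has_derivative[OF r(2), of _ j] d0[OF r(2)] in \<open>auto intro: DERIV_subset\<close>)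
      then show ?thesis using w r(1) by (metis centre_in_ball)
    qed
    have "L z = L w" if w: "w \<in> ball z r" for w
    proof -
      define c where "c = X w $ i / X z $ i"
      have c: "c \<noteq> 0" using i r(2)[OF w] by (simp add: c_def)
      have Xw: "X w = c *s X z"
        unfolding vec_eq_iff
      proof
        fix j show "X w $ j = (c *s X z) $ j"
          using ratio[OF w, of j] i r(2)[OF w] by (simp add: c_def field_simps)
      qed
      have "a *s X z = (a / c) *s X w" for a using c by (simp add: Xw)
      moreover have "a *s X w = (a * c) *s X z" for a by (simp add: Xw)
      ultimately show ?thesis unfolding L_def by blast
    qed
    then show ?thesis unfolding eventually_at using r(1) by (intro exI[of _ r]) (auto simp: dist_commute)
  qed
  show ?thesis
    unfolding proj_const_def
  proof
    fix z
    have "L z = L 0"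
      by (rule connected_local_const[of UNIV]) (use loc in auto)
    moreover have "X z \<in> L z" unfolding L_def by (rule range_eqI[of _ _ 1]) simp
    ultimately show "\<exists>c. X z = c *s X 0" unfolding L_def by auto
  qed
qed

end

section \<open>Entire curves in double covers\<close>

lemma proj_class_mem:
  assumes "x \<noteq> 0"
  shows "proj_rel `` {x} \<in> P2" "x' \<in> proj_rel `` {x} \<longleftrightarrow> (\<exists>c. c \<noteq> 0 \<and> x' = c *s x)"
proof -
  show "proj_rel `` {x} \<in> P2" unfolding P2_def by (rule quotientI) (use assms in simp)
  show "x' \<in> proj_rel `` {x} \<longleftrightarrow> (\<exists>c. c \<noteq> 0 \<and> x' = c *s x)"
    using assms by (auto simp: proj_rel_def)
qed

text \<open>Transfers the hyperbolicity hypothesis, which speaks of curves of equivalence classes,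
  to lifts.\<close>

lemma proj_const_if_hyperbolic_complement:
  assumes X: "proj_curve X" and nz: "\<And>z. peval (($) (X z)) q \<noteq> 0"
    and hyp: "brody_hyperbolic P2_atlas (P2 - plane_curve q)"
  shows "proj_const X"
proof -
  have X0: "X z \<noteq> 0" for z using X by (auto simp: proj_curve_def)
  define f where "f z = proj_rel `` {X z}" for z
  have fP2: "f z \<in> P2" and mem: "X z \<in> f z" for z
  proof -
    show "f z \<in> P2" unfolding f_def by (rule proj_class_mem(1)[OF X0])
    have "\<exists>c. c \<noteq> 0 \<and> X z = c *s X z" by (rule exI[of _ 1]) simp
    then show "X z \<in> f z" unfolding f_def proj_class_mem(2)[OF X0] .
  qed
  have "entire_curve P2_atlas f"
    unfolding entire_curve_def
  proof
    fix z
    obtain i where i: "X z $ i \<noteq> 0" using X0[of z] by (auto simp: vec_eq_iff)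
    obtain r where r: "r > 0" "\<And>w. w \<in> ball z r \<Longrightarrow> X w $ i \<noteq> 0"
      "\<And>j. (\<lambda>w. X w $ j / X w $ i) holomorphic_on ball z r"
      using X i unfolding proj_curve_def by blast
    have "x $ i \<noteq> 0" if "w \<in> ball z r" "x \<in> f w" for w x
      using that(2) r(2)[OF that(1)] unfolding f_def proj_class_mem(2)[OF X0] by auto
    then have sub: "f ` ball z r \<subseteq> {p \<in> P2. \<forall>x\<in>p. x $ i \<noteq> 0}"
      using fP2 by blast
    have hol: "((\<lambda>p. the_elem ((\<lambda>x. x $ j / x $ i) ` p)) \<circ> f) holomorphic_on ball z r" for j
      using r(3)[of j] by (rule holomorphic_transform) (simp add: P2_coordinate[OF fP2 mem])
    have "\<forall>\<phi>\<in>{\<lambda>p. the_elem ((\<lambda>x. x $ j / x $ i) ` p) | j. j \<noteq> i}. (\<phi> \<circ> f) holomorphic_on ball z r"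
      using hol by blast
    then show "\<exists>(U, \<Phi>)\<in>P2_atlas. \<exists>r>0. f ` ball z r \<subseteq> U \<and> (\<forall>\<phi>\<in>\<Phi>. (\<phi> \<circ> f) holomorphic_on ball z r)"
      unfolding P2_atlas_def
      by (intro bexI[of _ "P2_chart i"]) (use r(1) sub in \<open>auto simp: P2_chart_def intro!: exI[of _ r]\<close>)
  qed
  moreover have "range f \<subseteq> P2 - plane_curve q"
    using fP2 mem nz by (fastforce simp: plane_curve_def mpoly_eval_eq_peval)
  ultimately have "f constant_on UNIV" using hyp by (simp add: brody_hyperbolic_def)
  then have fz: "f z = f 0" for z unfolding constant_on_def by (metis UNIV_I)
  have "X z \<in> f 0" for z using mem[of z] by (simp only: fz[of z])
  then show ?thesis unfolding proj_const_def f_def proj_class_mem(2)[OF X0] by blast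
qed

text \<open>Y is the fibre coordinate relative to the lift X and need not be continuous. The
  equation for all scalings c allows passing to the affine lift. Nonconstancy is asked of X, since
  the reparametrisation only sees X.\<close>

definition cover_curve :: "nat \<Rightarrow> ternary_poly \<Rightarrow> (complex \<Rightarrow> complex ^ 3) \<Rightarrow> (complex \<Rightarrow> complex) \<Rightarrow> bool" where
  "cover_curve d G X Y \<longleftrightarrow> proj_curve X \<and> (\<forall>z. norm (X z) = 1) \<and> \<not> proj_const X \<and>
     (\<forall>z c. c \<noteq> 0 \<longrightarrow> (c ^ d * Y z)\<^sup>2 = peval (($) (c *s X z)) G) \<and>
     (\<forall>z i. X z $ i \<noteq> 0 \<longrightarrow> (\<lambda>w. Y w / X w $ i ^ d) field_differentiable (at z))"

lemma O_class_mem: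
  assumes "w \<in> O_total d" "(x, y) \<in> w"
  shows "x \<noteq> 0" "c \<noteq> 0 \<Longrightarrow> (c *s x, c ^ d * y) \<in> w" "w = O_rel d `` {(x, y)}"
proof -
  obtain x0 y0 where w: "w = O_rel d `` {(x0, y0)}" "x0 \<noteq> 0"
    using assms(1) unfolding O_total_def by (auto elim!: quotientE)
  have "((x0, y0), (x, y)) \<in> O_rel d" using assms(2) w by blast
  then obtain e where e: "e \<noteq> 0" "x = e *s x0" "y = e ^ d * y0" by (auto simp: O_rel_def)
  then show "x \<noteq> 0" using w by simp
  show "(c *s x, c ^ d * y) \<in> w" if "c \<noteq> 0"
  proof -
    have "((x0, y0), (c *s x, c ^ d * y)) \<in> O_rel d"
      unfolding O_rel_def using that e w(2)
      by (auto simp: power_mult_distrib intro!: exI[of _ "c * e"])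
    then show ?thesis using w by blast
  qed
  show "w = O_rel d `` {(x, y)}"
    unfolding w(1) using equiv_class_eq[OF equiv_O_rel \<open>((x0, y0), (x, y)) \<in> O_rel d\<close>] .
qed

text \<open>If X were projectively constant, the affine fibre coordinate would be an entire function
  with constant square, hence constant, and f would be constant too.\<close>

lemma cover_curve_of_entire_curve:
  assumes f: "entire_curve (O_atlas d) f" "range f \<subseteq> double_cover d G" "\<not> f constant_on UNIV"
  obtains X Y where "cover_curve d G X Y"
proof -
  have tot: "f z \<in> O_total d" for z using f(2) by (auto simp: double_cover_def)
  have "\<exists>p. p \<in> f z \<and> norm (fst p) = 1" for z
  proof -
    obtain x y where xy: "f z = O_rel d `` {(x, y)}" "x \<noteq> 0"
      using tot[of z] unfolding O_total_def by (auto elim!: quotientE)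
    have "((x, y), (x, y)) \<in> O_rel d" using xy(2) by (auto simp: O_rel_def intro!: exI[of _ 1])
    then have mem: "(x, y) \<in> f z" using xy by blast
    let ?c = "1 / complex_of_real (norm x)"
    have "(?c *s x, ?c ^ d * y) \<in> f z" using O_class_mem(2)[OF tot mem, of ?c] xy(2) by simp
    moreover have "norm (?c *s x) = 1" using xy(2) by (simp add: norm_scalar_mult norm_divide)
    ultimately show ?thesis by force
  qed
  then obtain p where p: "\<And>z. p z \<in> f z" "\<And>z. norm (fst (p z)) = 1" by metis
  define X where "X z = fst (p z)" for z
  define Y where "Y z = snd (p z)" for z
  have mem: "(X z, Y z) \<in> f z" and n1: "norm (X z) = 1" for z using p by (auto simp: X_def Y_def)
  have X0: "X z \<noteq> 0" for z using n1[of z] by auto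
  have chart: "\<exists>r>0. (\<forall>w\<in>ball z r. X w $ i \<noteq> 0) \<and> (\<forall>j. (\<lambda>w. X w $ j / X w $ i) holomorphic_on ball z r) \<and>
      (\<lambda>w. Y w / X w $ i ^ d) holomorphic_on ball z r" if i: "X z $ i \<noteq> 0" for z i
  proof -
    have "\<exists>C\<in>O_atlas d. \<exists>r>0. f ` ball z r \<subseteq> fst C \<and> (\<forall>\<phi>\<in>snd C. (\<phi> \<circ> f) holomorphic_on ball z r)"
      using spec[OF f(1)[unfolded entire_curve_def], of z] by (simp only: case_prod_beta')
    then obtain i0 r where r: "r > 0" "f ` ball z r \<subseteq> fst (O_chart d i0)"
      "\<forall>\<phi>\<in>snd (O_chart d i0). (\<phi> \<circ> f) holomorphic_on ball z r"
      unfolding O_atlas_def by blast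
    have nz: "X w $ i0 \<noteq> 0" if "w \<in> ball z r" for w
    proof -
      have "f w \<in> fst (O_chart d i0)" using r(2) that by blast
      then show ?thesis using mem[of w] by (auto simp: O_chart_def)
    qed
    have holj: "(\<lambda>w. X w $ j / X w $ i0) holomorphic_on ball z r" for j
    proof (cases "j = i0")
      case True
      have "(\<lambda>w. 1) holomorphic_on ball z r" by simp
      then show ?thesis by (rule holomorphic_transform) (use nz True in simp)
    next
      case False
      then have "((\<lambda>w. the_elem ((\<lambda>(x, y). x $ j / x $ i0) ` w)) \<circ> f) holomorphic_on ball z r"
        using r(3) by (auto simp: O_chart_def)
      then show ?thesis by (rule holomorphic_transform) (simp add: O_coordinate(1)[OF tot mem])
    qed
    have "((\<lambda>w. the_elem ((\<lambda>(x, y). y / x $ i0 ^ d) ` w)) \<circ> f) holomorphic_on ball z r"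
      using r(3) by (auto simp: O_chart_def)
    then have holY: "(\<lambda>w. Y w / X w $ i0 ^ d) holomorphic_on ball z r"
      by (rule holomorphic_transform) (simp add: O_coordinate(2)[OF tot mem])
    have z: "z \<in> ball z r" using r(1) by simp
    have "isCont (\<lambda>w. X w $ i / X w $ i0) z"
      using holomorphic_on_imp_continuous_on[OF holj] r(1) by (simp add: continuous_on_eq_continuous_at)
    moreover have "X z $ i / X z $ i0 \<noteq> 0" using i nz[OF z] by simp
    ultimately obtain e where e: "e > 0" "\<And>w. dist z w < e \<Longrightarrow> X w $ i / X w $ i0 \<noteq> 0"
      using continuous_at_avoid by blast
    let ?r = "min r e"
    have sub: "ball z ?r \<subseteq> ball z r" by auto
    have nzi: "X w $ i \<noteq> 0" if "w \<in> ball z ?r" for w using e(2)[of w] that by auto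
    note hs = holomorphic_on_subset[OF holj sub] holomorphic_on_subset[OF holY sub]
    have "(\<lambda>w. (X w $ j / X w $ i0) / (X w $ i / X w $ i0)) holomorphic_on ball z ?r" for j
      using e(2) by (intro holomorphic_on_divide hs) auto
    then have "(\<lambda>w. X w $ j / X w $ i) holomorphic_on ball z ?r" for j
      by (rule holomorphic_transform) (use nz in auto)
    moreover have "(\<lambda>w. (Y w / X w $ i0 ^ d) / (X w $ i / X w $ i0) ^ d) holomorphic_on ball z ?r"
      using e(2) by (intro holomorphic_on_divide holomorphic_on_power hs) auto
    then have "(\<lambda>w. Y w / X w $ i ^ d) holomorphic_on ball z ?r"
      by (rule holomorphic_transform) (use nz in \<open>auto simp: power_divide\<close>)
    ultimately show ?thesis using nzi r(1) e(1) by (intro exI[of _ ?r]) auto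
  qed
  have pc: "proj_curve X"
    unfolding proj_curve_def
  proof (intro conjI allI impI)
    show "X z \<noteq> 0" for z by (rule X0)
    show "\<exists>r>0. \<forall>j. (\<forall>w\<in>ball z r. X w $ i \<noteq> 0) \<and> (\<lambda>w. X w $ j / X w $ i) holomorphic_on ball z r"
      if "X z $ i \<noteq> 0" for z i using chart[OF that] by blast
  qed
  have sq: "(c ^ d * Y z)\<^sup>2 = peval (($) (c *s X z)) G" if "c \<noteq> 0" for z c
  proof -
    have "f z \<in> double_cover d G" using f(2) by blast
    then show ?thesis
      using O_class_mem(2)[OF tot mem that, of z] by (auto simp: double_cover_def mpoly_eval_eq_peval)
  qed
  have diffY: "(\<lambda>w. Y w / X w $ i ^ d) field_differentiable (at z)" if i: "X z $ i \<noteq> 0" for z i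
  proof -
    obtain r where "r > 0" "(\<lambda>w. Y w / X w $ i ^ d) holomorphic_on ball z r" using chart[OF i] by blast
    then show ?thesis by (simp add: holomorphic_on_imp_differentiable_at)
  qed
  have "\<not> proj_const X"
  proof
    assume "proj_const X"
    then obtain c where c: "\<And>z. X z = c z *s X 0" unfolding proj_const_def by metis
    have c0: "c z \<noteq> 0" for z using c[of z] X0[of z] by auto
    obtain i where i0: "X 0 $ i \<noteq> 0" using X0[of 0] by (auto simp: vec_eq_iff)
    have i: "X z $ i \<noteq> 0" for z
    proof -
      have "X z $ i = c z * X 0 $ i" using c[of z] by (metis vector_smult_component)
      then show ?thesis using i0 c0 by simp
    qed
    define b where "b w = Y w / X w $ i ^ d" for w
    define x where "x = (1 / X 0 $ i) *s X 0"
    have x: "(1 / X z $ i) *s X z = x" for z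
    proof -
      have "X z $ i = c z * X 0 $ i" using c[of z] by (metis vector_smult_component)
      then show ?thesis using c[of z] c0[of z] by (simp add: x_def vec_eq_iff)
    qed
    have b2: "(b z)\<^sup>2 = peval (($) x) G" for z
      using sq[of "1 / X z $ i" z] i[of z] unfolding x by (simp add: b_def power_divide)
    have "b holomorphic_on UNIV"
      unfolding holomorphic_on_def b_def using diffY[OF i] field_differentiable_at_within by blast
    moreover have "norm (b z) \<le> sqrt (norm (peval (($) x) G))" for z
      using b2[of z] by (intro real_le_rsqrt) (metis norm_power order_refl)
    then have "bounded (range b)" by (auto simp: bounded_iff)
    ultimately have "b constant_on UNIV" by (rule Liouville_theorem)
    then have b: "b z = b 0" for z unfolding constant_on_def by (metis UNIV_I)
    have cls: "f z = O_rel d `` {(x, b z)}" for z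
    proof -
      have "((1 / X z $ i) *s X z, (1 / X z $ i) ^ d * Y z) \<in> f z"
        by (rule O_class_mem(2)[OF tot mem]) (use i in simp)
      then have "(x, b z) \<in> f z" unfolding x by (simp add: b_def power_divide)
      then show ?thesis by (rule O_class_mem(3)[OF tot])
    qed
    have "f z = f 0" for z using cls[of z] cls[of 0] b[of z] by simp
    then have "f constant_on UNIV" unfolding constant_on_def by blast
    then show False using f(3) by simp
  qed
  then show thesis using that pc n1 sq diffY unfolding cover_curve_def by blast
qed

section \<open>Affine reparametrisation and tameness of a single curve\<close>

lemma proj_curve_affine:
  assumes "proj_curve X" "R \<noteq> 0"
  shows "proj_curve (\<lambda>w. X (a + R * w))"
  unfolding proj_curve_def
proof (intro conjI allI impI)
  show "X (a + R * z) \<noteq> 0" for z using assms(1) by (auto simp: proj_curve_def)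
  fix z i assume i: "X (a + R * z) $ i \<noteq> 0"
  then obtain r where r: "r > 0" "\<And>w. w \<in> ball (a + R * z) r \<Longrightarrow> X w $ i \<noteq> 0"
    "\<And>j. (\<lambda>w. X w $ j / X w $ i) holomorphic_on ball (a + R * z) r"
    using assms(1) unfolding proj_curve_def by blast
  let ?r = "r / norm R"
  have into: "a + R * w \<in> ball (a + R * z) r" if "w \<in> ball z ?r" for w
  proof -
    have "dist (a + R * z) (a + R * w) = norm R * dist z w"
      by (simp add: dist_norm norm_mult[symmetric] right_diff_distrib)
    then show ?thesis using that assms(2) by (simp add: pos_less_divide_eq mult.commute)
  qed
  have "(\<lambda>w. X (a + R * w) $ j / X (a + R * w) $ i) holomorphic_on ball z ?r" for j
  proof -
    have "(\<lambda>w. a + R * w) holomorphic_on ball z ?r" by (intro holomorphic_intros)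
    moreover have "(\<lambda>w. a + R * w) ` ball z ?r \<subseteq> ball (a + R * z) r" using into by blast
    ultimately show ?thesis using holomorphic_on_compose_gen[OF _ r(3)[of j]] by (simp only: o_def)
  qed
  then show "\<exists>r>0. \<forall>j. (\<forall>w\<in>ball z r. X (a + R * w) $ i \<noteq> 0) \<and>
      (\<lambda>w. X (a + R * w) $ j / X (a + R * w) $ i) holomorphic_on ball z r"
    using r(1,2) into assms(2) by (intro exI[of _ ?r]) auto
qed

lemma cover_curve_affine:
  assumes "cover_curve d G X Y" "R \<noteq> 0"
  shows "cover_curve d G (\<lambda>w. X (a + R * w)) (\<lambda>w. Y (a + R * w))"
proof -
  have X: "proj_curve X" "\<And>z. norm (X z) = 1" "\<not> proj_const X"
    and sq: "\<And>z c. c \<noteq> 0 \<Longrightarrow> (c ^ d * Y z)\<^sup>2 = peval (($) (c *s X z)) G"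
    and Y: "\<And>z i. X z $ i \<noteq> 0 \<Longrightarrow> (\<lambda>w. Y w / X w $ i ^ d) field_differentiable (at z)"
    using assms(1) unfolding cover_curve_def by blast+
  have "\<not> proj_const (\<lambda>w. X (a + R * w))"
  proof
    assume *: "proj_const (\<lambda>w. X (a + R * w))"
    have "\<exists>c. X z = c *s X 0" for z
    proof -
      have "a + R * ((z - a) / R) = z" for z using assms(2) by simp
      then obtain c c0 where c: "X z = c *s X a" "X 0 = c0 *s X a"
        using * unfolding proj_const_def by (metis mult_zero_right add.right_neutral)
      have "c0 \<noteq> 0" using c(2) X(2)[of 0] by auto
      then have "X z = (c / c0) *s X 0" by (simp add: c)
      then show ?thesis by blast
    qed
    then show False using X(3) by (simp add: proj_const_def)
  qed
  moreover have "(\<lambda>w. Y (a + R * w) / X (a + R * w) $ i ^ d) field_differentiable (at z)"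
    if "X (a + R * z) $ i \<noteq> 0" for z i
  proof -
    have "(\<lambda>w. a + R * w) field_differentiable (at z)"
      by (intro derivative_intros)
    from field_differentiable_compose[OF this Y[OF that]] show ?thesis by (simp add: o_def)
  qed
  ultimately show ?thesis
    using proj_curve_affine[OF X(1) assms(2)] X(2) sq unfolding cover_curve_def by blast
qed

lemma tame_mono: "tame q t X S \<Longrightarrow> S' \<subseteq> S \<Longrightarrow> tame q t X S'"
  unfolding tame_def by blast

lemma large_component:
  fixes x :: "complex ^ 3"
  assumes "norm x = 1"
  obtains i where "norm (x $ i) \<ge> 1 / 3"
proof -
  have "norm x \<le> (\<Sum>i\<in>UNIV. norm (x $ i))" unfolding norm_vec_def by (rule L2_set_le_sum) simp
  then have "1 \<le> norm (x $ 1) + norm (x $ 2) + norm (x $ 3)" using assms by (simp add: sum_3)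
  then have "norm (x $ 1) \<ge> 1 / 3 \<or> norm (x $ 2) \<ge> 1 / 3 \<or> norm (x $ 3) \<ge> 1 / 3" by linarith
  then show thesis using that by blast
qed

text \<open>A unit vector has a component of modulus at least 1/3 > 1/4, and at each point |q| < 2
  |t| or |q| > |t| / 2. These strict inequalities persist nearby.\<close>

lemma tame_local:
  assumes X: "proj_curve X" "\<And>z. norm (X z) = 1" and t: "t \<noteq> 0" and q: "q \<in> forms V k"
  shows "\<exists>r>0. tame q t X (ball z r)"
proof -
  note lim = proj_curve_tendsto[OF X, of z]
  obtain i where i: "norm (X z $ i) \<ge> 1 / 3" using large_component[OF X(2)] by blast
  have ev1: "\<forall>\<^sub>F w in nhds z. norm (X w $ i) > 1 / 4"
    by (rule order_tendstoD(1)[OF proj_tendsto_norm(1)[OF lim]]) (use i in simp)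
  have t0: "norm t > 0" using t by simp
  have ev2: "(\<forall>\<^sub>F w in nhds z. norm (peval (($) (X w)) q) < 2 * norm t) \<or>
      (\<forall>\<^sub>F w in nhds z. norm (peval (($) (X w)) q) > norm t / 2)"
  proof (cases "norm (peval (($) (X z)) q) < 2 * norm t")
    case True
    then show ?thesis using order_tendstoD(2)[OF proj_tendsto_norm(2)[OF lim q]] by blast
  next
    case False
    then have "norm (peval (($) (X z)) q) > norm t / 2" using t0 by linarith
    then show ?thesis using order_tendstoD(1)[OF proj_tendsto_norm(2)[OF lim q]] by blast
  qed
  then show ?thesis
  proof
    assume "\<forall>\<^sub>F w in nhds z. norm (peval (($) (X w)) q) < 2 * norm t"
    from eventually_conj[OF ev1 this] obtain r where r: "r > 0"
      "\<And>w. dist w z < r \<Longrightarrow> norm (X w $ i) > 1 / 4 \<and> norm (peval (($) (X w)) q) < 2 * norm t"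
      unfolding eventually_nhds_metric by blast
    have "tame q t X (ball z r)"
      unfolding tame_def
    proof (intro conjI disjI1 exI[of _ i] ballI)
      show "1 / 4 \<le> norm (X w $ i)" "norm (peval (($) (X w)) q) \<le> 2 * norm t" if "w \<in> ball z r" for w
        using r(2)[of w] that by (auto simp: dist_commute)
    qed
    then show ?thesis using r(1) by blast
  next
    assume "\<forall>\<^sub>F w in nhds z. norm (peval (($) (X w)) q) > norm t / 2"
    from eventually_conj[OF ev1 this] obtain r where r: "r > 0"
      "\<And>w. dist w z < r \<Longrightarrow> norm (X w $ i) > 1 / 4 \<and> norm (peval (($) (X w)) q) > norm t / 2"
      unfolding eventually_nhds_metric by blast
    have "tame q t X (ball z r)"
      unfolding tame_def
    proof (intro conjI disjI2 exI[of _ i] ballI)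
      show "1 / 4 \<le> norm (X w $ i)" "norm t \<le> 2 * norm (peval (($) (X w)) q)" if "w \<in> ball z r" for w
        using r(2)[of w] that by (auto simp: dist_commute)
    qed
    then show ?thesis using r(1) by blast
  qed
qed

text \<open>If all large balls were tame, one index i would serve infinitely many of them, and the
  ratios by the i-th coordinate would be bounded entire functions.\<close>

lemma tame_fails:
  assumes X: "proj_curve X" "\<And>z. norm (X z) = 1" "\<not> proj_const X"
  shows "\<exists>r>0. \<not> tame q t X (ball 0 r)"
proof (rule ccontr)
  assume "\<not> ?thesis"
  then have "\<forall>n. \<exists>i. \<forall>z\<in>ball 0 (real (Suc n)). norm (X z $ i) \<ge> 1 / 4"
    unfolding tame_def by (metis of_nat_0_less_iff zero_less_Suc)
  then obtain I where I: "\<And>n z. z \<in> ball 0 (real (Suc n)) \<Longrightarrow> norm (X z $ I n) \<ge> 1 / 4" by metis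
  have "\<exists>i. infinite {n. I n = i}"
  proof (rule ccontr)
    assume "\<not> ?thesis"
    then have "finite (\<Union>i\<in>UNIV. {n. I n = i})" by (intro finite_UN_I) auto
    moreover have "(\<Union>i\<in>UNIV. {n. I n = i}) = UNIV" by auto
    ultimately show False by simp
  qed
  then obtain i where i: "infinite {n. I n = i}" by blast
  have big: "norm (X z $ i) \<ge> 1 / 4" for z
  proof -
    obtain N where N: "norm z < real N" using reals_Archimedean2 by blast
    obtain n where "n \<ge> N" "I n = i" using i unfolding infinite_nat_iff_unbounded_le by blast
    then show ?thesis using I[of z n] N by simp
  qed
  have nz: "X z $ i \<noteq> 0" for z using big[of z] by auto
  have "(\<lambda>z. X z $ j / X z $ i) constant_on UNIV" for j
  proof (rule Liouville_theorem)
    show "(\<lambda>z. X z $ j / X z $ i) holomorphic_on UNIV"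
      by (rule proj_curve_holomorphic[OF X(1) open_UNIV nz])
    have "norm (X z $ j / X z $ i) \<le> 1 / (1 / 4)" for z
      unfolding norm_divide using big[of z] norm_component_le[of "X z" j] X(2) by (intro frac_le) auto
    then show "bounded (range (\<lambda>z. X z $ j / X z $ i))" by (auto simp: bounded_iff intro!: exI[of _ 4])
  qed
  then have ratio: "X z $ j / X z $ i = X 0 $ j / X 0 $ i" for z j
    unfolding constant_on_def by (metis UNIV_I)
  have "X z = (X z $ i / X 0 $ i) *s X 0" for z
    unfolding vec_eq_iff
  proof
    fix j show "X z $ j = ((X z $ i / X 0 $ i) *s X 0) $ j"
      using ratio[of z j] nz[of z] nz[of 0] by (simp add: field_simps)
  qed
  then have "proj_const X" unfolding proj_const_def by blast
  then show False using X(3) by simp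
qed

text \<open>The substitution w \<mapsto> z + R w turns the radii 2 R and R / 4 from
  \<open>good_failure_ball\<close> into 2 and 1/4, whatever R is.\<close>

lemma rescaled_cover_curve:
  assumes C: "cover_curve d G X Y" and t: "t \<noteq> 0" and q: "q \<in> forms V k" and L: "L > 0"
  obtains X' Y' where "cover_curve d G X' Y'" "\<not> tame q t X' (ball 0 2)"
    "\<And>c. norm c < L \<Longrightarrow> tame q t X' (ball c (1 / 4))"
proof -
  have X: "proj_curve X" "\<And>z. norm (X z) = 1" "\<not> proj_const X" using C by (auto simp: cover_curve_def)
  obtain r0 where r0: "r0 > 0" "\<not> tame q t X (ball 0 r0)" using tame_fails[OF X] by blast
  obtain z R where R: "R > 0" "\<not> tame q t X (ball z (2 * R))"
      "\<And>w. w \<in> ball z (L * R) \<Longrightarrow> tame q t X (ball w (R / 4))"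
  proof (rule good_failure_ball[of "tame q t X" 0 r0 L])
    show "tame q t X B" if "tame q t X A" "B \<subseteq> A" for A B using that by (rule tame_mono)
    show "\<exists>r>0. tame q t X (ball z r)" for z by (rule tame_local[OF X(1,2) t q])
    show "\<not> tame q t X (ball 0 r0)" "r0 > 0" "L > 0" by fact+
  qed (rule that; blast)
  let ?h = "\<lambda>w. z + complex_of_real R * w"
  have img: "?h ` ball c r = ball (?h c) (R * r)" for c r
  proof -
    have d: "dist (?h c) (?h w) = R * dist c w" for w
      using R(1) by (simp add: dist_norm norm_mult[symmetric] right_diff_distrib flip: norm_of_real)
         (simp add: norm_mult right_diff_distrib[symmetric])
    show ?thesis
    proof (intro equalityI subsetI)
      fix y assume "y \<in> ?h ` ball c r" then show "y \<in> ball (?h c) (R * r)" using d R(1) by auto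
    next
      fix y assume y: "y \<in> ball (?h c) (R * r)"
      have e: "y = ?h ((y - z) / R)" using R(1) by simp
      have "dist (?h c) (?h ((y - z) / R)) < R * r" using y by (subst e[symmetric]) simp
      then have "R * dist c ((y - z) / R) < R * r" unfolding d .
      then have "(y - z) / R \<in> ball c r" using R(1) by simp
      then show "y \<in> ?h ` ball c r" using e by blast
    qed
  qed
  have tm: "tame q t (\<lambda>w. X (?h w)) (ball c r) \<longleftrightarrow> tame q t X (ball (?h c) (R * r))" for c r
    unfolding img[symmetric] tame_def by simp
  show thesis
  proof (rule that)
    show "cover_curve d G (\<lambda>w. X (?h w)) (\<lambda>w. Y (?h w))" using C by (rule cover_curve_affine) (use R in simp)
    show "\<not> tame q t (\<lambda>w. X (?h w)) (ball 0 2)" unfolding tm using R(2) by (simp add: mult.commute)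
    fix c :: complex assume c: "norm c < L"
    have "norm (complex_of_real R * c) < L * R" using c R(1) by (simp add: norm_mult mult.commute)
    then have "?h c \<in> ball z (L * R)" by (simp add: dist_norm)
    then show "tame q t (\<lambda>w. X (?h w)) (ball c (1 / 4))" unfolding tm using R(3) by simp
  qed
qed

section \<open>Degenerating double covers\<close>

lemma frequently_lower_limit:
  fixes f :: "nat \<Rightarrow> real"
  assumes "\<exists>\<^sub>F n in sequentially. c \<le> f n" "f \<longlonglongrightarrow> L"
  shows "c \<le> L"
proof (rule ccontr)
  assume "\<not> c \<le> L"
  then have "\<forall>\<^sub>F n in sequentially. f n < c" using order_tendstoD(2)[OF assms(2)] by simp
  then have "\<forall>\<^sub>F n in sequentially. \<not> c \<le> f n" by eventually_elim simp
  then show False using assms(1) by (simp add: frequently_def)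
qed

text \<open>The chart and the side of tameness may change with n, but one choice occurs infinitely
  often, and weak inequalities that hold infinitely often survive a limit.\<close>

lemma limit_tame:
  assumes tame: "\<forall>\<^sub>F n in sequentially. tame q (t n) (X n) S" and t: "\<And>n. t n \<noteq> 0"
    and lim: "\<And>z i. z \<in> S \<Longrightarrow> (\<lambda>n. norm (X n z $ i)) \<longlonglongrightarrow> norm (X' z $ i)"
  shows "\<exists>i. \<forall>z\<in>S. 1 / 4 \<le> norm (X' z $ i)"
    and "(\<And>z. z \<in> S \<Longrightarrow> (\<lambda>n. norm (peval (($) (X n z)) q) / norm (t n)) \<longlonglongrightarrow> \<mu> z) \<Longrightarrow>
      (\<forall>z\<in>S. \<mu> z \<le> 2) \<or> (\<forall>z\<in>S. 1 / 2 \<le> \<mu> z)"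
proof -
  have "\<exists>i. \<exists>\<^sub>F n in sequentially. \<forall>z\<in>S. 1 / 4 \<le> norm (X n z $ i)"
  proof (rule ccontr)
    assume "\<not> ?thesis"
    then have "\<forall>\<^sub>F n in sequentially. \<forall>i\<in>UNIV. \<not> (\<forall>z\<in>S. 1 / 4 \<le> norm (X n z $ i))"
      by (subst eventually_ball_finite_distrib) (auto simp: frequently_def)
    with tame have "\<forall>\<^sub>F n in sequentially. False"
      by eventually_elim (auto simp: tame_def)
    then show False by simp
  qed
  then obtain i where i: "\<exists>\<^sub>F n in sequentially. \<forall>z\<in>S. 1 / 4 \<le> norm (X n z $ i)" by blast
  have "1 / 4 \<le> norm (X' z $ i)" if z: "z \<in> S" for z
  proof (rule frequently_lower_limit[OF _ lim[OF z]])
    show "\<exists>\<^sub>F n in sequentially. 1 / 4 \<le> norm (X n z $ i)"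
      using i by (rule frequently_elim1) (use z in blast)
  qed
  then show "\<exists>i. \<forall>z\<in>S. 1 / 4 \<le> norm (X' z $ i)" by blast
  assume \<mu>: "\<And>z. z \<in> S \<Longrightarrow> (\<lambda>n. norm (peval (($) (X n z)) q) / norm (t n)) \<longlonglongrightarrow> \<mu> z"
  have t0: "norm (t n) > 0" for n using t by simp
  have ev: "\<exists>\<^sub>F n in sequentially. (\<forall>z\<in>S. norm (peval (($) (X n z)) q) \<le> 2 * norm (t n)) \<or>
      (\<forall>z\<in>S. norm (t n) \<le> 2 * norm (peval (($) (X n z)) q))"
    by (rule eventually_frequently) (use tame in \<open>auto elim!: eventually_mono simp: tame_def\<close>)
  then show "(\<forall>z\<in>S. \<mu> z \<le> 2) \<or> (\<forall>z\<in>S. 1 / 2 \<le> \<mu> z)"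
    unfolding frequently_disj_iff
  proof
    assume *: "\<exists>\<^sub>F n in sequentially. \<forall>z\<in>S. norm (peval (($) (X n z)) q) \<le> 2 * norm (t n)"
    have "- 2 \<le> - \<mu> z" if z: "z \<in> S" for z
    proof (rule frequently_lower_limit[OF _ tendsto_minus[OF \<mu>[OF z]]])
      show "\<exists>\<^sub>F n in sequentially. - 2 \<le> - (norm (peval (($) (X n z)) q) / norm (t n))"
        using * by (rule frequently_elim1) (use z t0 in \<open>simp add: pos_divide_le_eq\<close>)
    qed
    then show ?thesis by auto
  next
    assume *: "\<exists>\<^sub>F n in sequentially. \<forall>z\<in>S. norm (t n) \<le> 2 * norm (peval (($) (X n z)) q)"
    have "1 / 2 \<le> \<mu> z" if z: "z \<in> S" for z
    proof (rule frequently_lower_limit[OF _ \<mu>[OF z]])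
      show "\<exists>\<^sub>F n in sequentially. 1 / 2 \<le> norm (peval (($) (X n z)) q) / norm (t n)"
        using * by (rule frequently_elim1) (use z t0 in \<open>auto simp: pos_le_divide_eq\<close>)
    qed
    then show ?thesis by auto
  qed
qed

lemma branch_poly_monic:
  assumes "m \<ge> 1"
  shows "degree (branch_poly m s F x) = m" "lead_coeff (branch_poly m s F x) = 1"
proof -
  let ?R = "\<Sum>i=1..m. monom (peval (\<lambda>j. peval (($) x) (s j)) (F i)) (m - i)"
  have R: "degree ?R < m"
    using assms by (intro le_less_trans[OF degree_sum_le[where n = "m - 1"]])
      (auto intro!: order.trans[OF degree_monom_le])
  then show d: "degree (branch_poly m s F x) = m"
    unfolding branch_poly_def by (subst degree_add_eq_left) (auto simp: degree_monom_eq)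
  show "lead_coeff (branch_poly m s F x) = 1"
    unfolding d using R by (simp add: branch_poly_def coeff_eq_0)
qed

text \<open>Substituting q = t w makes every term of the deformation divisible by t^(2 l), and
  dividing y by t^l absorbs this factor.\<close>

lemma deformation_square:
  assumes sq: "(c ^ (l * k) * y)\<^sup>2 = peval (($) (c *s x)) (deformation (2 * l) s q F t)"
    and c: "c = 1 / x $ i" "x $ i \<noteq> 0" and t: "t \<noteq> 0" and q: "q \<in> ternary_forms k"
  shows "(y / (x $ i ^ (l * k) * t ^ l))\<^sup>2 = poly (branch_poly (2 * l) s F (c *s x)) (normal_coord q k t i x)"
proof -
  let ?W = "normal_coord q k t i x"
  have cx: "(($) (c *s x)) = (\<lambda>j. x $ j / x $ i)" by (simp add: fun_eq_iff c(1))
  have qW: "peval (($) (c *s x)) q = t * ?W"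
    unfolding cx normal_coord_ratio[OF q c(2)] using t by simp
  have tp: "(t * ?W) ^ (2 * l - j) * t ^ j = t ^ (2 * l) * ?W ^ (2 * l - j)" if "j \<in> {1..2 * l}" for j
  proof -
    have "t ^ (2 * l) = t ^ (2 * l - j) * t ^ j" using that by (simp flip: power_add)
    then show ?thesis by (simp add: power_mult_distrib mult_ac)
  qed
  have "peval (($) (c *s x)) (deformation (2 * l) s q F t) = (t * ?W) ^ (2 * l) +
     (\<Sum>j=1..2 * l. peval (\<lambda>r. peval (($) (c *s x)) (s r)) (F j) * ((t * ?W) ^ (2 * l - j) * t ^ j))"
    by (simp add: peval_deformation qW mult.assoc)
  also have "\<dots> = t ^ (2 * l) * ?W ^ (2 * l) +
     (\<Sum>j=1..2 * l. peval (\<lambda>r. peval (($) (c *s x)) (s r)) (F j) * (t ^ (2 * l) * ?W ^ (2 * l - j)))"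
    using tp by (intro arg_cong2[of _ _ _ _ "(+)"] sum.cong) (auto simp: power_mult_distrib)
  also have "\<dots> = t ^ (2 * l) * poly (branch_poly (2 * l) s F (c *s x)) ?W"
    unfolding poly_branch_poly distrib_left sum_distrib_left
    by (intro arg_cong2[of _ _ _ _ "(+)"] sum.cong) (auto simp: mult_ac)
  finally have *: "(c ^ (l * k) * y)\<^sup>2 = t ^ (2 * l) * poly (branch_poly (2 * l) s F (c *s x)) ?W"
    using sq by simp
  have "(y / (x $ i ^ (l * k) * t ^ l))\<^sup>2 = (c ^ (l * k) * y)\<^sup>2 / t ^ (2 * l)"
    using c by (simp add: power_divide power_mult_distrib mult.commute flip: power_mult)
  then show ?thesis using * t by simp
qed

text \<open>The assumed limit of the component norms is the same at all \<zeta>, as for a constant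
  limit curve, so one index works on the compact ball of radius 2.\<close>

lemma eventually_tame_ball:
  assumes X': "norm (x::complex ^ 3) = 1"
    and lim: "\<And>\<zeta> i. ((\<lambda>p. norm (X (fst p) (snd p) $ i)) \<longlongrightarrow> norm (x $ i)) (sequentially \<times>\<^sub>F nhds \<zeta>)"
    and t: "\<And>n. t n \<noteq> 0"
    and \<mu>: "(\<forall>\<zeta>. \<forall>\<^sub>F p in sequentially \<times>\<^sub>F nhds \<zeta>. norm (peval (($) (X (fst p) (snd p))) q) / norm (t (fst p)) \<le> 2) \<or>
      (\<forall>\<zeta>. \<forall>\<^sub>F p in sequentially \<times>\<^sub>F nhds \<zeta>. 1 / 2 \<le> norm (peval (($) (X (fst p) (snd p))) q) / norm (t (fst p)))"
  shows "\<forall>\<^sub>F n in sequentially. tame q (t n) (X n) (ball 0 2)"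
proof -
  have t0: "norm (t n) > 0" for n using t by simp
  obtain i where i: "norm (x $ i) \<ge> 1 / 3" using large_component[OF X'] by blast
  have "\<forall>\<^sub>F p in sequentially \<times>\<^sub>F nhds \<zeta>. norm (X (fst p) (snd p) $ i) > 1 / 4" for \<zeta>
    by (rule order_tendstoD(1)[OF lim]) (use i in simp)
  from eventually_compact_uniform[OF compact_cball this, of 0 2]
  have 1: "\<forall>\<^sub>F n in sequentially. \<forall>z\<in>cball 0 2. norm (X n z $ i) > 1 / 4" by simp
  from \<mu> show ?thesis
  proof
    assume "\<forall>\<zeta>. \<forall>\<^sub>F p in sequentially \<times>\<^sub>F nhds \<zeta>. norm (peval (($) (X (fst p) (snd p))) q) / norm (t (fst p)) \<le> 2"
    from eventually_compact_uniform[OF compact_cball spec[OF this], of 0 2]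
    have "\<forall>\<^sub>F n in sequentially. \<forall>z\<in>cball 0 2. norm (peval (($) (X n z)) q) / norm (t n) \<le> 2" by simp
    with 1 show ?thesis
    proof eventually_elim
      case (elim n)
      have "norm (X n z $ i) \<ge> 1 / 4" "norm (peval (($) (X n z)) q) \<le> 2 * norm (t n)" if "z \<in> ball 0 2" for z
      proof -
        have z: "z \<in> cball 0 2" using that by simp
        show "norm (X n z $ i) \<ge> 1 / 4" using elim(1) z by force
        show "norm (peval (($) (X n z)) q) \<le> 2 * norm (t n)"
          using bspec[OF elim(2) z] t0[of n] by (simp add: pos_divide_le_eq)
      qed
      then show ?case unfolding tame_def by blast
    qed
  next
    assume "\<forall>\<zeta>. \<forall>\<^sub>F p in sequentially \<times>\<^sub>F nhds \<zeta>. 1 / 2 \<le> norm (peval (($) (X (fst p) (snd p))) q) / norm (t (fst p))"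
    from eventually_compact_uniform[OF compact_cball spec[OF this], of 0 2]
    have "\<forall>\<^sub>F n in sequentially. \<forall>z\<in>cball 0 2. 1 / 2 \<le> norm (peval (($) (X n z)) q) / norm (t n)" by simp
    with 1 show ?thesis
    proof eventually_elim
      case (elim n)
      have "norm (X n z $ i) \<ge> 1 / 4" "norm (t n) \<le> 2 * norm (peval (($) (X n z)) q)" if "z \<in> ball 0 2" for z
      proof -
        have z: "z \<in> cball 0 2" using that by simp
        show "norm (X n z $ i) \<ge> 1 / 4" using elim(1) z by force
        show "norm (t n) \<le> 2 * norm (peval (($) (X n z)) q)"
          using bspec[OF elim(2) z] t0[of n] by (simp add: pos_le_divide_eq)
      qed
      then show ?case unfolding tame_def by blast
    qed
  qed
qed

lemma proj_const_norms:
  assumes "proj_const X" "\<And>z. norm (X z) = 1"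
  shows "norm (X z $ i) = norm (X 0 $ i)" "X z $ j / X z $ i = X 0 $ j / X 0 $ i"
proof -
  obtain c where c: "X z = c *s X 0" using assms(1) by (auto simp: proj_const_def)
  then have "norm c = 1" using assms(2)[of z] assms(2)[of 0] by (simp add: norm_scalar_mult)
  then show "norm (X z $ i) = norm (X 0 $ i)" using c by (simp add: norm_mult)
  have "c \<noteq> 0" using \<open>norm c = 1\<close> by auto
  then show "X z $ j / X z $ i = X 0 $ j / X 0 $ i" using c by simp
qed

lemma tendsto_peval_vec:
  fixes x :: "complex ^ 3"
  assumes "\<And>j. ((\<lambda>p. Y p $ j) \<longlongrightarrow> x $ j) F"
  shows "((\<lambda>p. peval (($) (Y p)) f) \<longlongrightarrow> peval (($) x) f) F"
  by (intro tendsto_intros assms)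

lemma no_degenerating_cover_curves:
  fixes X :: "nat \<Rightarrow> complex \<Rightarrow> complex ^ 3" and t :: "nat \<Rightarrow> complex" and q :: ternary_poly
  assumes l: "l \<ge> 1" and k: "k \<ge> 4" and smooth: "smooth_plane_curve k q"
    and hyp: "brody_hyperbolic P2_atlas (P2 - plane_curve q)"
    and good: "\<not> bad_param (2 * l) s q F"
    and t: "\<And>n. t n \<noteq> 0" "t \<longlonglongrightarrow> 0"
    and C: "\<And>n. cover_curve (l * k) (deformation (2 * l) s q F (t n)) (X n) (Y n)"
    and tame: "\<And>c. \<forall>\<^sub>F n in sequentially. tame q (t n) (X n) (ball c (1 / 4))"
    and not_tame: "\<And>n. \<not> tame q (t n) (X n) (ball 0 2)"
  shows False
proof -
  have q: "q \<in> ternary_forms k" using smooth by (simp add: smooth_plane_curve_def)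
  have X: "\<And>n. proj_curve (X n)" "\<And>n z. norm (X n z) = 1" using C by (auto simp: cover_curve_def)
  obtain \<sigma> X' where \<sigma>: "strict_mono \<sigma>" and X': "proj_curve X'" "\<And>z. norm (X' z) = 1"
    and lim0: "\<And>\<zeta>. proj_tendsto (\<lambda>(n, z). X (\<sigma> n) z) (X' \<zeta>) (sequentially \<times>\<^sub>F nhds \<zeta>)"
    and types: "\<And>\<zeta>. (\<exists>r i w. r > 0 \<and> (\<forall>z\<in>ball \<zeta> r. X' z $ i \<noteq> 0) \<and> w holomorphic_on ball \<zeta> r \<and> (\<forall>y\<in>ball \<zeta> r.
          ((\<lambda>(n, z). normal_coord q k (t (\<sigma> n)) i (X (\<sigma> n) z)) \<longlongrightarrow> w y) (sequentially \<times>\<^sub>F nhds y))) \<or>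
       (\<exists>r i. r > 0 \<and> (\<forall>z\<in>ball \<zeta> r. X' z $ i \<noteq> 0) \<and>
          (\<forall>\<^sub>F n in sequentially. \<forall>z\<in>ball \<zeta> r. X (\<sigma> n) z $ i \<noteq> 0 \<and> peval (($) (X (\<sigma> n) z)) q \<noteq> 0) \<and>
          (\<forall>y\<in>ball \<zeta> r. filterlim (\<lambda>(n, z). normal_coord q k (t (\<sigma> n)) i (X (\<sigma> n) z)) at_infinity
            (sequentially \<times>\<^sub>F nhds y)))"
  proof (rule projective_limit[where X = X and t = t and q = q and k = k and \<rho> = "1 / 4"], goal_cases)
    case (1 n) show ?case by (rule X(1))
  next
    case (2 n z) show ?case by (rule X(2))
  next
    case (3 n) show ?case by (rule t(1))
  next
    case 4 show ?case by (rule q)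
  next
    case 5 show ?case by simp
  next
    case (6 c) show ?case by (rule tame)
  next
    case (7 \<sigma> X') show ?case by (rule 7(1)[OF 7(2-6)])
  qed
  define Z where "Z n = X (\<sigma> n)" for n
  define \<tau> where "\<tau> n = t (\<sigma> n)" for n
  let ?F = "\<lambda>\<zeta>. sequentially \<times>\<^sub>F nhds (\<zeta>::complex)"
  have Z: "\<And>n. proj_curve (Z n)" "\<And>n z. norm (Z n z) = 1" using X by (auto simp: Z_def)
  have \<tau>: "\<And>n. \<tau> n \<noteq> 0" "\<tau> \<longlonglongrightarrow> 0"
    using t(1) LIMSEQ_subseq_LIMSEQ[OF t(2) \<sigma>] \<tau>_def[abs_def] by (simp_all add: o_def)
  have lim: "proj_tendsto (\<lambda>p. Z (fst p) (snd p)) (X' \<zeta>) (?F \<zeta>)" for \<zeta>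
    using lim0[of \<zeta>] by (simp add: Z_def case_prod_beta')
  have fin_or_inf: "(\<exists>r i w. r > 0 \<and> (\<forall>z\<in>ball \<zeta> r. X' z $ i \<noteq> 0) \<and> w holomorphic_on ball \<zeta> r \<and> (\<forall>y\<in>ball \<zeta> r.
          ((\<lambda>p. normal_coord q k (\<tau> (fst p)) i (Z (fst p) (snd p))) \<longlongrightarrow> w y) (?F y))) \<or>
       (\<exists>r i. r > 0 \<and> (\<forall>z\<in>ball \<zeta> r. X' z $ i \<noteq> 0) \<and>
          (\<forall>\<^sub>F n in sequentially. \<forall>z\<in>ball \<zeta> r. Z n z $ i \<noteq> 0 \<and> peval (($) (Z n z)) q \<noteq> 0) \<and>
          (\<forall>y\<in>ball \<zeta> r. filterlim (\<lambda>p. normal_coord q k (\<tau> (fst p)) i (Z (fst p) (snd p))) at_infinity (?F y)))" for \<zeta>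
    using types[of \<zeta>] unfolding case_prod_beta' Z_def \<tau>_def .
  \<comment> \<open>The modulus of q / t on unit lifts. It is the modulus of the normal coordinate
    up to the factor |x_i|^k, but does not depend on a chart.\<close>
  define M where "M p = norm (peval (($) (Z (fst p) (snd p))) q) / norm (\<tau> (fst p))" for p
  have comp: "((\<lambda>p. norm (Z (fst p) (snd p) $ i)) \<longlongrightarrow> norm (X' \<zeta> $ i)) (?F \<zeta>)" for i \<zeta>
    by (rule proj_tendsto_norm(1)[OF lim])
  have Mev: "\<forall>\<^sub>F p in ?F \<zeta>. norm (normal_coord q k (\<tau> (fst p)) i (Z (fst p) (snd p))) * norm (Z (fst p) (snd p) $ i) ^ k = M p"
    if i: "X' \<zeta> $ i \<noteq> 0" for \<zeta> i
    using proj_tendsto_chart(1)[OF lim i] by eventually_elim (simp add: M_def normal_coord_def norm_divide norm_mult norm_power)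
  have Mfin: "(M \<longlongrightarrow> norm w * norm (X' \<zeta> $ i) ^ k) (?F \<zeta>)"
    if i: "X' \<zeta> $ i \<noteq> 0" and w: "((\<lambda>p. normal_coord q k (\<tau> (fst p)) i (Z (fst p) (snd p))) \<longlongrightarrow> w) (?F \<zeta>)" for \<zeta> i w
    by (rule Lim_transform_eventually[OF _ Mev[OF i]]) (intro tendsto_intros w comp)
  have Minf: "filterlim M at_top (?F \<zeta>)"
    if i: "X' \<zeta> $ i \<noteq> 0" and w: "filterlim (\<lambda>p. normal_coord q k (\<tau> (fst p)) i (Z (fst p) (snd p))) at_infinity (?F \<zeta>)" for \<zeta> i
  proof -
    have "filterlim (\<lambda>p. norm (Z (fst p) (snd p) $ i) ^ k *
        norm (normal_coord q k (\<tau> (fst p)) i (Z (fst p) (snd p)))) at_top (?F \<zeta>)"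
      by (rule filterlim_tendsto_pos_mult_at_top[OF tendsto_power[OF comp[of i \<zeta>]]])
         (use i filterlim_compose[OF filterlim_norm_at_top w] in auto)
    then have "filterlim (\<lambda>p. norm (normal_coord q k (\<tau> (fst p)) i (Z (fst p) (snd p))) *
        norm (Z (fst p) (snd p) $ i) ^ k) at_top (?F \<zeta>)" by (simp add: mult.commute)
    then show ?thesis by (rule filterlim_cong[OF refl refl Mev[OF i], THEN iffD1])
  qed
  \<comment> \<open>The limit inherits from the curves that balls of radius 1/4 stay in one chart,
    as needed for bounding the differentials.\<close>
  have rigid: "proj_const X'" if "\<And>z. peval (($) (X' z)) q = 0"
  proof -
    interpret curve_in_smooth_curve q k X' by unfold_locales (use smooth k X' that in auto)
    show ?thesis
    proof (rule proj_curve_constant[OF X'(2)])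
      show "(1 / 4 :: real) > 0" by simp
      fix \<zeta>
      have "\<forall>\<^sub>F n in sequentially. tame q (\<tau> n) (Z n) (ball \<zeta> (1 / 4))"
        unfolding Z_def \<tau>_def using eventually_compose_filterlim[OF tame filterlim_subseq[OF \<sigma>]] .
      then show "\<exists>i. \<forall>z\<in>ball \<zeta> (1 / 4). 1 / 4 \<le> norm (X' z $ i)"
      proof (rule limit_tame(1)[OF _ \<tau>(1)])
        show "(\<lambda>n. norm (Z n z $ i)) \<longlonglongrightarrow> norm (X' z $ i)" for z i
          using tendsto_prod_nhds_pointwise[of "\<lambda>n z. norm (Z n z $ i)" _ z] comp[of i z]
          by (simp add: case_prod_beta')
      qed
    qed
  qed
  \<comment> \<open>The common source of contradiction: a constant limit with M on one side makes
    late curves tame on \<open>ball 0 2\<close>.\<close>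
  have contra: False if "proj_const X'"
    "(\<forall>\<zeta>. \<forall>\<^sub>F p in ?F \<zeta>. M p \<le> 2) \<or> (\<forall>\<zeta>. \<forall>\<^sub>F p in ?F \<zeta>. 1 / 2 \<le> M p)"
  proof -
    have "\<forall>\<^sub>F n in sequentially. tame q (\<tau> n) (Z n) (ball 0 2)"
    proof (rule eventually_tame_ball[OF X'(2)[of 0] _ \<tau>(1)])
      show "((\<lambda>p. norm (Z (fst p) (snd p) $ i)) \<longlongrightarrow> norm (X' 0 $ i)) (?F \<zeta>)" for \<zeta> i
        using comp[of i \<zeta>] proj_const_norms(1)[OF that(1) X'(2), of \<zeta> i] by simp
    qed (use that(2) in \<open>simp add: M_def\<close>)
    then show False using not_tame by (auto simp: Z_def \<tau>_def eventually_sequentially)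
  qed
  \<comment> \<open>Finiteness of the limit of M and its failure are both open conditions on
    \<zeta>, so one of them holds everywhere by connectedness.\<close>
  define Fin where "Fin \<zeta> \<longleftrightarrow> (\<exists>L. (M \<longlongrightarrow> L) (?F \<zeta>))" for \<zeta>
  have not_both: "\<not> Fin \<zeta>" if "filterlim M at_top (?F \<zeta>)" for \<zeta>
    unfolding Fin_def
    using not_tendsto_and_filterlim_at_infinity[OF prod_nhds_nontrivial _ filterlim_at_top_imp_at_infinity[OF that]]
    by blast
  have locF: "\<forall>\<^sub>F y in at \<zeta>. Fin \<zeta> = Fin y" for \<zeta>
    using fin_or_inf[of \<zeta>]
  proof (elim disjE exE conjE)
    fix r i w assume *: "r > 0" "\<forall>z\<in>ball \<zeta> r. X' z $ i \<noteq> 0" "\<forall>y\<in>ball \<zeta> r.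
          ((\<lambda>p. normal_coord q k (\<tau> (fst p)) i (Z (fst p) (snd p))) \<longlongrightarrow> w y) (?F y)"
    have "Fin y" if "y \<in> ball \<zeta> r" for y
      unfolding Fin_def using Mfin[OF bspec[OF *(2) that] bspec[OF *(3) that]] by blast
    then show ?thesis
      using *(1) unfolding eventually_at by (intro exI[of _ r]) (auto simp: dist_commute)
  next
    fix r i assume *: "r > 0" "\<forall>z\<in>ball \<zeta> r. X' z $ i \<noteq> 0" "\<forall>y\<in>ball \<zeta> r.
          filterlim (\<lambda>p. normal_coord q k (\<tau> (fst p)) i (Z (fst p) (snd p))) at_infinity (?F y)"
    have "\<not> Fin y" if "y \<in> ball \<zeta> r" for y
      by (rule not_both[OF Minf[OF bspec[OF *(2) that] bspec[OF *(3) that]]])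
    then show ?thesis
      using *(1) unfolding eventually_at by (intro exI[of _ r]) (auto simp: dist_commute)
  qed
  have all: "Fin \<zeta> = Fin 0" for \<zeta>
    by (rule connected_local_const[of UNIV]) (use locF in auto)
  show False
  proof (cases "Fin 0")
    case False
    have inf: "\<exists>r i. r > 0 \<and> (\<forall>z\<in>ball \<zeta> r. X' z $ i \<noteq> 0) \<and>
          (\<forall>\<^sub>F n in sequentially. \<forall>z\<in>ball \<zeta> r. Z n z $ i \<noteq> 0 \<and> peval (($) (Z n z)) q \<noteq> 0) \<and>
          (\<forall>y\<in>ball \<zeta> r. filterlim (\<lambda>p. normal_coord q k (\<tau> (fst p)) i (Z (fst p) (snd p))) at_infinity (?F y))" for \<zeta>
      using fin_or_inf[of \<zeta>]
    proof (elim disjE exE conjE)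
      fix r i w assume *: "r > 0" "\<forall>z\<in>ball \<zeta> r. X' z $ i \<noteq> 0" "\<forall>y\<in>ball \<zeta> r.
            ((\<lambda>p. normal_coord q k (\<tau> (fst p)) i (Z (fst p) (snd p))) \<longlongrightarrow> w y) (?F y)"
      have \<zeta>: "\<zeta> \<in> ball \<zeta> r" using *(1) by simp
      have "Fin \<zeta>" unfolding Fin_def using Mfin[OF bspec[OF *(2) \<zeta>] bspec[OF *(3) \<zeta>]] by blast
      then show ?thesis using all False by blast
    qed blast
    have top: "filterlim M at_top (?F \<zeta>)" for \<zeta>
    proof -
      obtain r i where *: "r > 0" "\<forall>z\<in>ball \<zeta> r. X' z $ i \<noteq> 0" "\<forall>y\<in>ball \<zeta> r.
          filterlim (\<lambda>p. normal_coord q k (\<tau> (fst p)) i (Z (fst p) (snd p))) at_infinity (?F y)"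
        using inf[of \<zeta>] by blast
      have \<zeta>: "\<zeta> \<in> ball \<zeta> r" using *(1) by simp
      show ?thesis by (rule Minf[OF bspec[OF *(2) \<zeta>] bspec[OF *(3) \<zeta>]])
    qed
    \<comment> \<open>Hurwitz's theorem for q in an affine chart, where the curves have no zeros of
      q.\<close>
    have locz: "\<forall>\<^sub>F y in at \<zeta>. (peval (($) (X' \<zeta>)) q = 0) = (peval (($) (X' y)) q = 0)" for \<zeta>
    proof -
      obtain r i where r: "r > 0" "\<forall>z\<in>ball \<zeta> r. X' z $ i \<noteq> 0"
          "\<forall>\<^sub>F n in sequentially. \<forall>z\<in>ball \<zeta> r. Z n z $ i \<noteq> 0 \<and> peval (($) (Z n z)) q \<noteq> 0"
        using inf[of \<zeta>] by blast
      let ?h = "\<lambda>V z. peval (\<lambda>j. V z $ j / V z $ i) q"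
      have "(\<forall>z\<in>ball \<zeta> r. ?h X' z \<noteq> 0) \<or> (\<forall>z\<in>ball \<zeta> r. ?h X' z = 0)"
      proof (rule Hurwitz_prod_nhds[of "ball \<zeta> r" "\<lambda>n. ?h (Z n)"])
        show "\<forall>\<^sub>F n in sequentially. ?h (Z n) holomorphic_on ball \<zeta> r \<and> (\<forall>z\<in>ball \<zeta> r. ?h (Z n) z \<noteq> 0)"
          using r(3)
        proof eventually_elim
          case (elim n)
          have nz: "Z n z $ i \<noteq> 0" "peval (($) (Z n z)) q \<noteq> 0" if "z \<in> ball \<zeta> r" for z using elim that by auto
          show ?case
            using nz by (auto intro!: holomorphic_mpoly_eval proj_curve_holomorphic[OF Z(1)] simp: peval_ratio[OF q])
        qed
        show "?h X' holomorphic_on ball \<zeta> r"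
          by (intro holomorphic_mpoly_eval proj_curve_holomorphic[OF X'(1)]) (use r(2) in auto)
        show "((\<lambda>(n, w). ?h (Z n) w) \<longlongrightarrow> ?h X' z) (?F z)" if "z \<in> ball \<zeta> r" for z
          unfolding case_prod_beta' by (intro tendsto_peval proj_tendsto_chart(2)[OF lim bspec[OF r(2) that]])
      qed auto
      moreover have "?h X' z = 0 \<longleftrightarrow> peval (($) (X' z)) q = 0" if "z \<in> ball \<zeta> r" for z
        using r(2) that by (simp add: peval_ratio[OF q])
      ultimately have "(\<forall>z\<in>ball \<zeta> r. peval (($) (X' z)) q \<noteq> 0) \<or> (\<forall>z\<in>ball \<zeta> r. peval (($) (X' z)) q = 0)"
        by blast
      then have "(peval (($) (X' \<zeta>)) q = 0) = (peval (($) (X' y)) q = 0)" if "y \<in> ball \<zeta> r" for y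
        using that r(1) by (metis centre_in_ball)
      then show ?thesis
        using r(1) unfolding eventually_at by (intro exI[of _ r]) (auto simp: dist_commute)
    qed
    have allz: "(peval (($) (X' \<zeta>)) q = 0) = (peval (($) (X' 0)) q = 0)" for \<zeta>
      by (rule connected_local_const[of UNIV]) (use locz in auto)
    have "proj_const X'"
    proof (cases "peval (($) (X' 0)) q = 0")
      case True
      then show ?thesis using allz by (intro rigid) blast
    next
      case False
      then show ?thesis using allz by (intro proj_const_if_hyperbolic_complement[OF X'(1) _ hyp]) blast
    qed
    then show False
    proof (rule contra)
      show "(\<forall>\<zeta>. \<forall>\<^sub>F p in ?F \<zeta>. M p \<le> 2) \<or> (\<forall>\<zeta>. \<forall>\<^sub>F p in ?F \<zeta>. 1 / 2 \<le> M p)"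
        using top unfolding filterlim_at_top by blast
    qed
  next
    case True
    then have fin: "Fin \<zeta>" for \<zeta> using all by blast
    have FinD: "\<exists>r i w. r > 0 \<and> (\<forall>z\<in>ball \<zeta> r. X' z $ i \<noteq> 0) \<and> w holomorphic_on ball \<zeta> r \<and> (\<forall>y\<in>ball \<zeta> r.
          ((\<lambda>p. normal_coord q k (\<tau> (fst p)) i (Z (fst p) (snd p))) \<longlongrightarrow> w y) (?F y))" for \<zeta>
      using fin_or_inf[of \<zeta>]
    proof (elim disjE exE conjE)
      fix r i assume *: "r > 0" "\<forall>z\<in>ball \<zeta> r. X' z $ i \<noteq> 0" "\<forall>y\<in>ball \<zeta> r.
          filterlim (\<lambda>p. normal_coord q k (\<tau> (fst p)) i (Z (fst p) (snd p))) at_infinity (?F y)"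
      have \<zeta>: "\<zeta> \<in> ball \<zeta> r" using *(1) by simp
      show ?thesis using not_both[OF Minf[OF bspec[OF *(2) \<zeta>] bspec[OF *(3) \<zeta>]]] fin by blast
    qed blast
    \<comment> \<open>q = (q / t) t, where q / t stays bounded and t tends to 0.\<close>
    have zero: "peval (($) (X' \<zeta>)) q = 0" for \<zeta>
    proof -
      obtain L where L: "(M \<longlongrightarrow> L) (?F \<zeta>)" using fin by (auto simp: Fin_def)
      have "((\<lambda>p. M p * norm (\<tau> (fst p))) \<longlongrightarrow> L * norm (0::complex)) (?F \<zeta>)"
        by (intro tendsto_intros L filterlim_compose[OF \<tau>(2) filterlim_fst])
      moreover have "M p * norm (\<tau> (fst p)) = norm (peval (($) (Z (fst p) (snd p))) q)" for p
        using \<tau>(1) by (simp add: M_def)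
      ultimately have "((\<lambda>p. norm (peval (($) (Z (fst p) (snd p))) q)) \<longlongrightarrow> 0) (?F \<zeta>)" by simp
      then show ?thesis
        using tendsto_unique[OF prod_nhds_nontrivial proj_tendsto_norm(2)[OF lim q]] by fastforce
    qed
    have const: "proj_const X'" by (rule rigid[OF zero])
    note norms = proj_const_norms[OF const X'(2)]
    \<comment> \<open>The limit curve is constant, so this single chart serves all \<zeta>.\<close>
    obtain i where i0: "norm (X' 0 $ i) \<ge> 1 / 3" using large_component[OF X'(2)] by blast
    then have xi: "X' 0 $ i \<noteq> 0" by auto
    have i: "X' \<zeta> $ i \<noteq> 0" for \<zeta> using norms(1)[of \<zeta> i] xi by auto
    let ?W = "\<lambda>p. normal_coord q k (\<tau> (fst p)) i (Z (fst p) (snd p))"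
    have local: "\<exists>r u. r > 0 \<and> u holomorphic_on ball \<zeta> r \<and> (\<forall>y\<in>ball \<zeta> r. (?W \<longlongrightarrow> u y) (?F y))" for \<zeta>
    proof -
      obtain r j w where r: "r > 0" "\<forall>z\<in>ball \<zeta> r. X' z $ j \<noteq> 0" "w holomorphic_on ball \<zeta> r"
        "\<forall>y\<in>ball \<zeta> r. ((\<lambda>p. normal_coord q k (\<tau> (fst p)) j (Z (fst p) (snd p))) \<longlongrightarrow> w y) (?F y)"
        using FinD[of \<zeta>] by blast
      \<comment> \<open>Normal coordinates in the charts i and j differ by the k-th power of a
        coordinate ratio, whose limit is constant.\<close>
      let ?c = "(X' 0 $ j / X' 0 $ i) ^ k"
      have "(?W \<longlongrightarrow> w y * ?c) (?F y)" if y: "y \<in> ball \<zeta> r" for y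
      proof -
        have j: "X' y $ j \<noteq> 0" using r(2) y by blast
        have "((\<lambda>p. normal_coord q k (\<tau> (fst p)) j (Z (fst p) (snd p)) *
            (Z (fst p) (snd p) $ j / Z (fst p) (snd p) $ i) ^ k) \<longlongrightarrow> w y * (X' y $ j / X' y $ i) ^ k) (?F y)"
          using r(4) y by (intro tendsto_intros proj_tendsto_chart(2)[OF lim i]) blast
        then have "((\<lambda>p. normal_coord q k (\<tau> (fst p)) j (Z (fst p) (snd p)) *
            (Z (fst p) (snd p) $ j / Z (fst p) (snd p) $ i) ^ k) \<longlongrightarrow> w y * ?c) (?F y)"
          by (simp only: norms(2)[of y j i])
        then show ?thesis
        proof (rule Lim_transform_eventually)
          show "\<forall>\<^sub>F p in ?F y. normal_coord q k (\<tau> (fst p)) j (Z (fst p) (snd p)) *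
            (Z (fst p) (snd p) $ j / Z (fst p) (snd p) $ i) ^ k = ?W p"
            using proj_tendsto_chart(1)[OF lim j] proj_tendsto_chart(1)[OF lim i[of y]]
            by eventually_elim (simp add: normal_coord_def power_divide)
        qed
      qed
      then show ?thesis
        using r(1) holomorphic_on_mult[OF r(3) holomorphic_on_const[of ?c]] by blast
    qed
    have "\<exists>u. (?W \<longlongrightarrow> u) (?F \<zeta>)" for \<zeta> using local[of \<zeta>] centre_in_ball[of \<zeta>] by blast
    then have "\<forall>\<zeta>. \<exists>u. (?W \<longlongrightarrow> u) (?F \<zeta>)" by (rule allI)
    from choice[OF this] obtain U where "\<forall>\<zeta>. (?W \<longlongrightarrow> U \<zeta>) (?F \<zeta>)" by (rule exE)
    then have U: "\<And>\<zeta>. (?W \<longlongrightarrow> U \<zeta>) (?F \<zeta>)" by (rule spec)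
    have holU: "U holomorphic_on UNIV"
    proof -
      have "U field_differentiable (at \<zeta>)" for \<zeta>
      proof -
        obtain r u where r: "r > 0" "u holomorphic_on ball \<zeta> r" "\<forall>y\<in>ball \<zeta> r. (?W \<longlongrightarrow> u y) (?F y)"
          using local by blast
        have "u y = U y" if "y \<in> ball \<zeta> r" for y
          using tendsto_unique[OF prod_nhds_nontrivial bspec[OF r(3) that] U] .
        then have "U holomorphic_on ball \<zeta> r" using r(2) by (rule holomorphic_transform[rotated])
        then show ?thesis using r(1) by (simp add: holomorphic_on_imp_differentiable_at)
      qed
      then show ?thesis unfolding holomorphic_on_def using field_differentiable_at_within by blast
    qed
    \<comment> \<open>Converts between M and the normal coordinate in chart i: M tends to |U|
      e.\<close>
    define e where "e = norm (X' 0 $ i) ^ k"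
    have e: "e > 0" using xi by (simp add: e_def)
    have MU: "(M \<longlongrightarrow> norm (U \<zeta>) * e) (?F \<zeta>)" for \<zeta>
      unfolding e_def norms(1)[of \<zeta> i, symmetric] by (rule Mfin[OF i U])
    define a where "a = (1 / X' 0 $ i) *s X' 0"
    have aj: "a $ j = X' \<zeta> $ j / X' \<zeta> $ i" for j \<zeta> unfolding norms(2)[of \<zeta> j i] by (simp add: a_def)
    have a0: "a \<noteq> 0" using xi by (simp add: a_def vector_mul_eq_0) (metis zero_index)
    have qa: "peval (($) a) q = 0" unfolding a_def peval_scaled[OF q] zero by simp
    let ?p = "branch_poly (2 * l) s F a"
    have "\<not> degenerate_fibre ?p" using good a0 qa by (auto simp: bad_param_def)
    moreover have "lead_coeff ?p = 1" "degree ?p = 2 * l" using branch_poly_monic[of "2 * l" s F a] l by auto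
    moreover have "\<exists>V. V holomorphic_on ball 0 R \<and> (\<forall>z\<in>ball 0 R. (V z)\<^sup>2 = poly ?p (U z))" if R: "R > 0" for R
    proof -
      \<comment> \<open>The fibre coordinate of the covers in chart i, rescaled by t^l as in
        \<open>deformation_square\<close>.\<close>
      define V where "V n z = Y (\<sigma> n) z / (Z n z $ i ^ (l * k) * \<tau> n ^ l)" for n z
      have Vsq: "(V n z)\<^sup>2 = poly (branch_poly (2 * l) s F ((1 / Z n z $ i) *s Z n z)) (normal_coord q k (\<tau> n) i (Z n z))"
        if "Z n z $ i \<noteq> 0" for n z
        unfolding V_def
      proof (rule deformation_square[OF _ refl that \<tau>(1) q])
        show "((1 / Z n z $ i) ^ (l * k) * Y (\<sigma> n) z)\<^sup>2 = peval (($) ((1 / Z n z $ i) *s Z n z)) (deformation (2 * l) s q F (\<tau> n))"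
          using C[of "\<sigma> n"] that unfolding cover_curve_def Z_def \<tau>_def by simp
      qed
      have Vlim: "((\<lambda>p. (V (fst p) (snd p))\<^sup>2) \<longlongrightarrow> poly ?p (U \<zeta>)) (?F \<zeta>)" for \<zeta>
      proof -
        have "((\<lambda>p. ((1 / Z (fst p) (snd p) $ i) *s Z (fst p) (snd p)) $ j) \<longlongrightarrow> a $ j) (?F \<zeta>)" for j
          unfolding aj[of j \<zeta>] using proj_tendsto_chart(2)[OF lim i, of j \<zeta>] by simp
        note lims = tendsto_peval_vec[OF this]
        have "((\<lambda>p. poly (branch_poly (2 * l) s F ((1 / Z (fst p) (snd p) $ i) *s Z (fst p) (snd p))) (?W p))
            \<longlongrightarrow> poly ?p (U \<zeta>)) (?F \<zeta>)"
          unfolding poly_branch_poly by (intro tendsto_intros lims U)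
        then show ?thesis
          by (rule Lim_transform_eventually)
             (use proj_tendsto_chart(1)[OF lim i[of \<zeta>]] in eventually_elim, simp add: Vsq)
      qed
      have "continuous_on (cball 0 R) (\<lambda>z. poly ?p (U z))"
        by (intro continuous_intros holomorphic_on_imp_continuous_on holomorphic_on_subset[OF holU]) auto
      then have "bounded ((\<lambda>z. poly ?p (U z)) ` cball 0 R)"
        by (intro compact_imp_bounded compact_continuous_image compact_cball)
      then obtain B where B: "\<And>z. z \<in> cball 0 R \<Longrightarrow> norm (poly ?p (U z)) \<le> B"
        unfolding bounded_iff by blast
      have "\<forall>\<^sub>F n in sequentially. \<forall>z\<in>cball 0 R. (\<lambda>p. Z (fst p) (snd p) $ i \<noteq> 0 \<and> norm ((V (fst p) (snd p))\<^sup>2) < B + 1) (n, z)"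
      proof (rule eventually_compact_uniform[OF compact_cball])
        fix z :: complex assume z: "z \<in> cball 0 R"
        show "\<forall>\<^sub>F p in ?F z. Z (fst p) (snd p) $ i \<noteq> 0 \<and> norm ((V (fst p) (snd p))\<^sup>2) < B + 1"
          using B[OF z] by (intro eventually_conj proj_tendsto_chart(1)[OF lim i] order_tendstoD(2)[OF tendsto_norm[OF Vlim]]) simp
      qed
      then obtain N where N: "\<And>n z. n \<ge> N \<Longrightarrow> z \<in> cball 0 R \<Longrightarrow> Z n z $ i \<noteq> 0 \<and> norm ((V n z)\<^sup>2) < B + 1"
        unfolding eventually_sequentially fst_conv snd_conv by blast
      \<comment> \<open>For n \<ge> N chart i is available on the ball and the squares are bounded
        there. Only the squares are known to converge; Montel's theorem yields a root of the limit
        along a subsequence that may depend on R.\<close>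
      define f where "f n = V (n + N)" for n
      have holf: "f n holomorphic_on ball 0 R" for n
      proof -
        have "(\<lambda>w. Y (\<sigma> (n + N)) w / Z (n + N) w $ i ^ (l * k)) holomorphic_on ball 0 R"
          unfolding holomorphic_on_def
        proof
          fix z :: complex assume "z \<in> ball 0 R"
          then have "X (\<sigma> (n + N)) z $ i \<noteq> 0" using N[of "n + N" z] by (simp add: Z_def)
          then show "(\<lambda>w. Y (\<sigma> (n + N)) w / Z (n + N) w $ i ^ (l * k)) field_differentiable (at z within ball 0 R)"
            using C[of "\<sigma> (n + N)"] unfolding cover_curve_def Z_def by (blast intro: field_differentiable_at_within)
        qed
        then have "(\<lambda>w. Y (\<sigma> (n + N)) w / Z (n + N) w $ i ^ (l * k) / \<tau> (n + N) ^ l) holomorphic_on ball 0 R"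
          by (rule holomorphic_on_divide[OF _ holomorphic_on_const]) (use \<tau>(1) in simp)
        then show ?thesis unfolding f_def V_def by simp
      qed
      have bf: "norm (f n z) \<le> sqrt (B + 1)" if "z \<in> ball 0 R" for n z
      proof (rule real_le_rsqrt)
        show "(norm (f n z))\<^sup>2 \<le> B + 1"
          using N[of "n + N" z] that by (simp add: f_def norm_power)
      qed
      obtain g r where g: "g holomorphic_on ball 0 R" "strict_mono (r :: nat \<Rightarrow> nat)"
          "\<And>x. x \<in> ball 0 R \<Longrightarrow> ((\<lambda>n. f (r n) x) \<longlongrightarrow> g x) sequentially"
        by (rule Montel[of "ball 0 R" "range f" f]) (use holf bf in \<open>auto intro!: exI[of _ "sqrt (B + 1)"]\<close>)
      have "(g z)\<^sup>2 = poly ?p (U z)" if z: "z \<in> ball 0 R" for z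
      proof (rule LIMSEQ_unique)
        show "(\<lambda>n. (f (r n) z)\<^sup>2) \<longlonglongrightarrow> (g z)\<^sup>2" by (intro tendsto_intros g(3) z)
        have "(\<lambda>n. (V n z)\<^sup>2) \<longlonglongrightarrow> poly ?p (U z)"
          using tendsto_prod_nhds_pointwise[of "\<lambda>n z. (V n z)\<^sup>2" _ z] Vlim[of z] by (simp add: case_prod_beta')
        then have "(\<lambda>n. (V (n + N) z)\<^sup>2) \<longlonglongrightarrow> poly ?p (U z)" by (rule LIMSEQ_ignore_initial_segment)
        from LIMSEQ_subseq_LIMSEQ[OF this g(2)]
        show "(\<lambda>n. (f (r n) z)\<^sup>2) \<longlonglongrightarrow> poly ?p (U z)" by (simp add: f_def o_def)
      qed
      then show ?thesis using g(1) by blast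
    qed
    \<comment> \<open>The bounds 2 and 1/2 for the limit of M are divided by e.\<close>
    moreover have "(\<forall>z\<in>ball c (1 / 4). norm (U z) \<le> 2 / e) \<or> (\<forall>z\<in>ball c (1 / 4). norm (U z) \<ge> 1 / 2 / e)" for c
    proof -
      have "\<forall>\<^sub>F n in sequentially. tame q (\<tau> n) (Z n) (ball c (1 / 4))"
        unfolding Z_def \<tau>_def using eventually_compose_filterlim[OF tame filterlim_subseq[OF \<sigma>]] .
      then have "(\<forall>z\<in>ball c (1 / 4). norm (U z) * e \<le> 2) \<or> (\<forall>z\<in>ball c (1 / 4). 1 / 2 \<le> norm (U z) * e)"
      proof (rule limit_tame(2)[OF _ \<tau>(1)])
        show "(\<lambda>n. norm (Z n z $ i)) \<longlonglongrightarrow> norm (X' z $ i)" for z i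
          using tendsto_prod_nhds_pointwise[of "\<lambda>n z. norm (Z n z $ i)" _ z] comp[of i z]
          by (simp add: case_prod_beta')
        show "(\<lambda>n. norm (peval (($) (Z n z)) q) / norm (\<tau> n)) \<longlonglongrightarrow> norm (U z) * e" for z
          using tendsto_prod_nhds_pointwise[of "\<lambda>n z. norm (peval (($) (Z n z)) q) / norm (\<tau> n)" _ z] MU[of z, unfolded M_def[abs_def]]
          by (simp add: case_prod_beta')
      qed
      then show ?thesis using e by (simp add: pos_le_divide_eq pos_divide_le_eq mult_ac)
    qed
    ultimately have "U constant_on UNIV"
      using e by (intro hyperelliptic_curve_constant[OF holU, where p = ?p and l = l and \<rho> = "1 / 4"
        and m = "1 / 2 / e" and M = "2 / e"]) (use l in auto)
    then have Uc: "U \<zeta> = U 0" for \<zeta> unfolding constant_on_def by (metis UNIV_I)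
    have MU0: "(M \<longlongrightarrow> norm (U 0) * e) (?F \<zeta>)" for \<zeta> using MU[of \<zeta>] unfolding Uc[of \<zeta>] .
    show False
    \<comment> \<open>U is constant, so M has the same limit at all points, and this limit is below
      2 or above 1/2.\<close>
    proof (rule contra[OF const], cases "norm (U 0) * e < 2")
      case True
      have "\<forall>\<^sub>F p in ?F \<zeta>. M p \<le> 2" for \<zeta>
        using order_tendstoD(2)[OF MU0 True] by (rule eventually_mono) simp
      then show "(\<forall>\<zeta>. \<forall>\<^sub>F p in ?F \<zeta>. M p \<le> 2) \<or> (\<forall>\<zeta>. \<forall>\<^sub>F p in ?F \<zeta>. 1 / 2 \<le> M p)" by blast
    next
      case False
      then have "1 / 2 < norm (U 0) * e" by simp
      have "\<forall>\<^sub>F p in ?F \<zeta>. 1 / 2 \<le> M p" for \<zeta>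
        using order_tendstoD(1)[OF MU0 \<open>1 / 2 < norm (U 0) * e\<close>] by (rule eventually_mono) simp
      then show "(\<forall>\<zeta>. \<forall>\<^sub>F p in ?F \<zeta>. M p \<le> 2) \<or> (\<forall>\<zeta>. \<forall>\<^sub>F p in ?F \<zeta>. 1 / 2 \<le> M p)" by blast
    qed
  qed
qed

text \<open>Otherwise all forms of degree k would vanish at x, in particular the k-th powers of the
  coordinates.\<close>

lemma forms_base_point_free:
  assumes s: "basis_of_ternary_forms k N s" and x: "x \<noteq> 0"
  shows "\<exists>j<N. peval (($) x) (s j) \<noteq> 0"
proof (rule ccontr)
  assume "\<not> ?thesis"
  then have "s ` {..<N} \<subseteq> {p. peval (($) x) p = 0}" by auto
  moreover have "mpoly.subspace {p. peval (($) x) p = 0}"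
    by (auto simp: mpoly.subspace_def peval_add peval_scale)
  ultimately have *: "ternary_forms k \<subseteq> {p. peval (($) x) p = 0}"
    using mpoly.span_minimal s unfolding basis_of_ternary_forms_def by metis
  obtain i where i: "x $ i \<noteq> 0" using x by (auto simp: vec_eq_iff)
  let ?p = "Poly_Mapping.single (Poly_Mapping.single i k) 1 :: ternary_poly"
  have "?p \<in> ternary_forms k" by (auto simp: forms_def monom_degree_def)
  moreover have "peval (($) x) ?p = x $ i ^ k" by (simp add: peval_def monom_eval_def)
  ultimately show False using * i by auto
qed

text \<open>If q vanished at all nonzero points, so would its partial derivatives at (1, 0, 0),
  against the Jacobian criterion.\<close>

lemma smooth_plane_curve_nonvanishing:
  assumes q: "smooth_plane_curve k q"
  shows "\<exists>p. p \<noteq> 0 \<and> peval (($) p) q \<noteq> 0"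
proof (rule ccontr)
  assume "\<not> ?thesis"
  then have zero: "peval (($) x) q = 0" if "x \<noteq> 0" for x using that by blast
  let ?x = "axis 1 1 :: complex ^ 3"
  have x0: "?x \<noteq> 0" by simp
  then obtain i where i: "peval (($) ?x) (mpoly_deriv i q) \<noteq> 0"
    using q zero unfolding smooth_plane_curve_def mpoly_eval_eq_peval by blast
  let ?y = "\<lambda>z. ?x + z *s axis i 1"
  have "((\<lambda>z. peval (($) (?y z)) q) has_field_derivative
      (\<Sum>v\<in>UNIV. peval (($) (?y 0)) (mpoly_deriv v q) * (axis i 1 :: complex ^ 3) $ v)) (at 0)"
    by (rule has_field_derivative_mpoly_eval) (auto intro!: derivative_eq_intros)
  moreover have "(\<Sum>v\<in>UNIV. peval (($) (?y 0)) (mpoly_deriv v q) * (axis i 1 :: complex ^ 3) $ v) =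
      peval (($) ?x) (mpoly_deriv i q)"
    by (simp add: axis_def if_distrib cong: if_cong)
  moreover have "((\<lambda>z. peval (($) (?y z)) q) has_field_derivative 0) (at 0)"
  proof (rule has_field_derivative_transform_within_open[OF DERIV_const, where S = "ball 0 1"])
    fix z :: complex assume z: "z \<in> ball 0 1"
    have "?y z \<noteq> 0"
    proof
      assume "?y z = 0"
      then have "?y z $ 1 = 0" by simp
      then have "1 + z = 0 \<or> (1::complex) = 0" by (simp add: axis_def split: if_splits)
      then have "z = -1" by (simp add: add_eq_0_iff)
      then show False using z by simp
    qed
    then show "0 = peval (($) (?y z)) q" using zero by simp
  qed auto
  ultimately show False using i DERIV_unique by fastforce
qed

theorem theorem5:
  fixes l k N :: nat and s :: "nat \<Rightarrow> ternary_poly" and s\<^sub>D :: ternary_poly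
  assumes "l \<ge> 3" and "k \<ge> 5"
    and "basis_of_ternary_forms k N s"
    and "smooth_plane_curve k s\<^sub>D"
    and "brody_hyperbolic P2_atlas (P2 - plane_curve s\<^sub>D)"
  shows "holds_for_generic_small_deformation N s (2 * l) s\<^sub>D
           (\<lambda>G. brody_hyperbolic (O_atlas (l * k)) (double_cover (l * k) G))"
proof -
  let ?q = "s\<^sub>D" let ?H = "\<lambda>F t. brody_hyperbolic (O_atlas (l * k)) (double_cover (l * k) (deformation (2 * l) s ?q F t))"
  have q: "?q \<in> ternary_forms k" using assms(4) by (simp add: smooth_plane_curve_def)
  have s: "s j \<in> ternary_forms k" if "j < N" for j
    using assms(3) mpoly.span_base[of "s j" "s ` {..<N}"] that by (auto simp: basis_of_ternary_forms_def)
  have k: "k > 0" "k \<ge> 4" "l \<ge> 1" using assms(1,2) by auto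
  obtain p where p: "p \<noteq> 0" "peval (($) p) ?q \<noteq> 0" using smooth_plane_curve_nonvanishing[OF assms(4)] by blast
  have "\<exists>U. zariski_open_params N (2 * l) U \<and> U \<noteq> {} \<and>
      (\<forall>F\<in>U. F \<in> deformation_params N (2 * l) \<and> \<not> bad_param (2 * l) s ?q F)"
    by (rule generic_params_not_bad[OF assms(1) k(1) s _ q p(2,1)]) (blast intro: forms_base_point_free[OF assms(3)])+
  then obtain U where U: "zariski_open_params N (2 * l) U" "U \<noteq> {}"
    and good: "\<And>F. F \<in> U \<Longrightarrow> \<not> bad_param (2 * l) s ?q F" by blast
  have "\<exists>\<epsilon>>0. \<forall>t. 0 < cmod t \<and> cmod t \<le> \<epsilon> \<longrightarrow> ?H F t" if F: "F \<in> U" for F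
  proof (rule ccontr)
    assume "\<not> ?thesis"
    then have neg: "\<exists>t. 0 < cmod t \<and> cmod t \<le> \<epsilon> \<and> \<not> ?H F t" if "\<epsilon> > 0" for \<epsilon> using that by blast
    have "\<exists>t. 0 < cmod t \<and> cmod t \<le> inverse (real (Suc n)) \<and> \<not> ?H F t" for n by (rule neg) simp
    then obtain t where t: "\<And>n. 0 < cmod (t n)" "\<And>n. cmod (t n) \<le> inverse (real (Suc n))" "\<And>n. \<not> ?H F (t n)"
      by metis
    have t0: "t n \<noteq> 0" for n using t(1)[of n] by auto
    have lim: "t \<longlonglongrightarrow> 0"
      by (rule Lim_null_comparison[OF _ LIMSEQ_inverse_real_of_nat]) (use t(2) in auto)
    have "\<exists>X Y. cover_curve (l * k) (deformation (2 * l) s ?q F (t n)) X Y \<and> \<not> tame ?q (t n) X (ball 0 2) \<and>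
        (\<forall>c. norm c < real (Suc n) \<longrightarrow> tame ?q (t n) X (ball c (1 / 4)))" for n
    proof -
      obtain f where f: "entire_curve (O_atlas (l * k)) f"
          "range f \<subseteq> double_cover (l * k) (deformation (2 * l) s ?q F (t n))" "\<not> f constant_on UNIV"
        using t(3)[of n] unfolding brody_hyperbolic_def by blast
      obtain X Y where C: "cover_curve (l * k) (deformation (2 * l) s ?q F (t n)) X Y"
        by (rule cover_curve_of_entire_curve[OF f])
      \<comment> \<open>Used as the radius L of the region of good centres, which exhausts the plane
        as n grows.\<close>
      have "real (Suc n) > 0" by simp
      from rescaled_cover_curve[OF C t0 q this] show ?thesis by blast
    qed
    then obtain X Y where XY: "\<And>n. cover_curve (l * k) (deformation (2 * l) s ?q F (t n)) (X n) (Y n)"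
        "\<And>n. \<not> tame ?q (t n) (X n) (ball 0 2)"
        "\<And>n c. norm c < real (Suc n) \<Longrightarrow> tame ?q (t n) (X n) (ball c (1 / 4))" by metis
    have tm: "\<forall>\<^sub>F n in sequentially. tame ?q (t n) (X n) (ball c (1 / 4))" for c
    proof -
      obtain N0 where N0: "norm c < real N0" using reals_Archimedean2 by blast
      show ?thesis
        by (rule eventually_sequentiallyI[of N0], rule XY(3)) (use N0 in simp)
    qed
    show False
      by (rule no_degenerating_cover_curves[OF k(3,2) assms(4,5) good[OF F] t0 lim XY(1) tm XY(2)])
  qed
  then show ?thesis unfolding holds_for_generic_small_deformation_def using U by blast
qed

end
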